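(* Let $E=\mathbb{C}^d$, $F=\mathbb{C}^r$, $p\in\mathbb{R}^d\subset E$, let $K_0\subset E$ be a compact absolutely convex neighbourhood of $0$ and $K:=p+K_0$. Let $f:K\to F$ be an analytic map. Let $m,n\in\mathbb{Z}_{\ge0}$ with $m\le n$. Let $\mathbf{C}_m$ be the representation matrix of $\widetilde{f_*}|_{\widetilde{\mathfrak{D}}_{p,m}}:\widetilde{\mathfrak{D}}_{p,m}\to\widetilde{\mathfrak{D}}_{f(p),m}$ with respect to the bases $(u_{p,i})_{i=1}^{r_m^E}$ and $(v_{f(p),i})_{i=1}^{r_m^F}$. Let $\mu$ be a (Borel) probability measure on $K_0$ with $\mathrm{supp}(\mu)\subset K_0$. Let $z_0^1,\dots,z_0^N\in\mathrm{supp}(\mu)$, $\widehat\mu_N:=N^{-1}\sum_{i=1}^N\delta_{z_0^i}$ and $Z_N:=(p+z_0^1,\dots,p+z_0^N)\in K^N$. Assume that $\mathbf{D}_n(\mu)$ is invertible and that there exists $\gamma\in(0,1)$ such that $$\big\|\mathbf{I}-\mathbf{D}_n(\mu)^{-1/2}\mathbf{D}_n(\widehat\mu_N)\mathbf{D}_n(\mu)^{-1/2}\big\|_{\rm op}\le1-\gamma.$$ Then $$\big\|\mathbf{C}_m-\widehat{\mathbf{C}}_{m,n,Z_N}\big\|_{\rm Fr}\le C\sqrt{\frac{m!}{\gamma}}\cdot\frac{R_\mu^n}{\Lambda_n(\mu)^{1/2}},$$ where $R_\mu:=\sup_{x\in\mathrm{supp}(\mu)}|x|_{K_0}$ and $C>0$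 is a constant depending only on $f,p,K_0$ and $\mu$.
   Context: $E=\mathbb{C}^d$ and $F=\mathbb{C}^r$ carry the standard Hermitian inner products $\langle z,w\rangle=w^*z=\sum_i z_i\overline{w_i}$. A set $S$ is absolutely convex if $ax+by\in S$ whenever $x,y\in S$ and $a,b\in\mathbb{C}$, $|a|+|b|\le1$. $|z|_{K_0}:=\inf\{t>0: z\in tK_0\}$. $\mathbf{e}_\zeta(z):=e^{\zeta^*z}$. $\|\cdot\|_{\rm Fr}$ and $\|\cdot\|_{\rm op}$ are the Frobenius and operator norms, $\dagger$ the Moore–Penrose pseudo-inverse. A map on a compact set $K$ is analytic if it is the restriction of a holomorphic map on an open neighbourhood of $K$. Bases and matrices. Fix a numbering $\{\alpha^{(i)}\}_{i\ge1}$ of $\mathbb{Z}_{\ge0}^d$ with $\alpha^{(1)}=0$, $\alpha^{(i+1)}$ the $i$-th elementary vector for $1\le i\le d$, and $|\alpha^{(i)}|\le|\alpha^{(j)}|$ for $i\le j$; similarly $\{\beta^{(i)}\}$ of $\mathbb{Z}_{\ge0}^r$. Put $r_n^E=\binom{n+d}{d}$, $r_n^F=\binom{n+r}{r}$, $$u_{p,i}(z)=\frac{e^{-\|p\|^2/2}}{\sqrt{\alpha^{(i)}!}}(z-p)^{\alpha^{(i)}}e^{p^*z},\qquad v_{q,i}(w)=\frac{e^{-\|q\|^2/2}}{\sqrt{\beta^{(i)}!}}(w-q)^{\beta^{(i)}}e^{q^*w},$$ and row vectors $\mathbf{u}_{p,n}(z)=(u_{p,1}(z),\dots,u_{p,r_n^E}(z))$,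 $\mathbf{v}_{q,n}(w)=(v_{q,1}(w),\dots,v_{q,r_n^F}(w))$. For $Z=(z^1,\dots,z^N)\in E^N$ let $\mathbf{U}_{p,n,Z}\in\mathbb{C}^{N\times r_n^E}$ be the matrix with rows $\mathbf{u}_{p,n}(z^i)$; for $W=(w^1,\dots,w^N)\in F^N$ let $\mathbf{V}_{q,n,W}\in\mathbb{C}^{N\times r_n^F}$ be the matrix with rows $\mathbf{v}_{q,n}(w^i)$. For $Z\in K^N$, $W=(f(z^1),\dots,f(z^N))$ and $m\le n$, $\widehat{\mathbf{C}}_{m,n,Z}\in\mathbb{C}^{r_m^F\times r_m^E}$ consists of the first $r_m^E$ columns of $\mathbf{V}_{f(p),m,W}^*(\mathbf{U}_{p,n,Z}^* )^\dagger$. Moment matrices. For a Borel measure $\mu$ on $E$ (with the relevant moments finite), $\mathbf{D}_n(\mu)=\big(\int\overline{z^{\alpha^{(i)}}}z^{\alpha^{(j)}}d\mu(z)\big)_{i,j=1}^{r_n^E}$ and $\Lambda_n(\mu)$ is its smallest eigenvalue. Push-forward. For compact $S$, $\mathcal{O}_E(S)$ is the space of germs on $S$ of holomorphic functions (inductive limit of $\mathcal{O}_E(U)$ over open $U\supset S$), and $'$ denotes the continuous dual. $f_*:\mathcal{O}_E(K)'\to\mathcal{O}_F(F)'$ is $f_*(\nu)(h)=\nu(h\circ f)$. For $\nu\in\mathcal{O}_E(K)'$, $\overline{\mathbf{FB}}_E(\nu)(\zeta):=\overline{\nu(\mathbf{e}_\zeta)}$, an injective antilinear map into entire functions on $E$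 ($K$ compact convex); similarly $\overline{\mathbf{FB}}_F$ on $\mathcal{O}_F(F)'$. $\widetilde{f_*}:=\overline{\mathbf{FB}}_F\circ f_*\circ\overline{\mathbf{FB}}_E^{-1}$. $\mathfrak{D}_{p,n}$ is the span of the functionals $h\mapsto(\partial^\alpha h)(p)$, $|\alpha|\le n$, and $\widetilde{\mathfrak{D}}_{p,n}=\overline{\mathbf{FB}}_E(\mathfrak{D}_{p,n})=\{P\mathbf{e}_p: P\text{ polynomial on }E,\ \deg P\le n\}$, with basis $(u_{p,i})_{i\le r_n^E}$; similarly $\widetilde{\mathfrak{D}}_{q,n}$ on $F$ with basis $(v_{q,i})_{i\le r_n^F}$. $\widetilde{f_*}$ maps $\widetilde{\mathfrak{D}}_{p,m}$ into $\widetilde{\mathfrak{D}}_{f(p),m}$. The representation matrix $(C_{ij})$ of a linear map $L$ with respect to bases $(b_j),(b'_i)$ is given by $L(b_j)=\sum_iC_{ij}b'_i$. *)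

theory Defs
  imports
    "HOL-Probability.Probability"
    "Jordan_Normal_Form.Schur_Decomposition"
begin

no_notation Matrix.vec_index (infixl "$" 100)

definition abs_convex :: "(complex^'d) set \<Rightarrow> bool" where
  "abs_convex S \<longleftrightarrow>
     (\<forall>x\<in>S. \<forall>y\<in>S. \<forall>a b. cmod a + cmod b \<le> 1 \<longrightarrow> a *s x + b *s y \<in> S)"

definition minkowski_gauge :: "(complex^'d) set \<Rightarrow> complex^'d \<Rightarrow> real" where
  "minkowski_gauge S z = Inf {t. t > 0 \<and> z \<in> (\<lambda>x. t *\<^sub>R x) ` S}"

definition msupp :: "'a::topological_space measure \<Rightarrow> 'a set" where
  "msupp M = {x. \<forall>U. open U \<longrightarrow> x \<in> U \<longrightarrow> emeasure M U > 0}"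

definition empirical :: "nat \<Rightarrow> (nat \<Rightarrow> 'a::topological_space) \<Rightarrow> 'a measure" where
  "empirical N x = measure_of UNIV (sets borel)
     (\<lambda>A. ennreal (1 / real N) * (\<Sum>i<N. emeasure (return borel (x i)) A))"

definition l2_vec :: "complex Matrix.vec \<Rightarrow> real" where
  "l2_vec v = sqrt (\<Sum>i<dim_vec v. (cmod (vec_index v i))\<^sup>2)"

definition op_norm :: "complex mat \<Rightarrow> real" where
  "op_norm A = (SUP v\<in>{v \<in> carrier_vec (dim_col A). l2_vec v \<le> 1}. l2_vec (A *\<^sub>v v))"

definition frob_norm :: "complex mat \<Rightarrow> real" where
  "frob_norm A = sqrt (\<Sum>i<dim_row A. \<Sum>j<dim_col A. (cmod (A $$ (i, j)))\<^sup>2)"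

definition penrose_inverse :: "complex mat \<Rightarrow> complex mat" where
  "penrose_inverse A = (THE X. X \<in> carrier_mat (dim_col A) (dim_row A)
     \<and> A * X * A = A \<and> X * A * X = X
     \<and> mat_adjoint (A * X) = A * X \<and> mat_adjoint (X * A) = X * A)"

definition psd_mat :: "complex mat \<Rightarrow> bool" where
  "psd_mat A \<longleftrightarrow> square_mat A \<and> mat_adjoint A = A
     \<and> (\<forall>v\<in>carrier_vec (dim_row A). Re ((A *\<^sub>v v) \<bullet>c v) \<ge> 0)"

definition inv_sqrt_mat :: "complex mat \<Rightarrow> complex mat" where
  "inv_sqrt_mat A = (THE B. B \<in> carrier_mat (dim_row A) (dim_row A) \<and> psd_mat B
     \<and> inverts_mat A (B * B) \<and> inverts_mat (B * B) A)"

definition min_eigenvalue :: "complex mat \<Rightarrow> real" where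
  "min_eigenvalue A = Min {x. eigenvalue A (complex_of_real x)}"

text \<open>Representation matrix of \<open>L\<close> with respect to \<open>b 0, \<dots>, b (k - 1)\<close> and
  \<open>b' 0, \<dots>, b' (l - 1)\<close>, for subspaces of a space of functions.\<close>
definition rep_matrix ::
  "(('a \<Rightarrow> complex) \<Rightarrow> 'b \<Rightarrow> complex) \<Rightarrow> nat \<Rightarrow> (nat \<Rightarrow> 'a \<Rightarrow> complex)
    \<Rightarrow> nat \<Rightarrow> (nat \<Rightarrow> 'b \<Rightarrow> complex) \<Rightarrow> complex mat" where
  "rep_matrix L k b l b' = (THE A. A \<in> carrier_mat l k
     \<and> (\<forall>j<k. L (b j) = (\<lambda>w. \<Sum>i<l. A $$ (i, j) * b' i w)))"

definition mdeg :: "('d::finite \<Rightarrow> nat) \<Rightarrow> nat" where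
  "mdeg a = (\<Sum>i\<in>UNIV. a i)"

definition mfact :: "('d::finite \<Rightarrow> nat) \<Rightarrow> nat" where
  "mfact a = (\<Prod>i\<in>UNIV. fact (a i))"

definition mpow :: "complex^'d \<Rightarrow> ('d \<Rightarrow> nat) \<Rightarrow> complex" where
  "mpow z a = (\<Prod>i\<in>UNIV. (z $ i) ^ a i)"

text \<open>Numberings are indexed from \<open>0\<close>, as are rows and columns of matrices. The bijection \<open>c\<close>
  is the labelling of the coordinates by \<open>1, \<dots>, d\<close>, since the index type \<open>'d\<close> carries none.\<close>
definition numbering :: "(nat \<Rightarrow> 'd::finite \<Rightarrow> nat) \<Rightarrow> bool" where
  "numbering \<alpha> \<longleftrightarrow> bij \<alpha> \<and> \<alpha> 0 = (\<lambda>_. 0)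
     \<and> (\<exists>c. bij_betw c {1..CARD('d)} (UNIV :: 'd set)
            \<and> (\<forall>i\<in>{1..CARD('d)}. \<alpha> i = (\<lambda>k. if k = c i then 1 else 0)))
     \<and> (\<forall>i j. i \<le> j \<longrightarrow> mdeg (\<alpha> i) \<le> mdeg (\<alpha> j))"

definition rdim :: "nat \<Rightarrow> nat \<Rightarrow> nat" where
  "rdim d n = (n + d) choose d"

text \<open>\<open>\<langle>z, w\<rangle> = w\<^sup>* z\<close>, linear in the first argument.\<close>
definition herm :: "complex^'d \<Rightarrow> complex^'d \<Rightarrow> complex" where
  "herm z w = (\<Sum>i\<in>UNIV. z $ i * cnj (w $ i))"

definition expf :: "complex^'d \<Rightarrow> complex^'d \<Rightarrow> complex" where
  "expf \<zeta> z = exp (herm z \<zeta>)"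

text \<open>Used both for \<open>u\<^bsub>p,i\<^esub>\<close> on \<open>E\<close> and \<open>v\<^bsub>q,i\<^esub>\<close> on \<open>F\<close>.\<close>
definition fock_basis ::
  "(nat \<Rightarrow> 'd \<Rightarrow> nat) \<Rightarrow> complex^'d \<Rightarrow> nat \<Rightarrow> complex^'d \<Rightarrow> complex" where
  "fock_basis \<alpha> p i z =
     complex_of_real (exp (- (norm p)\<^sup>2 / 2) / sqrt (real (mfact (\<alpha> i))))
       * mpow (z - p) (\<alpha> i) * exp (herm z p)"

text \<open>Used both for \<open>U\<^bsub>p,n,Z\<^esub>\<close> and \<open>V\<^bsub>q,n,W\<^esub>\<close>; the sample points are \<open>x 0, \<dots>, x (N - 1)\<close>.\<close>
definition sample_mat ::
  "(nat \<Rightarrow> 'd \<Rightarrow> nat) \<Rightarrow> complex^'d \<Rightarrow> nat \<Rightarrow> nat \<Rightarrow> (nat \<Rightarrow> complex^'d) \<Rightarrow> complex mat" where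
  "sample_mat \<alpha> p n N x =
     Matrix.mat N (rdim CARD('d) n) (\<lambda>(i, j). fock_basis \<alpha> p j (x i))"

definition C_hat ::
  "(nat \<Rightarrow> 'd \<Rightarrow> nat) \<Rightarrow> (nat \<Rightarrow> 'r \<Rightarrow> nat) \<Rightarrow> (complex^'d \<Rightarrow> complex^'r) \<Rightarrow> complex^'d
    \<Rightarrow> nat \<Rightarrow> nat \<Rightarrow> nat \<Rightarrow> (nat \<Rightarrow> complex^'d) \<Rightarrow> complex mat" where
  "C_hat \<alpha> \<beta> f p m n N x =
     (let P = mat_adjoint (sample_mat \<beta> (f p) m N (\<lambda>i. f (x i)))
                * penrose_inverse (mat_adjoint (sample_mat \<alpha> p n N x))
      in Matrix.mat (rdim CARD('r) m) (rdim CARD('d) m) (\<lambda>(i, j). P $$ (i, j)))"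

definition moment_mat ::
  "(nat \<Rightarrow> 'd \<Rightarrow> nat) \<Rightarrow> nat \<Rightarrow> (complex^'d) measure \<Rightarrow> complex mat" where
  "moment_mat \<alpha> n M = Matrix.mat (rdim CARD('d) n) (rdim CARD('d) n)
     (\<lambda>(i, j). LINT z|M. cnj (mpow z (\<alpha> i)) * mpow z (\<alpha> j))"

text \<open>Holomorphic in several variables: Frechet differentiable with complex linear derivative.\<close>
definition hol_on :: "(complex^'d) set \<Rightarrow> (complex^'d \<Rightarrow> complex) \<Rightarrow> bool" where
  "hol_on U h \<longleftrightarrow>
     (\<forall>z\<in>U. \<exists>D. (h has_derivative D) (at z) \<and> (\<forall>c v. D (c *s v) = c * D v))"

definition hol_map_on :: "(complex^'d) set \<Rightarrow> (complex^'d \<Rightarrow> complex^'r) \<Rightarrow> bool" where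
  "hol_map_on U g \<longleftrightarrow>
     (\<forall>z\<in>U. \<exists>D. (g has_derivative D) (at z) \<and> (\<forall>c v. D (c *s v) = c *s D v))"

text \<open>The values of \<open>f\<close> off \<open>K\<close> are irrelevant.\<close>
definition analytic_map_on :: "(complex^'d) set \<Rightarrow> (complex^'d \<Rightarrow> complex^'r) \<Rightarrow> bool" where
  "analytic_map_on K f \<longleftrightarrow>
     (\<exists>U g. open U \<and> K \<subseteq> U \<and> hol_map_on U g \<and> (\<forall>z\<in>K. g z = f z))"

definition hol_near :: "(complex^'d) set \<Rightarrow> (complex^'d \<Rightarrow> complex) \<Rightarrow> bool" where
  "hol_near S h \<longleftrightarrow> (\<exists>U. open U \<and> S \<subseteq> U \<and> hol_on U h)"

definition germ ::
  "(complex^'d) set \<Rightarrow> (complex^'d \<Rightarrow> complex) \<Rightarrow> (complex^'d \<Rightarrow> complex) set" where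
  "germ S h = {g. hol_near S g \<and> (\<exists>U. open U \<and> S \<subseteq> U \<and> (\<forall>z\<in>U. g z = h z))}"

definition germs :: "(complex^'d) set \<Rightarrow> (complex^'d \<Rightarrow> complex) set set" where
  "germs S = germ S ` {h. hol_near S h}"

text \<open>The continuous dual of the space of germs on \<open>S\<close>. A linear functional on the locally convex
  inductive limit is continuous iff it is continuous on the space of holomorphic functions on each
  open \<open>U \<supseteq> S\<close> with the topology of compact convergence, given by the seminorms
  \<open>h \<mapsto> sup\<^bsub>L\<^esub> |h|\<close>, \<open>L \<subseteq> U\<close> compact (a directed family).
  For \<open>S = UNIV\<close> the germs are the singletons of entire functions, and this is the dual of the
  space of entire functions.\<close>
definition dual_germs ::
  "(complex^'d) set \<Rightarrow> ((complex^'d \<Rightarrow> complex) set \<Rightarrow> complex) set" where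
  "dual_germs S = {\<nu> \<in> extensional (germs S).
     (\<forall>g h a b. hol_near S g \<longrightarrow> hol_near S h \<longrightarrow>
        \<nu> (germ S (\<lambda>z. a * g z + b * h z)) = a * \<nu> (germ S g) + b * \<nu> (germ S h))
     \<and> (\<forall>U. open U \<longrightarrow> S \<subseteq> U \<longrightarrow>
          (\<exists>L B. compact L \<and> L \<noteq> {} \<and> L \<subseteq> U
             \<and> (\<forall>h. hol_on U h \<longrightarrow> cmod (\<nu> (germ S h)) \<le> B * (SUP z\<in>L. cmod (h z)))))}"

text \<open>The germ on \<open>K\<close> of an analytic function given on \<open>K\<close> only. It is unique when \<open>K\<close> is convex
  with nonempty interior, by the identity theorem.\<close>
definition germ_of_restriction ::
  "(complex^'d) set \<Rightarrow> (complex^'d \<Rightarrow> complex) \<Rightarrow> (complex^'d \<Rightarrow> complex) set" where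
  "germ_of_restriction K k = (THE G. G \<in> germs K \<and> (\<forall>g\<in>G. \<forall>z\<in>K. g z = k z))"

definition push_forward ::
  "(complex^'d) set \<Rightarrow> (complex^'d \<Rightarrow> complex^'r)
    \<Rightarrow> ((complex^'d \<Rightarrow> complex) set \<Rightarrow> complex) \<Rightarrow> (complex^'r \<Rightarrow> complex) set \<Rightarrow> complex" where
  "push_forward K f \<nu> =
     (\<lambda>H\<in>germs UNIV. \<nu> (germ_of_restriction K (the_elem H \<circ> f)))"

definition FB_conj ::
  "(complex^'d) set \<Rightarrow> ((complex^'d \<Rightarrow> complex) set \<Rightarrow> complex) \<Rightarrow> complex^'d \<Rightarrow> complex" where
  "FB_conj S \<nu> \<zeta> = cnj (\<nu> (germ S (expf \<zeta>)))"

definition push_tilde ::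
  "(complex^'d) set \<Rightarrow> (complex^'d \<Rightarrow> complex^'r)
    \<Rightarrow> (complex^'d \<Rightarrow> complex) \<Rightarrow> complex^'r \<Rightarrow> complex" where
  "push_tilde K f = FB_conj UNIV \<circ> push_forward K f \<circ> inv_into (dual_germs K) (FB_conj K)"

text \<open>The representation matrix of \<open>push_tilde K f\<close> from the span of
  \<open>u\<^bsub>p,i\<^esub>\<close> to the span of \<open>v\<^bsub>f(p),i\<^esub>\<close>, in degree at most \<open>m\<close>.\<close>
definition C_mat ::
  "(nat \<Rightarrow> 'd \<Rightarrow> nat) \<Rightarrow> (nat \<Rightarrow> 'r \<Rightarrow> nat) \<Rightarrow> (complex^'d) set
    \<Rightarrow> (complex^'d \<Rightarrow> complex^'r) \<Rightarrow> complex^'d \<Rightarrow> nat \<Rightarrow> complex mat" where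
  "C_mat \<alpha> \<beta> K f p m = rep_matrix (push_tilde K f)
     (rdim CARD('d) m) (fock_basis \<alpha> p) (rdim CARD('r) m) (fock_basis \<beta> (f p))"

end

theory Submission
  imports Defs "HOL-Complex_Analysis.Cauchy_Integral_Formula" "Jordan_Normal_Form.Spectral_Radius"
begin

text \<open>The push-forward is computed by duality. Write \<open>q = f p\<close>. The function \<open>u\<^sub>j\<close> is the conjugate
transform of an explicit functional \<open>\<nu>\<^sub>j\<close>, a Taylor coefficient at \<open>p\<close>:
\<open>\<nu>\<^sub>j h\<close> is a multiple of the coefficient of \<open>(z - p)\<^bsup>\<alpha> j\<^esup>\<close> in \<open>exp (- p\<^sup>* (z - p)) h z\<close>
(\<open>FB_conj_fock_germ\<close>). The transform is injective, so \<open>\<nu>\<^sub>j\<close> is the only preimage of \<open>u\<^sub>j\<close>.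
Pushing forward and transforming gives \<open>\<zeta> \<mapsto> cnj (\<nu>\<^sub>j (e\<^sub>\<zeta> \<circ> f))\<close>, and the reproducing identity
\<open>e\<^sub>\<zeta> w = \<Sum>\<^sub>i cnj (v\<^sub>i \<zeta>) v\<^sub>i w\<close> shows that the entries of \<open>C\<^sub>m\<close> are \<open>cnj (\<nu>\<^sub>j (v\<^sub>i \<circ> f))\<close>
(\<open>C_mat_eq\<close>). Their conjugates are the coefficients of the expansion
\<open>v\<^sub>i \<circ> f = \<Sum>\<^sub>j \<nu>\<^sub>j (v\<^sub>i \<circ> f) u\<^sub>j\<close>, a Taylor expansion in disguise.

Injectivity of the transform is a density statement. If two functionals agree on exponentials, they agree
on polynomials, because \<open>(exp (t z\<^sub>i) - 1) / t\<close> tends to \<open>z\<^sub>i\<close>; and on a balanced body the partial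
sums of the homogeneous expansion at the centre converge uniformly near the body, so the functionals
agree on all germs (\<open>inj_on_FB_conj\<close>).

Truncating the expansion of \<open>v\<^sub>i \<circ> f\<close> after degree \<open>n\<close> leaves a remainder at \<open>p + x\<close> that is bounded by
\<open>B\<^sub>i |x|\<^bsup>n\<^esup>\<close>, where \<open>|x|\<close> is the Minkowski gauge and \<open>\<Sum>\<^sub>i B\<^sub>i\<^sup>2\<close> is finite. This uses only
Cauchy estimates on complex lines through \<open>p\<close>, since \<open>f\<close> is holomorphic on a slightly larger dilation of
the body (\<open>fock_expansion_remainder\<close>).

At the sample points the expansion reads \<open>V\<^sup>* = C U\<^sup>* + E\<^sup>*\<close>, where the first columns of \<open>C\<close> form
\<open>C\<^sub>m\<close> and \<open>E\<close> is the matrix of remainders.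
The hypothesis on the empirical moment matrix makes \<open>U\<close> injective, so \<open>U\<^sup>*\<close> has the right inverse
\<open>(U\<^sup>*)\<^sup>\<dagger>\<close> and \<open>C\<^sub>m\<close> minus its estimator is \<open>- E\<^sup>* (U\<^sup>*)\<^sup>\<dagger>\<close>, restricted to the
first columns (\<open>estimator_error_entry\<close>). Since \<open>U y\<close> equals, up to scalars of modulus bounded below, a
polynomial with coefficients \<open>y\<^sub>j / sqrt (\<alpha>\<^sub>j!)\<close> sampled at the data points, \<open>|U y|\<^sup>2\<close> is at least a constant
times \<open>N \<gamma> \<Lambda> \<Sum>\<^sub>j |y\<^sub>j|\<^sup>2 / \<alpha>\<^sub>j!\<close>. Only the columns of degree at most \<open>m\<close> enter the error,
which is why \<open>m!\<close> and not \<open>n!\<close> appears (\<open>sample_mat_lower_bound\<close>, \<open>penrose_column_bound\<close>).\<close>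

no_notation Matrix.vec_index (infixl "$" 100)

section \<open>Multi-indices\<close>

text \<open>The support is restricted to \<open>S\<close> so that statements about all multi-indices can be proved by induction on
the set of variables.\<close>

definition multi_on :: "'d set \<Rightarrow> nat \<Rightarrow> ('d \<Rightarrow> nat) set" where
  "multi_on S k = {a. (\<forall>i. i \<notin> S \<longrightarrow> a i = 0) \<and> (\<Sum>i\<in>S. a i) = k}"

text \<open>A multi-index on \<open>insert x S\<close> is its value at \<open>x\<close> together with a multi-index on \<open>S\<close>; this is the induction
step in the multinomial theorem.\<close>

lemma multi_on_insert:
  assumes "finite S" "x \<notin> S"
  shows "bij_betw (\<lambda>(j, a). a(x := j)) (SIGMA j:{..k}. multi_on S (k - j)) (multi_on (insert x S) k)"
proof (rule bij_betwI[where g = "\<lambda>a. (a x, a(x := 0))"])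
  show "(\<lambda>(j, a). a(x := j)) \<in> (SIGMA j:{..k}. multi_on S (k - j)) \<rightarrow> multi_on (insert x S) k"
  proof safe
    fix j a assume "j \<le> k" and a: "a \<in> multi_on S (k - j)"
    have "(\<Sum>i\<in>S. (a(x := j)) i) = (\<Sum>i\<in>S. a i)"
      using assms by (intro sum.cong) auto
    with a \<open>j \<le> k\<close> assms show "a(x := j) \<in> multi_on (insert x S) k"
      by (auto simp: multi_on_def)
  qed
  show "(\<lambda>a. (a x, a(x := 0))) \<in> multi_on (insert x S) k \<rightarrow> (SIGMA j:{..k}. multi_on S (k - j))"
  proof
    fix a assume a: "a \<in> multi_on (insert x S) k"
    have "(\<Sum>i\<in>S. (a(x := 0)) i) = (\<Sum>i\<in>S. a i)"
      using assms by (intro sum.cong) auto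
    with a assms show "(a x, a(x := 0)) \<in> (SIGMA j:{..k}. multi_on S (k - j))"
      by (auto simp: multi_on_def)
  qed
qed (use assms in \<open>auto simp: multi_on_def fun_eq_iff\<close>)

lemma finite_multi_on: "finite S \<Longrightarrow> finite (multi_on S k)"
proof (induction S arbitrary: k rule: finite_induct)
  case empty
  have "multi_on ({} :: 'a set) k \<subseteq> {\<lambda>_. 0}" by (auto simp: multi_on_def)
  then show ?case using finite_subset by blast
next
  case (insert x S)
  have "finite (SIGMA j:{..k}. multi_on S (k - j))" using insert.IH by auto
  then show ?case using bij_betw_finite[OF multi_on_insert[OF insert.hyps]] by blast
qed

text \<open>Dividing by \<open>k!\<close> turns the multinomial theorem into the binomial theorem for divided powers, which is
applied once for each variable.\<close>

lemma multinomial_on: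
  fixes y :: "'d \<Rightarrow> complex"
  assumes "finite S"
  shows "(\<Sum>a\<in>multi_on S k. \<Prod>i\<in>S. y i ^ a i / fact (a i)) = (\<Sum>i\<in>S. y i) ^ k / fact k"
  using assms
proof (induction S arbitrary: k rule: finite_induct)
  case empty
  show ?case
  proof (cases "k = 0")
    case True
    have "multi_on ({} :: 'd set) 0 = {\<lambda>_. 0}" by (auto simp: multi_on_def)
    then show ?thesis using True by simp
  next
    case False
    have "multi_on ({} :: 'd set) k = {}" using False by (auto simp: multi_on_def)
    then show ?thesis using False by simp
  qed
next
  case (insert x S)
  let ?s = "\<Sum>i\<in>S. y i"
  let ?F = "\<lambda>T a. \<Prod>i\<in>T. y i ^ a i / fact (a i)"
  have upd: "?F (insert x S) (a(x := j)) = y x ^ j / fact j * ?F S a" for a j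
  proof -
    have "?F S (a(x := j)) = ?F S a" using insert.hyps by (intro prod.cong) auto
    then show ?thesis using insert.hyps by simp
  qed
  have "(\<Sum>a\<in>multi_on (insert x S) k. ?F (insert x S) a)
      = (\<Sum>(j, a)\<in>(SIGMA j:{..k}. multi_on S (k - j)). y x ^ j / fact j * ?F S a)"
    unfolding sum.reindex_bij_betw[OF multi_on_insert[OF insert.hyps], symmetric]
    by (intro sum.cong refl) (clarsimp simp only: upd split: prod.splits)
  also have "\<dots> = (\<Sum>j\<le>k. \<Sum>a\<in>multi_on S (k - j). y x ^ j / fact j * ?F S a)"
    using insert.hyps by (subst sum.Sigma) (auto simp: finite_multi_on)
  also have "\<dots> = (\<Sum>j\<le>k. y x ^ j / fact j * (?s ^ (k - j) / fact (k - j)))"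
    by (simp only: sum_distrib_left[symmetric] insert.IH)
  also have "\<dots> = (\<Sum>j\<le>k. of_nat (k choose j) * y x ^ j * ?s ^ (k - j)) / fact k"
    unfolding sum_divide_distrib
    by (intro sum.cong) (auto simp: binomial_fact)
  also have "\<dots> = (y x + ?s) ^ k / fact k"
    by (simp add: binomial_ring)
  finally show ?case using insert.hyps by simp
qed

text \<open>The induction on the number of variables is the hockey-stick identity for binomial coefficients.\<close>

lemma card_multi_on:
  assumes "finite S"
  shows "card {a. (\<forall>i. i \<notin> S \<longrightarrow> a i = 0) \<and> (\<Sum>i\<in>S. a i) \<le> k} = (k + card S) choose card S"
  using assms
proof (induction S arbitrary: k rule: finite_induct)
  case empty
  have "{a :: 'a \<Rightarrow> nat. \<forall>i. a i = 0} = {\<lambda>_. 0}" by auto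
  then show ?case by simp
next
  case (insert x S)
  let ?M = "\<lambda>S k. {a. (\<forall>i. i \<notin> S \<longrightarrow> a i = 0) \<and> (\<Sum>i\<in>S. a i) \<le> (k::nat)}"
  have U: "?M T k = (\<Union>j\<in>{..k}. multi_on T j)" for T :: "'a set" and k
    by (auto simp: multi_on_def)
  have fin: "finite (?M T k)" if "finite T" for T :: "'a set" and k
    unfolding U using that by (auto simp: finite_multi_on)
  have "bij_betw (\<lambda>(j, a). a(x := j)) (SIGMA j:{..k}. ?M S (k - j)) (?M (insert x S) k)"
  proof (rule bij_betwI[where g = "\<lambda>a. (a x, a(x := 0))"])
    have eq: "(\<Sum>i\<in>S. (a(x := j)) i) = (\<Sum>i\<in>S. a i)" for a :: "'a \<Rightarrow> nat" and j
      using insert.hyps by (intro sum.cong) auto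
    show "(\<lambda>(j, a). a(x := j)) \<in> (SIGMA j:{..k}. ?M S (k - j)) \<rightarrow> ?M (insert x S) k"
    proof safe
      fix j a i assume "j \<le> k" "(\<Sum>i\<in>S. a i) \<le> k - j"
      then show "(\<Sum>i\<in>insert x S. (a(x := j)) i) \<le> k"
        unfolding sum.insert[OF insert.hyps] eq by simp
    qed (auto split: if_splits)
    show "(\<lambda>a. (a x, a(x := 0))) \<in> ?M (insert x S) k \<rightarrow> (SIGMA j:{..k}. ?M S (k - j))"
    proof safe
      fix a assume a: "(\<Sum>i\<in>insert x S. a i) \<le> k"
      then show "a x \<le> k" "(\<Sum>i\<in>S. (a(x := 0)) i) \<le> k - a x"
        unfolding sum.insert[OF insert.hyps] eq by simp_all
    qed auto
  qed (use insert.hyps in \<open>auto simp: fun_eq_iff\<close>)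
  from bij_betw_same_card[OF this, symmetric]
  have "card (?M (insert x S) k) = card (SIGMA j:{..k}. ?M S (k - j))" .
  also have "\<dots> = (\<Sum>j\<le>k. card (?M S (k - j)))"
    using insert.hyps fin by (subst card_SigmaI) auto
  also have "\<dots> = (\<Sum>j\<le>k. ((k - j) + card S) choose card S)"
    using insert.IH by simp
  also have "\<dots> = (\<Sum>j\<le>k. (card S + j) choose card S)"
    by (rule sum.reindex_bij_witness[of _ "\<lambda>j. k - j" "\<lambda>j. k - j"]) (auto simp: add.commute)
  also have "\<dots> = (\<Sum>j\<le>k. (card S + j) choose j)"
    by (intro sum.cong) (auto simp: binomial_symmetric[of "card S"])
  also have "\<dots> = Suc (card S + k) choose k"
    by (rule sum_choose_lower)
  also have "\<dots> = (k + card (insert x S)) choose card (insert x S)"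
    using insert.hyps by (subst binomial_symmetric) (auto simp: add.commute)
  finally show ?case .
qed

lemma multi_on_UNIV: "multi_on UNIV k = {a. mdeg a = k}"
  by (auto simp: multi_on_def mdeg_def)

lemma finite_mdeg: "finite {a :: 'd::finite \<Rightarrow> nat. mdeg a = k}"
  using finite_multi_on[of "UNIV :: 'd set" k] by (simp add: multi_on_UNIV)

lemma finite_mdeg_le: "finite {a :: 'd::finite \<Rightarrow> nat. mdeg a \<le> k}"
proof -
  have "{a :: 'd \<Rightarrow> nat. mdeg a \<le> k} = (\<Union>j\<in>{..k}. {a. mdeg a = j})" by auto
  then show ?thesis by (simp add: finite_mdeg)
qed

lemma multinomial:
  fixes y :: "complex^'d"
  shows "(\<Sum>i\<in>UNIV. y $ i) ^ k / fact k = (\<Sum>a | mdeg a = k. mpow y a / of_nat (mfact a))"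
  using multinomial_on[of UNIV "\<lambda>i. y $ i" k, symmetric]
  by (simp add: multi_on_UNIV mpow_def mfact_def prod_dividef)

lemma card_mdeg_le: "card {a :: 'd::finite \<Rightarrow> nat. mdeg a \<le> n} = rdim CARD('d) n"
  using card_multi_on[of "UNIV :: 'd set" n] by (simp add: mdeg_def rdim_def)

lemma numbering_image:
  fixes \<alpha> :: "nat \<Rightarrow> 'd::finite \<Rightarrow> nat"
  assumes "numbering \<alpha>"
  shows "bij_betw \<alpha> {i. mdeg (\<alpha> i) \<le> n} {a. mdeg a \<le> n}"
proof -
  have bij: "bij \<alpha>" using assms by (auto simp: numbering_def)
  have "{a. mdeg a \<le> n} \<subseteq> \<alpha> ` {i. mdeg (\<alpha> i) \<le> n}"
  proof
    fix a :: "'d \<Rightarrow> nat" assume "a \<in> {a. mdeg a \<le> n}"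
    moreover obtain i where "a = \<alpha> i" using bij_is_surj[OF bij] by (rule surjE)
    ultimately show "a \<in> \<alpha> ` {i. mdeg (\<alpha> i) \<le> n}" by blast
  qed
  moreover have "inj_on \<alpha> {i. mdeg (\<alpha> i) \<le> n}"
    using bij_is_inj[OF bij] subset_UNIV by (rule inj_on_subset)
  ultimately show ?thesis by (auto simp: bij_betw_def)
qed

text \<open>A numbering lists the degrees in increasing order, so the indices of degree at most \<open>n\<close> form an initial
segment, and its length is the number of such multi-indices.\<close>

lemma numbering_less_iff:
  fixes \<alpha> :: "nat \<Rightarrow> 'd::finite \<Rightarrow> nat"
  assumes "numbering \<alpha>"
  shows "i < rdim CARD('d) n \<longleftrightarrow> mdeg (\<alpha> i) \<le> n"
proof -
  let ?A = "{i. mdeg (\<alpha> i) \<le> n}"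
  have mono: "\<And>i j. i \<le> j \<Longrightarrow> mdeg (\<alpha> i) \<le> mdeg (\<alpha> j)"
    using assms by (auto simp: numbering_def)
  have card: "card ?A = rdim CARD('d) n" and fin: "finite ?A"
    using bij_betw_same_card[OF numbering_image[OF assms, of n]]
      bij_betw_finite[OF numbering_image[OF assms, of n]]
    by (auto simp: card_mdeg_le finite_mdeg_le)
  have "{..<card ?A} = ?A"
  proof (rule card_subset_eq[OF fin])
    show "{..<card ?A} \<subseteq> ?A"
    proof (rule ccontr)
      assume "\<not> ?thesis"
      then obtain j where j: "j < card ?A" "j \<notin> ?A" by blast
      have "?A \<subseteq> {..<j}"
      proof
        fix i assume "i \<in> ?A"
        then have "\<not> j \<le> i" using mono[of j i] j by auto
        then show "i \<in> {..<j}" by simp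
      qed
      then have "card ?A \<le> j" using card_mono[of "{..<j}" ?A] by simp
      with j show False by simp
    qed
  qed simp
  then have "i < card ?A \<longleftrightarrow> i \<in> ?A" by blast
  then show ?thesis unfolding card by simp
qed

lemma numbering_bij:
  fixes \<alpha> :: "nat \<Rightarrow> 'd::finite \<Rightarrow> nat"
  assumes "numbering \<alpha>"
  shows "bij_betw \<alpha> {..<rdim CARD('d) n} {a. mdeg a \<le> n}"
proof -
  have "{..<rdim CARD('d) n} = {i. mdeg (\<alpha> i) \<le> n}"
    using numbering_less_iff[OF assms] by auto
  then show ?thesis using numbering_image[OF assms] by simp
qed

section \<open>Polynomials in several variables\<close>

text \<open>Lagrange basis polynomial for the nodes \<open>0, \<dots>, k\<close>.\<close>

definition lagrange_poly :: "nat \<Rightarrow> nat \<Rightarrow> complex poly" where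
  "lagrange_poly k s = (\<Prod>r\<in>{..k} - {s}. Polynomial.smult (inverse (of_nat s - of_nat r)) [:- of_nat r, 1:])"

lemma degree_lagrange_poly: "s \<le> k \<Longrightarrow> Polynomial.degree (lagrange_poly k s) \<le> k"
proof -
  assume "s \<le> k"
  have "Polynomial.degree (lagrange_poly k s) \<le> (\<Sum>r\<in>{..k} - {s}. Polynomial.degree (Polynomial.smult (inverse (of_nat s - of_nat r)) [:- of_nat r, 1::complex:]))"
    unfolding lagrange_poly_def by (rule order_trans[OF degree_prod_sum_le]) (auto simp: o_def)
  also have "\<dots> \<le> (\<Sum>r\<in>{..k} - {s}. 1)"
    by (intro sum_mono) (auto intro!: order_trans[OF degree_smult_le])
  also have "\<dots> = k" using \<open>s \<le> k\<close> by simp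
  finally show ?thesis .
qed

lemma poly_lagrange_poly: "s \<le> k \<Longrightarrow> r \<le> k \<Longrightarrow> poly (lagrange_poly k s) (of_nat r) = (if r = s then 1 else 0)"
proof (cases "r = s")
  case True
  then show ?thesis by (auto simp: lagrange_poly_def poly_prod right_diff_distrib[symmetric] mult.commute[of "of_nat _" "inverse _"] intro!: prod.neutral)
next
  case False
  assume "s \<le> k" "r \<le> k"
  then show ?thesis using False by (auto simp: lagrange_poly_def poly_prod intro!: bexI[of _ r])
qed

lemma lagrange_poly_interpolation:
  assumes "Polynomial.degree p \<le> k"
  shows "p = (\<Sum>s\<le>k. Polynomial.smult (poly p (of_nat s)) (lagrange_poly k s))"
proof (rule poly_eqI_degree[where A = "of_nat ` {..k}"])
  fix x :: complex assume "x \<in> of_nat ` {..k}"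
  then obtain r where r: "r \<le> k" "x = of_nat r" by auto
  then have "(\<Sum>s\<le>k. poly p (of_nat s) * poly (lagrange_poly k s) (of_nat r)) = (\<Sum>s\<le>k. if r = s then poly p (of_nat s) else 0)"
    by (intro sum.cong) (auto simp: poly_lagrange_poly)
  then show "poly p x = poly (\<Sum>s\<le>k. Polynomial.smult (poly p (of_nat s)) (lagrange_poly k s)) x"
    using r by (simp add: poly_sum)
next
  have c: "card (of_nat ` {..k} :: complex set) = Suc k"
    by (subst card_image) (auto intro: inj_onI)
  show "Polynomial.degree p < card (of_nat ` {..k} :: complex set)" using assms c by simp
  have "Polynomial.degree (\<Sum>s\<le>k. Polynomial.smult (poly p (of_nat s)) (lagrange_poly k s)) \<le> k"
    by (intro degree_sum_le) (auto intro!: order_trans[OF degree_smult_le] degree_lagrange_poly)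
  then show "Polynomial.degree (\<Sum>s\<le>k. Polynomial.smult (poly p (of_nat s)) (lagrange_poly k s)) < card (of_nat ` {..k} :: complex set)"
    using c by simp
qed

definition index_box :: "nat \<Rightarrow> ('d::finite \<Rightarrow> nat) set" where
  "index_box k = PiE UNIV (\<lambda>_. {..k})"

lemma finite_index_box [simp]: "finite (index_box k)"
  unfolding index_box_def by (intro finite_PiE) auto

lemma mem_index_box: "a \<in> index_box k \<longleftrightarrow> (\<forall>i. a i \<le> k)"
  by (auto simp: index_box_def PiE_def Pi_def)

lemma le_mdeg: "a i \<le> mdeg a"
  unfolding mdeg_def by (rule member_le_sum) auto

lemma mdeg_le_index_box: "mdeg a \<le> k \<Longrightarrow> a \<in> index_box k"
  using le_mdeg order_trans by (fastforce simp: mem_index_box)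

definition node :: "('d::finite \<Rightarrow> nat) \<Rightarrow> complex^'d" where
  "node s = (\<chi> i. of_nat (s i))"

text \<open>The coefficient of \<open>x\<^bsup>a\<^esup>\<close> in the tensor product Lagrange interpolant of \<open>h\<close> on the grid
\<open>{0, \<dots>, k}\<^bsup>d\<^esup>\<close>. Extracting coefficients by a finite linear combination of values makes them
linear in \<open>h\<close> and bounded by values of \<open>h\<close> without further argument.\<close>

definition grid_coeff :: "nat \<Rightarrow> (complex^'d \<Rightarrow> complex) \<Rightarrow> ('d::finite \<Rightarrow> nat) \<Rightarrow> complex" where
  "grid_coeff k h a = (\<Sum>s\<in>index_box k. (\<Prod>i\<in>UNIV. Polynomial.coeff (lagrange_poly k (s i)) (a i)) * h (node s))"

lemma grid_coeff_mpow:
  fixes a b :: "'d::finite \<Rightarrow> nat"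
  assumes "b \<in> index_box k"
  shows "grid_coeff k (\<lambda>x. mpow x b) a = (if a = b then 1 else 0)"
proof -
  have one: "(\<Sum>s\<le>k. Polynomial.coeff (lagrange_poly k s) (a i) * of_nat s ^ b i) = (if a i = b i then 1 else 0)" for i
  proof -
    have "b i \<le> k" using assms by (simp add: mem_index_box)
    then have "Polynomial.degree (Polynomial.monom (1::complex) (b i)) \<le> k" using degree_monom_le le_trans by blast
    from arg_cong[OF lagrange_poly_interpolation[OF this], of "\<lambda>q. Polynomial.coeff q (a i)"]
    show ?thesis by (auto simp: coeff_sum poly_monom mult.commute)
  qed
  have "grid_coeff k (\<lambda>x. mpow x b) a
      = (\<Sum>s\<in>index_box k. \<Prod>i\<in>UNIV. Polynomial.coeff (lagrange_poly k (s i)) (a i) * of_nat (s i) ^ b i)"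
    by (simp add: grid_coeff_def mpow_def node_def prod.distrib)
  also have "\<dots> = (\<Prod>i\<in>UNIV. \<Sum>s\<le>k. Polynomial.coeff (lagrange_poly k s) (a i) * of_nat s ^ b i)"
    unfolding index_box_def by (rule prod_sum_PiE[symmetric]) auto
  also have "\<dots> = (\<Prod>i\<in>UNIV. if a i = b i then 1 else 0)" by (simp add: one)
  also have "\<dots> = (if a = b then 1 else 0)" by (auto simp: fun_eq_iff)
  finally show ?thesis .
qed

lemma grid_coeff_sum:
  "grid_coeff k (\<lambda>x. \<Sum>j\<in>J. c j * h j x) a = (\<Sum>j\<in>J. c j * grid_coeff k (h j) a)"
  unfolding grid_coeff_def sum_distrib_left
  by (subst sum.swap) (auto intro!: sum.cong simp: mult_ac)

lemma grid_coeff_poly: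
  assumes "A \<subseteq> index_box k" "a \<in> A"
  shows "grid_coeff k (\<lambda>x. \<Sum>b\<in>A. c b * mpow x b) a = c a"
proof -
  have "finite A" using assms finite_index_box finite_subset by blast
  have "grid_coeff k (\<lambda>x. \<Sum>b\<in>A. c b * mpow x b) a = (\<Sum>b\<in>A. if a = b then c b else 0)"
    unfolding grid_coeff_sum using assms by (intro sum.cong) (auto simp: grid_coeff_mpow subset_eq)
  then show ?thesis using \<open>finite A\<close> assms by simp
qed

text \<open>Applying the coefficient functional to a vanishing linear combination isolates each coefficient.\<close>

lemma mpow_independent:
  assumes "finite A" "\<And>x :: complex^'d. (\<Sum>b\<in>A. c b * mpow x b) = 0" "a \<in> A"
  shows "c a = 0"
proof -
  define k where "k = Max (mdeg ` A)"
  have "A \<subseteq> index_box k" using assms(1) by (auto simp: k_def intro!: mdeg_le_index_box)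
  from grid_coeff_poly[OF this assms(3), of c] show ?thesis
    unfolding assms(2) by (simp add: grid_coeff_def)
qed

text \<open>Interpolation in one variable at a time; the variables in \<open>S\<close> are those already replaced by nodes.\<close>

lemma separately_polynomial_interpolation:
  fixes h :: "complex^'d \<Rightarrow> complex"
  assumes sep: "\<And>x i. \<exists>p. Polynomial.degree p \<le> k \<and> (\<forall>t. h (\<chi> j. if j = i then t else x $ j) = poly p t)"
    and "finite S"
  shows "h x = (\<Sum>s\<in>PiE S (\<lambda>_. {..k}). (\<Prod>i\<in>S. poly (lagrange_poly k (s i)) (x $ i))
                   * h (\<chi> i. if i \<in> S then of_nat (s i) else x $ i))"
  using \<open>finite S\<close>
proof (induction S rule: finite_induct)
  case empty
  show ?case by simp
next
  case (insert i S)
  let ?x = "\<lambda>S s. (\<chi> i. if i \<in> S then of_nat (s i) else x $ i) :: complex^'d"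
  have step: "h y = (\<Sum>r\<le>k. poly (lagrange_poly k r) (y $ i) * h (\<chi> j. if j = i then of_nat r else y $ j))" for y
  proof -
    obtain p where p: "Polynomial.degree p \<le> k" "\<And>t. h (\<chi> j. if j = i then t else y $ j) = poly p t"
      using sep by blast
    have "(\<chi> j. if j = i then y $ i else y $ j) = y" by (auto simp: Finite_Cartesian_Product.vec_eq_iff)
    then have "h y = poly p (y $ i)" using p(2)[of "y $ i"] by simp
    also have "\<dots> = (\<Sum>r\<le>k. poly p (of_nat r) * poly (lagrange_poly k r) (y $ i))"
      by (subst lagrange_poly_interpolation[OF p(1)]) (simp add: poly_sum)
    finally show ?thesis by (simp add: p(2) mult.commute)
  qed
  have inj: "inj_on (\<lambda>(r, s). s(i := r)) ({..k} \<times> PiE S (\<lambda>_. {..k}))"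
    using insert.hyps by (intro inj_combinator)
  have "h x = (\<Sum>s\<in>PiE S (\<lambda>_. {..k}). (\<Prod>i\<in>S. poly (lagrange_poly k (s i)) (x $ i)) * h (?x S s))"
    by (rule insert.IH)
  also have "\<dots> = (\<Sum>s\<in>PiE S (\<lambda>_. {..k}). \<Sum>r\<le>k. (\<Prod>j\<in>S. poly (lagrange_poly k (s j)) (x $ j)) *
      (poly (lagrange_poly k r) (x $ i) * h (\<chi> j. if j = i then of_nat r else ?x S s $ j)))"
    using insert.hyps by (subst step) (simp add: sum_distrib_left)
  also have "\<dots> = (\<Sum>(r, s)\<in>{..k} \<times> PiE S (\<lambda>_. {..k}). (\<Prod>j\<in>S. poly (lagrange_poly k (s j)) (x $ j)) *
      (poly (lagrange_poly k r) (x $ i) * h (\<chi> j. if j = i then of_nat r else ?x S s $ j)))"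
    by (subst sum.swap) (simp add: sum.cartesian_product)
  also have "\<dots> = (\<Sum>(r, s)\<in>{..k} \<times> PiE S (\<lambda>_. {..k}).
      (\<Prod>j\<in>insert i S. poly (lagrange_poly k ((s(i := r)) j)) (x $ j)) * h (?x (insert i S) (s(i := r))))"
  proof (intro sum.cong refl, clarify)
    fix r s
    have 1: "(\<Prod>j\<in>S. poly (lagrange_poly k ((s(i := r)) j)) (x $ j)) = (\<Prod>j\<in>S. poly (lagrange_poly k (s j)) (x $ j))"
      using insert.hyps by (intro prod.cong) auto
    have 2: "(\<chi> j. if j = i then of_nat r else ?x S s $ j) = ?x (insert i S) (s(i := r))"
      using insert.hyps by (auto simp: Finite_Cartesian_Product.vec_eq_iff)
    show "(\<Prod>j\<in>S. poly (lagrange_poly k (s j)) (x $ j)) *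
       (poly (lagrange_poly k r) (x $ i) * h (\<chi> j. if j = i then of_nat r else ?x S s $ j)) =
       (\<Prod>j\<in>insert i S. poly (lagrange_poly k ((s(i := r)) j)) (x $ j)) * h (?x (insert i S) (s(i := r)))"
      using insert.hyps unfolding 2 by (simp add: 1 del: fun_upd_apply) (simp add: mult_ac)
  qed
  also have "\<dots> = (\<Sum>s\<in>PiE (insert i S) (\<lambda>_. {..k}).
      (\<Prod>j\<in>insert i S. poly (lagrange_poly k (s j)) (x $ j)) * h (?x (insert i S) s))"
    unfolding PiE_insert_eq by (subst sum.reindex[OF inj]) (simp add: case_prod_unfold o_def)
  finally show ?case .
qed

lemma poly_eq_sum_coeff: "Polynomial.degree p \<le> k \<Longrightarrow> poly p (x::complex) = (\<Sum>a\<le>k. Polynomial.coeff p a * x ^ a)"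
  by (simp add: poly_altdef sum.mono_neutral_left coeff_eq_0 
      sum.mono_neutral_left[of "{..k}" "{..degree p}" "\<lambda>a. Polynomial.coeff p a * x ^ a"])

text \<open>A uniform degree bound in every variable suffices: interpolation on the grid reproduces the function
exactly, and the interpolant is a polynomial.\<close>

lemma separately_polynomial_imp_polynomial:
  fixes h :: "complex^'d \<Rightarrow> complex"
  assumes sep: "\<And>x i. \<exists>p. Polynomial.degree p \<le> k \<and> (\<forall>t. h (\<chi> j. if j = i then t else x $ j) = poly p t)"
  shows "h x = (\<Sum>a\<in>index_box k. grid_coeff k h a * mpow x a)"
proof -
  have "h x = (\<Sum>s\<in>index_box k. (\<Prod>i\<in>UNIV. poly (lagrange_poly k (s i)) (x $ i)) * h (node s))"
    using separately_polynomial_interpolation[OF sep finite[of UNIV], of x]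
    by (simp add: index_box_def node_def)
  also have "\<dots> = (\<Sum>s\<in>index_box k. (\<Sum>a\<in>index_box k. (\<Prod>i\<in>UNIV. Polynomial.coeff (lagrange_poly k (s i)) (a i) * (x $ i) ^ a i)) * h (node s))"
  proof (intro sum.cong refl arg_cong2[where f = "(*)"])
    fix s :: "'d \<Rightarrow> nat" assume s: "s \<in> index_box k"
    have "(\<Prod>i\<in>UNIV. poly (lagrange_poly k (s i)) (x $ i)) = (\<Prod>i\<in>UNIV. \<Sum>a\<le>k. Polynomial.coeff (lagrange_poly k (s i)) a * (x $ i) ^ a)"
      using s by (intro prod.cong refl poly_eq_sum_coeff degree_lagrange_poly) (auto simp: mem_index_box)
    also have "\<dots> = (\<Sum>a\<in>index_box k. \<Prod>i\<in>UNIV. Polynomial.coeff (lagrange_poly k (s i)) (a i) * (x $ i) ^ a i)"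
      unfolding index_box_def by (rule prod_sum_PiE) auto
    finally show "(\<Prod>i\<in>UNIV. poly (lagrange_poly k (s i)) (x $ i)) = (\<Sum>a\<in>index_box k. \<Prod>i\<in>UNIV. Polynomial.coeff (lagrange_poly k (s i)) (a i) * (x $ i) ^ a i)" .
  qed
  also have "\<dots> = (\<Sum>a\<in>index_box k. grid_coeff k h a * mpow x a)"
    unfolding grid_coeff_def sum_distrib_right
    by (subst sum.swap) (simp add: prod.distrib mpow_def mult_ac)
  finally show ?thesis .
qed

section \<open>Homogeneous expansion of holomorphic functions\<close>

lemma norm_smult_vec: "norm (c *s x) = cmod c * norm (x :: complex^'d)"
  by (simp add: norm_vec_def norm_mult L2_set_right_distrib)

lemma bounded_linear_smult_vec: "bounded_linear (\<lambda>t. t *s (x :: complex^'d))"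
  by (rule bounded_linear_intro[where K = "norm x"])
     (auto simp: norm_smult_vec Finite_Cartesian_Product.vec_eq_iff ring_distribs)

lemma continuous_slice [continuous_intros]: "continuous_on S (\<lambda>t. a + t *s (x :: complex^'d))"
  by (intro continuous_intros linear_continuous_on bounded_linear_smult_vec)

lemma open_slice: "open U \<Longrightarrow> open {t. a + t *s (x :: complex^'d) \<in> U}"
  using continuous_open_preimage[of UNIV "\<lambda>t. a + t *s x" U] continuous_slice[of UNIV a x]
  by (simp add: vimage_def)

lemma holomorphic_slice:
  assumes "hol_on U h" "\<And>t. t \<in> T \<Longrightarrow> a + t *s x \<in> U"
  shows "(\<lambda>t. h (a + t *s x)) holomorphic_on T"
  unfolding holomorphic_on_def
proof
  fix t assume "t \<in> T"
  then obtain D where D: "(h has_derivative D) (at (a + t *s x))" "\<And>c v. D (c *s v) = c * D v"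
    using assms unfolding hol_on_def by blast
  have "((\<lambda>t. a + t *s x) has_derivative (\<lambda>s. 0 + s *s x)) (at t)"
    by (intro has_derivative_add has_derivative_const bounded_linear_imp_has_derivative bounded_linear_smult_vec)
  then have "((\<lambda>t. h (a + t *s x)) has_derivative (\<lambda>s. D (s *s x))) (at t)"
    using has_derivative_compose D(1) by fastforce
  then have "((\<lambda>t. h (a + t *s x)) has_field_derivative D x) (at t)"
    unfolding has_field_derivative_def D(2) by (simp add: mult_commute_abs[of "D x"])
  then show "(\<lambda>t. h (a + t *s x)) field_differentiable at t within T"
    using field_differentiable_at_within field_differentiable_def by blast
qed

lemma hol_on_continuous: "hol_on U h \<Longrightarrow> continuous_on U h"
  unfolding hol_on_def
  by (meson continuous_at_imp_continuous_on has_derivative_continuous)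

text \<open>The homogeneous part of degree \<open>k\<close> of \<open>h\<close> at \<open>p\<close>, defined on every vector through the slice
\<open>t \<mapsto> h (p + t x)\<close>. This reduces convergence and remainder estimates to one complex variable.\<close>

definition hom_part :: "(complex^'d \<Rightarrow> complex) \<Rightarrow> complex^'d \<Rightarrow> nat \<Rightarrow> complex^'d \<Rightarrow> complex" where
  "hom_part h p k x = (deriv ^^ k) (\<lambda>t. h (p + t *s x)) 0 / fact k"

lemma hom_part_sums:
  assumes "hol_on U h" "\<And>t. cmod t < \<theta> \<Longrightarrow> p + t *s x \<in> U" "cmod t < \<theta>"
  shows "(\<lambda>k. hom_part h p k x * t ^ k) sums h (p + t *s x)"
proof -
  have "(\<lambda>t. h (p + t *s x)) holomorphic_on ball 0 \<theta>"
    using assms by (intro holomorphic_slice) auto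
  from holomorphic_power_series[OF this, of t] show ?thesis
    using assms(3) by (simp add: hom_part_def)
qed

lemma hom_part_bound:
  assumes "hol_on U h" "\<And>t. cmod t \<le> \<theta> \<Longrightarrow> p + t *s x \<in> U" "\<theta> > 0"
    and "\<And>t. cmod t \<le> \<theta> \<Longrightarrow> cmod (h (p + t *s x)) \<le> B"
  shows "cmod (hom_part h p k x) \<le> B / \<theta> ^ k"
proof -
  have hol: "(\<lambda>t. h (p + t *s x)) holomorphic_on cball 0 \<theta>"
    using assms by (intro holomorphic_slice) auto
  have "cmod ((deriv ^^ k) (\<lambda>t. h (p + t *s x)) 0) \<le> fact k * B / \<theta> ^ k"
    using hol assms(3,4)
    by (intro Cauchy_inequality) (auto intro: holomorphic_on_subset holomorphic_on_imp_continuous_on)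
  then show ?thesis
    by (simp add: hom_part_def norm_divide field_simps)
qed

text \<open>The tail of the one-variable Taylor series is dominated by a geometric series, by the Cauchy estimates.\<close>

lemma hom_part_remainder:
  assumes "hol_on U h" "\<And>t. cmod t \<le> \<theta> \<Longrightarrow> p + t *s x \<in> U" "\<theta> > 0"
    and "\<And>t. cmod t \<le> \<theta> \<Longrightarrow> cmod (h (p + t *s x)) \<le> B" "cmod t < \<theta>"
  shows "cmod (h (p + t *s x) - (\<Sum>k\<le>n. hom_part h p k x * t ^ k))
           \<le> B * (cmod t / \<theta>) ^ Suc n / (1 - cmod t / \<theta>)"
proof -
  let ?q = "cmod t / \<theta>"
  have q: "0 \<le> ?q" "?q < 1" using assms by auto
  have "(\<lambda>k. hom_part h p k x * t ^ k) sums h (p + t *s x)"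
    using assms by (intro hom_part_sums) auto
  from sums_split_initial_segment[OF this, of "Suc n"]
  have 1: "(\<lambda>k. hom_part h p (k + Suc n) x * t ^ (k + Suc n))
      sums (h (p + t *s x) - (\<Sum>k\<le>n. hom_part h p k x * t ^ k))"
    unfolding lessThan_Suc_atMost .
  have "(\<lambda>k. B * ?q ^ Suc n * ?q ^ k) sums (B * ?q ^ Suc n * (1 / (1 - ?q)))"
    using q by (intro sums_mult geometric_sums) auto
  moreover have "cmod (hom_part h p (k + Suc n) x * t ^ (k + Suc n)) \<le> B * ?q ^ Suc n * ?q ^ k" for k
  proof -
    have "cmod (hom_part h p (k + Suc n) x * t ^ (k + Suc n)) \<le> B / \<theta> ^ (k + Suc n) * cmod t ^ (k + Suc n)"
      unfolding norm_mult norm_power using assms by (intro mult_right_mono hom_part_bound) auto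
    also have "\<dots> = B * ?q ^ (k + Suc n)" by (simp only: power_divide) simp
    finally show ?thesis by (simp only: power_add mult_ac)
  qed
  ultimately have "cmod (h (p + t *s x) - (\<Sum>k\<le>n. hom_part h p k x * t ^ k)) \<le> B * ?q ^ Suc n * (1 / (1 - ?q))"
    by (intro norm_sums_le[OF 1])
  then show ?thesis by simp
qed

lemma hom_part_scale:
  assumes "hol_on U h" "open U" "p \<in> U"
  shows "hom_part h p k (c *s x) = c ^ k * hom_part h p k x"
proof -
  have "(deriv ^^ k) (\<lambda>t. h (p + (c * t) *s x)) 0 = c ^ k * (deriv ^^ k) (\<lambda>t. h (p + t *s x)) (c * 0)"
  proof (rule higher_deriv_compose_linear[where f = "\<lambda>t. h (p + t *s x)" and T = "{t. p + t *s x \<in> U}"])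
    show "(\<lambda>t. h (p + t *s x)) holomorphic_on {t. p + t *s x \<in> U}"
      using assms by (intro holomorphic_slice) auto
    show "open {t. p + t *s x \<in> U}" "open {t. p + t *s (c *s x) \<in> U}"
      using open_slice[OF assms(2), of p x] open_slice[OF assms(2), of p "c *s x"] by auto
  qed (use assms in \<open>auto simp: mult.commute\<close>)
  then show ?thesis by (simp add: hom_part_def mult.commute)
qed

lemma hom_part_cong:
  assumes "open U" "p \<in> U" "\<And>z. z \<in> U \<Longrightarrow> g z = h z"
  shows "hom_part g p k x = hom_part h p k x"
proof -
  have "\<forall>\<^sub>F t in nhds 0. g (p + t *s x) = h (p + t *s x)"
    using eventually_nhds_in_open[OF open_slice[OF assms(1), of p x], of 0] assms(2)
    by (auto elim!: eventually_mono simp: assms(3))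
  then show ?thesis unfolding hom_part_def by (subst higher_deriv_cong_ev[OF _ refl]) auto
qed

lemma hom_part_linear:
  assumes "hol_on U g" "hol_on U h" "open U" "p \<in> U"
  shows "hom_part (\<lambda>z. a * g z + b * h z) p k x = a * hom_part g p k x + b * hom_part h p k x"
proof -
  let ?T = "{t. p + t *s x \<in> U}"
  have T: "open ?T" "0 \<in> ?T" using assms open_slice by auto
  have hg: "(\<lambda>t. g (p + t *s x)) holomorphic_on ?T" and hh: "(\<lambda>t. h (p + t *s x)) holomorphic_on ?T"
    using assms by (auto intro: holomorphic_slice)
  have "(deriv ^^ k) (\<lambda>t. a * g (p + t *s x) + b * h (p + t *s x)) 0
      = (deriv ^^ k) (\<lambda>t. a * g (p + t *s x)) 0 + (deriv ^^ k) (\<lambda>t. b * h (p + t *s x)) 0"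
    using T by (intro higher_deriv_add[where S = ?T]) (auto intro!: holomorphic_intros hg hh)
  then show ?thesis
    using T higher_deriv_cmult[OF hg T(2,1), of k a] higher_deriv_cmult[OF hh T(2,1), of k b]
    by (simp add: hom_part_def add_divide_distrib)
qed

lemma hol_on_local_bound:
  assumes "hol_on U h" "open U" "p \<in> U"
  obtains \<delta> B where "\<delta> > 0" "cball p \<delta> \<subseteq> U" "\<And>z. z \<in> cball p \<delta> \<Longrightarrow> cmod (h z) \<le> B" "B > 0"
proof -
  obtain \<delta> where \<delta>: "\<delta> > 0" "cball p \<delta> \<subseteq> U" using assms open_contains_cball by blast
  have "compact (h ` cball p \<delta>)"
    using \<delta> hol_on_continuous[OF assms(1)] continuous_on_subset
    by (intro compact_continuous_image) auto
  then obtain B where "B > 0" "\<And>z. z \<in> cball p \<delta> \<Longrightarrow> cmod (h z) \<le> B"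
    using compact_imp_bounded bounded_pos by (metis imageI)
  with \<delta> show ?thesis using that by blast
qed

lemma dist_add_right_norm: "dist p (p + v) = norm (v :: complex^'d)"
  by (simp add: dist_norm)

text \<open>By induction on \<open>k\<close>: the part of degree \<open>k\<close> is the limit, as \<open>t\<close> tends to \<open>0\<close>, of
\<open>(h (p + t z) - \<Sum>\<^bsub>l < k\<^esub> h\<^sub>l(z) t\<^bsup>l\<^esup>) / t\<^bsup>k\<^esup>\<close>, uniformly for bounded \<open>z\<close>, and these quotients are
holomorphic along lines by the induction hypothesis.\<close>

lemma hom_part_holomorphic_line:
  assumes "hol_on U h" "open U" "p \<in> U"
  shows "(\<lambda>s. hom_part h p k (x + s *s y)) holomorphic_on UNIV"
proof (induction k rule: less_induct)
  case (less k)
  obtain \<delta> B where \<delta>: "\<delta> > 0" "cball p \<delta> \<subseteq> U" and B: "\<And>z. z \<in> cball p \<delta> \<Longrightarrow> cmod (h z) \<le> B" "B > 0"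
    using hol_on_local_bound[OF assms] by blast
  have "(\<lambda>s. hom_part h p k (x + s *s y)) holomorphic_on ball s0 1" for s0
  proof -
    define \<rho> where "\<rho> = norm x + (cmod s0 + 1) * norm y + 1"
    have "\<rho> > 0" unfolding \<rho>_def by (intro add_nonneg_pos add_nonneg_nonneg mult_nonneg_nonneg) auto
    have \<rho>: "norm (x + s *s y) \<le> \<rho>" if "s \<in> ball s0 1" for s
    proof -
      have "cmod s \<le> cmod s0 + 1" using that norm_triangle_sub[of s s0]
        by (simp add: dist_norm norm_minus_commute)
      then have "norm (s *s y) \<le> (cmod s0 + 1) * norm y"
        unfolding norm_smult_vec by (intro mult_right_mono) auto
      then show ?thesis using norm_triangle_ineq[of x "s *s y"] by (simp add: \<rho>_def)
    qed
    \<comment> \<open>For \<open>|t| \<le> 2 \<sigma>\<close> every point used stays in the ball on which \<open>h\<close> is bounded.\<close>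
    define \<sigma> where "\<sigma> = \<delta> / (2 * \<rho>)"
    have \<sigma>: "\<sigma> > 0" using \<delta> \<open>\<rho> > 0\<close> by (simp add: \<sigma>_def)
    have inball: "p + t *s (x + s *s y) \<in> cball p \<delta>" if "s \<in> ball s0 1" "cmod t \<le> 2 * \<sigma>" for s t
    proof -
      have "norm (t *s (x + s *s y)) \<le> (2 * \<sigma>) * \<rho>"
        unfolding norm_smult_vec using that \<rho> \<sigma> by (intro mult_mono) auto
      also have "\<dots> = \<delta>" using \<open>\<rho> > 0\<close> by (simp add: \<sigma>_def)
      finally show ?thesis unfolding mem_cball dist_add_right_norm .
    qed
    define t where "t n = complex_of_real (\<sigma> / real (Suc n))" for n
    have t: "t n \<noteq> 0" "cmod (t n) \<le> \<sigma>" "cmod (t n) = \<sigma> / real (Suc n)" for n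
    proof -
      have "0 < \<sigma> / real (Suc n)" "\<sigma> / real (Suc n) \<le> \<sigma>"
        using \<sigma> by (auto simp: divide_le_eq)
      then show "t n \<noteq> 0" "cmod (t n) \<le> \<sigma>" "cmod (t n) = \<sigma> / real (Suc n)"
        unfolding t_def norm_of_real of_real_eq_0_iff by linarith+
    qed
    define f where "f n s = (h (p + t n *s (x + s *s y)) - (\<Sum>l<k. hom_part h p l (x + s *s y) * t n ^ l)) / t n ^ k" for n s
    have err: "cmod (f n s - hom_part h p k (x + s *s y)) \<le> 2 * B * \<sigma> / (2 * \<sigma>) ^ Suc k / real (Suc n)"
      if s: "s \<in> ball s0 1" for n s
    proof -
      let ?z = "x + s *s y" and ?q = "cmod (t n) / (2 * \<sigma>)"
      have q: "?q \<le> 1 / 2" "0 \<le> ?q" using t(2)[of n] \<sigma> by (auto simp: field_simps)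
      have "cmod (h (p + t n *s ?z) - (\<Sum>l\<le>k. hom_part h p l ?z * t n ^ l)) \<le> B * ?q ^ Suc k / (1 - ?q)"
      proof (rule hom_part_remainder[OF assms(1)])
        show "cmod (t n) < 2 * \<sigma>" using t(2)[of n] \<sigma> by linarith
      qed (use inball[OF s] \<delta> B \<sigma> in auto)
      also have "\<dots> \<le> B * ?q ^ Suc k / (1 / 2)"
        using q B(2) by (intro divide_left_mono mult_nonneg_nonneg zero_le_power) auto
      finally have 1: "cmod (h (p + t n *s ?z) - (\<Sum>l\<le>k. hom_part h p l ?z * t n ^ l)) \<le> 2 * B * ?q ^ Suc k"
        by simp
      have "f n s - hom_part h p k ?z = (h (p + t n *s ?z) - (\<Sum>l\<le>k. hom_part h p l ?z * t n ^ l)) / t n ^ k"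
        using t(1)[of n] by (simp add: f_def field_simps lessThan_Suc_atMost[symmetric])
      then have "cmod (f n s - hom_part h p k ?z)
          = cmod (h (p + t n *s ?z) - (\<Sum>l\<le>k. hom_part h p l ?z * t n ^ l)) / cmod (t n) ^ k"
        by (simp only: norm_divide norm_power)
      also have "\<dots> \<le> 2 * B * ?q ^ Suc k / cmod (t n) ^ k"
        using 1 by (rule divide_right_mono) simp
      also have "\<dots> = 2 * B * cmod (t n) / (2 * \<sigma>) ^ Suc k"
        using t(1)[of n] by (simp add: power_divide)
      finally show ?thesis
        unfolding t(3) by (simp only: times_divide_eq_right times_divide_eq_left divide_divide_eq_left mult_ac)
    qed
    show ?thesis
    proof (rule holomorphic_uniform_sequence[where f = f])
      show "f n holomorphic_on ball s0 1" for n
      proof -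
        have "(\<lambda>s. h ((p + t n *s x) + s *s (t n *s y))) holomorphic_on ball s0 1"
        proof (rule holomorphic_slice[OF assms(1)])
          fix s assume s: "s \<in> ball s0 1"
          have "p + t n *s (x + s *s y) \<in> U"
            using inball[OF s, of "t n"] t(2)[of n] \<sigma> \<delta>(2) by auto
          then show "(p + t n *s x) + s *s (t n *s y) \<in> U"
            by (simp add: vector_add_ldistrib mult.commute add.assoc)
        qed
        then have "(\<lambda>s. h (p + t n *s (x + s *s y))) holomorphic_on ball s0 1"
          by (simp add: vector_add_ldistrib mult.commute add.assoc)
        moreover have "(\<lambda>s. hom_part h p l (x + s *s y)) holomorphic_on ball s0 1" if "l < k" for l
          using less that holomorphic_on_subset by blast
        ultimately show ?thesis
          unfolding f_def using t(1) by (intro holomorphic_intros) auto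
      qed
    next
      fix s assume s: "s \<in> ball s0 1"
      then obtain d where d: "d > 0" "cball s d \<subseteq> ball s0 1" by (meson open_ball open_contains_cball)
      have lim: "(\<lambda>n. 2 * B * \<sigma> / (2 * \<sigma>) ^ Suc k / real (Suc n)) \<longlonglongrightarrow> 0"
        by (intro LIMSEQ_Suc lim_const_over_n)
      have "uniform_limit (cball s d) f (\<lambda>s. hom_part h p k (x + s *s y)) sequentially"
      proof (rule uniform_limitI)
        fix e :: real assume "e > 0"
        from order_tendstoD(2)[OF lim this]
        show "\<forall>\<^sub>F n in sequentially. \<forall>s\<in>cball s d. dist (f n s) (hom_part h p k (x + s *s y)) < e"
        proof (rule eventually_mono, intro ballI)
          fix n s' assume lt: "2 * B * \<sigma> / (2 * \<sigma>) ^ Suc k / real (Suc n) < e" and "s' \<in> cball s d"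
          then have "s' \<in> ball s0 1" using d by blast
          from le_less_trans[OF err[OF this] lt]
          show "dist (f n s') (hom_part h p k (x + s' *s y)) < e" unfolding dist_norm .
        qed
      qed
      with d show "\<exists>d>0. cball s d \<subseteq> ball s0 1 \<and> uniform_limit (cball s d) f (\<lambda>s. hom_part h p k (x + s *s y)) sequentially"
        by blast
    qed simp
  qed
  then have "(\<lambda>s. hom_part h p k (x + s *s y)) field_differentiable at s0" for s0
    using holomorphic_on_imp_differentiable_at[of _ "ball s0 1" s0] by auto
  then show ?case unfolding holomorphic_on_def by simp
qed

text \<open>Homogeneity gives growth of order \<open>k\<close>, so the restriction to a coordinate line is an entire function that
is a polynomial by Liouville.\<close>

lemma hom_part_separately_polynomial:
  assumes "hol_on U h" "open U" "p \<in> U"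
  shows "\<exists>q. Polynomial.degree q \<le> k \<and> (\<forall>t. hom_part h p k (\<chi> j. if j = i then t else x $ j) = poly q t)"
proof -
  obtain \<delta> B where \<delta>: "\<delta> > 0" "cball p \<delta> \<subseteq> U" and B: "\<And>z. z \<in> cball p \<delta> \<Longrightarrow> cmod (h z) \<le> B" "B > 0"
    using hol_on_local_bound[OF assms] by blast
  have growth: "cmod (hom_part h p k z) \<le> B / \<delta> ^ k * norm z ^ k" for z
  proof (cases "z = 0")
    case True
    have "0 *s z = 0" by (simp add: Finite_Cartesian_Product.vec_eq_iff)
    then have "hom_part h p k z = 0 ^ k * hom_part h p k z"
      using hom_part_scale[OF assms, of k 0 z] True by simp
    moreover have "cmod (hom_part h p 0 z) \<le> B" using True B \<delta> by (simp add: hom_part_def)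
    ultimately show ?thesis using True B \<delta> by (cases k) auto
  next
    case False
    have inb: "p + t *s z \<in> cball p \<delta>" if "cmod t \<le> \<delta> / norm z" for t
      using that False by (simp add: dist_norm norm_smult_vec field_simps)
    have "cmod (hom_part h p k z) \<le> B / (\<delta> / norm z) ^ k"
      using inb \<delta> B False by (intro hom_part_bound[OF assms(1)]) auto
    then show ?thesis by (simp add: power_divide)
  qed
  define x0 where "x0 = (\<chi> j. if j = i then 0 else x $ j)"
  define y where "y = (axis i 1 :: complex^'a)"
  define \<phi> where "\<phi> t = hom_part h p k (x0 + t *s y)" for t
  have arg: "(\<chi> j. if j = i then t else x $ j) = x0 + t *s y" for t
    by (auto simp: Finite_Cartesian_Product.vec_eq_iff x0_def y_def axis_def)
  have "\<phi> t = (\<Sum>l\<le>k. (deriv ^^ l) \<phi> 0 / fact l * t ^ l)" for t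
  proof (rule Liouville_polynomial[where A = 1])
    show "\<phi> holomorphic_on UNIV" unfolding \<phi>_def by (rule hom_part_holomorphic_line[OF assms])
    fix s :: complex assume s: "1 \<le> cmod s"
    have "norm (x0 + s *s y) \<le> norm x0 + cmod s * norm y"
      using norm_triangle_ineq[of x0 "s *s y"] by (simp add: norm_smult_vec)
    also have "\<dots> \<le> (norm x0 + norm y) * cmod s"
      using s mult_left_mono[of 1 "cmod s" "norm x0"] by (simp add: algebra_simps)
    finally have "norm (x0 + s *s y) ^ k \<le> ((norm x0 + norm y) * cmod s) ^ k"
      by (intro power_mono) auto
    then have "cmod (\<phi> s) \<le> B / \<delta> ^ k * ((norm x0 + norm y) * cmod s) ^ k"
      unfolding \<phi>_def using growth B \<delta>
      by (intro order_trans[OF growth] mult_left_mono) auto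
    then show "cmod (\<phi> s) \<le> (B / \<delta> ^ k * (norm x0 + norm y) ^ k) * cmod s ^ k"
      by (simp add: power_mult_distrib mult_ac)
  qed
  moreover have "Polynomial.degree (\<Sum>l\<le>k. Polynomial.monom ((deriv ^^ l) \<phi> 0 / fact l) l) \<le> k"
    by (intro degree_sum_le) (auto intro: order_trans[OF degree_monom_le])
  ultimately show ?thesis
    unfolding arg \<phi>_def[symmetric]
    by (intro exI[of _ "\<Sum>l\<le>k. Polynomial.monom ((deriv ^^ l) \<phi> 0 / fact l) l"]) (simp add: poly_sum poly_monom)
qed

definition taylor_coeff :: "(complex^'d \<Rightarrow> complex) \<Rightarrow> complex^'d \<Rightarrow> ('d::finite \<Rightarrow> nat) \<Rightarrow> complex" where
  "taylor_coeff h p a = grid_coeff (mdeg a) (hom_part h p (mdeg a)) a"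

lemma mpow_scale: "mpow (t *s x) a = t ^ mdeg a * mpow x a"
  by (simp add: mpow_def mdeg_def power_mult_distrib prod.distrib power_sum)

text \<open>The homogeneous part is a polynomial by interpolation; comparing powers of \<open>t\<close> in
\<open>h\<^sub>k(t x) = t\<^bsup>k\<^esup> h\<^sub>k(x)\<close> leaves the monomials of degree \<open>k\<close>.\<close>

lemma hom_part_poly:
  assumes "hol_on U h" "open U" "p \<in> U"
  shows "hom_part h p k x = (\<Sum>a | mdeg a = k. taylor_coeff h p a * mpow x a)"
proof -
  define c where "c a = grid_coeff k (hom_part h p k) a" for a
  have exp: "hom_part h p k z = (\<Sum>a\<in>index_box k. c a * mpow z a)" for z
    unfolding c_def by (rule separately_polynomial_imp_polynomial[OF hom_part_separately_polynomial[OF assms]])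
  define q where "q = (\<Sum>a\<in>index_box k. Polynomial.monom (c a * mpow x a) (mdeg a))"
  have "poly q t = poly (Polynomial.monom (hom_part h p k x) k) t" for t
    using exp[of "t *s x"] unfolding hom_part_scale[OF assms]
    by (simp add: q_def poly_sum poly_monom mpow_scale mult_ac)
  then have "q = Polynomial.monom (hom_part h p k x) k" using poly_eq_poly_eq_iff by blast
  then have "hom_part h p k x = Polynomial.coeff q k" by simp
  also have "\<dots> = (\<Sum>a\<in>index_box k. if mdeg a = k then c a * mpow x a else 0)"
    unfolding q_def coeff_sum by (intro sum.cong) auto
  also have "\<dots> = (\<Sum>a | a \<in> index_box k \<and> mdeg a = k. c a * mpow x a)"
    by (simp add: sum.inter_filter)
  also have "{a. a \<in> index_box k \<and> mdeg a = k} = {a. mdeg a = k}" using mdeg_le_index_box by blast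
  finally show ?thesis unfolding c_def taylor_coeff_def by (auto intro!: sum.cong)
qed

lemma taylor_coeff_unique:
  assumes "\<And>x. hom_part h p k x = (\<Sum>a | mdeg a = k. c a * mpow x a)" "mdeg b = k"
  shows "taylor_coeff h p b = c b"
proof -
  have "hom_part h p k = (\<lambda>x. \<Sum>a | mdeg a = k. c a * mpow x a)" using assms(1) by auto
  then show ?thesis unfolding taylor_coeff_def assms(2)
    using assms(2) by (simp add: grid_coeff_poly mdeg_le_index_box subset_eq)
qed

lemma taylor_coeff_cong:
  assumes "open U" "p \<in> U" "\<And>z. z \<in> U \<Longrightarrow> g z = h z"
  shows "taylor_coeff g p a = taylor_coeff h p a"
proof -
  have "hom_part g p (mdeg a) = hom_part h p (mdeg a)" by (intro ext hom_part_cong[OF assms])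
  then show ?thesis by (simp add: taylor_coeff_def)
qed

lemma taylor_coeff_linear:
  assumes "hol_on U g" "hol_on U h" "open U" "p \<in> U"
  shows "taylor_coeff (\<lambda>z. s * g z + t * h z) p a = s * taylor_coeff g p a + t * taylor_coeff h p a"
  unfolding taylor_coeff_def grid_coeff_def hom_part_linear[OF assms]
  by (simp add: ring_distribs sum.distrib sum_distrib_left mult_ac)

lemma compact_continuous_bound:
  fixes h :: "'a::topological_space \<Rightarrow> 'b::real_normed_vector"
  assumes "compact L" "continuous_on L h"
  shows "\<exists>B>0. \<forall>z\<in>L. norm (h z) \<le> B"
proof -
  have "bounded (h ` L)" using assms compact_continuous_image compact_imp_bounded by blast
  then show ?thesis unfolding bounded_pos by auto
qed

section \<open>Closure properties of holomorphic functions\<close>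

lemma hol_onI:
  assumes "\<And>z. z \<in> U \<Longrightarrow> (h has_derivative D z) (at z)" "\<And>z c v. z \<in> U \<Longrightarrow> D z (c *s v) = c * D z v"
  shows "hol_on U h"
  unfolding hol_on_def using assms by blast

lemma hol_on_obtain:
  assumes "hol_on U h"
  obtains D where "\<And>z. z \<in> U \<Longrightarrow> (h has_derivative D z) (at z)" "\<And>z c v. z \<in> U \<Longrightarrow> D z (c *s v) = c * D z v"
  using assms unfolding hol_on_def by metis

lemma hol_on_subset: "hol_on U h \<Longrightarrow> V \<subseteq> U \<Longrightarrow> hol_on V h"
  by (auto simp: hol_on_def)

lemma hol_on_const: "hol_on U (\<lambda>z. c)"
  by (rule hol_onI[where D = "\<lambda>_ _. 0"]) auto

lemma hol_on_nth: "hol_on U (\<lambda>z. z $ i)"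
  by (rule hol_onI[where D = "\<lambda>_ v. v $ i"]) (auto intro: bounded_linear_imp_has_derivative bounded_linear_vec_nth)

lemma hol_on_add: "hol_on U g \<Longrightarrow> hol_on U h \<Longrightarrow> hol_on U (\<lambda>z. g z + h z)"
proof (elim hol_on_obtain)
  fix D E
  assume D: "\<And>z. z \<in> U \<Longrightarrow> (g has_derivative D z) (at z)" "\<And>z c v. z \<in> U \<Longrightarrow> D z (c *s v) = c * D z v"
    and E: "\<And>z. z \<in> U \<Longrightarrow> (h has_derivative E z) (at z)" "\<And>z c v. z \<in> U \<Longrightarrow> E z (c *s v) = c * E z v"
  show ?thesis
    by (rule hol_onI[where D = "\<lambda>z v. D z v + E z v"])
       (auto intro!: has_derivative_add D(1) E(1) simp: D(2) E(2) ring_distribs)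
qed

lemma hol_on_mult: "hol_on U g \<Longrightarrow> hol_on U h \<Longrightarrow> hol_on U (\<lambda>z. g z * h z)"
proof (elim hol_on_obtain)
  fix D E
  assume D: "\<And>z. z \<in> U \<Longrightarrow> (g has_derivative D z) (at z)" "\<And>z c v. z \<in> U \<Longrightarrow> D z (c *s v) = c * D z v"
    and E: "\<And>z. z \<in> U \<Longrightarrow> (h has_derivative E z) (at z)" "\<And>z c v. z \<in> U \<Longrightarrow> E z (c *s v) = c * E z v"
  show ?thesis
    by (rule hol_onI[where D = "\<lambda>z v. g z * E z v + D z v * h z"])
       (auto intro!: has_derivative_mult D(1) E(1) simp: D(2) E(2) ring_distribs)
qed

lemma hol_on_lincomb: "hol_on U g \<Longrightarrow> hol_on U h \<Longrightarrow> hol_on U (\<lambda>z. a * g z + b * h z)"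
  by (intro hol_on_add hol_on_mult hol_on_const)

lemma hol_on_sum: "(\<And>j. j \<in> J \<Longrightarrow> hol_on U (h j)) \<Longrightarrow> hol_on U (\<lambda>z. \<Sum>j\<in>J. h j z)"
  by (induction J rule: infinite_finite_induct) (auto intro: hol_on_add hol_on_const)

lemma hol_on_prod: "(\<And>j. j \<in> J \<Longrightarrow> hol_on U (h j)) \<Longrightarrow> hol_on U (\<lambda>z. \<Prod>j\<in>J. h j z)"
  by (induction J rule: infinite_finite_induct) (auto intro: hol_on_mult hol_on_const)

lemma hol_on_power: "hol_on U h \<Longrightarrow> hol_on U (\<lambda>z. h z ^ n)"
  by (induction n) (auto intro: hol_on_mult hol_on_const)

lemma hol_on_exp: "hol_on U g \<Longrightarrow> hol_on U (\<lambda>z. exp (g z))"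
proof (elim hol_on_obtain)
  fix D
  assume D: "\<And>z. z \<in> U \<Longrightarrow> (g has_derivative D z) (at z)" "\<And>z c v. z \<in> U \<Longrightarrow> D z (c *s v) = c * D z v"
  have "((\<lambda>z. exp (g z)) has_derivative (\<lambda>v. exp (g z) * D z v)) (at z)" if "z \<in> U" for z
    using has_derivative_compose[OF D(1)[OF that], of exp "(*) (exp (g z))"]
      DERIV_exp[of "g z"] by (simp add: has_field_derivative_def)
  then show ?thesis
    by (rule hol_onI[where D = "\<lambda>z v. exp (g z) * D z v"]) (auto simp: D(2))
qed

lemma hol_on_compose_map:
  assumes "hol_map_on U f" "hol_on UNIV h"
  shows "hol_on U (\<lambda>z. h (f z))"
  unfolding hol_on_def
proof
  fix z assume "z \<in> U"
  then obtain D where D: "(f has_derivative D) (at z)" "\<forall>c v. D (c *s v) = c *s D v"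
    using assms unfolding hol_map_on_def by blast
  obtain E where E: "(h has_derivative E) (at (f z))" "\<forall>c v. E (c *s v) = c * E v"
    using assms unfolding hol_on_def by blast
  show "\<exists>D. ((\<lambda>z. h (f z)) has_derivative D) (at z) \<and> (\<forall>c v. D (c *s v) = c * D v)"
    by (rule exI[of _ "\<lambda>v. E (D v)"]) (auto intro: has_derivative_compose D(1) E(1) simp: D(2) E(2))
qed

lemma hol_on_herm: "hol_on U (\<lambda>z. herm z \<zeta>)"
  unfolding herm_def by (intro hol_on_sum hol_on_mult hol_on_nth hol_on_const)

lemma herm_diff_left: "herm (z - w) \<zeta> = herm z \<zeta> - herm w \<zeta>"
  by (simp add: herm_def ring_distribs sum_subtractf)

lemma herm_add_left: "herm (z + w) \<zeta> = herm z \<zeta> + herm w \<zeta>"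
  by (simp add: herm_def ring_distribs sum.distrib)

lemma herm_diff_right: "herm z (\<zeta> - w) = herm z \<zeta> - herm z w"
  by (simp add: herm_def ring_distribs sum_subtractf)

lemma herm_add_right: "herm z (\<zeta> + w) = herm z \<zeta> + herm z w"
  by (simp add: herm_def ring_distribs sum.distrib)

lemma herm_scale_left: "herm (c *s z) \<zeta> = c * herm z \<zeta>"
  by (simp add: herm_def sum_distrib_left mult_ac)

lemma cnj_herm: "cnj (herm z w) = herm w z"
  by (simp add: herm_def mult.commute)

lemma herm_self: "herm z z = complex_of_real ((norm z)\<^sup>2)"
proof -
  have "(norm z)\<^sup>2 = (\<Sum>i\<in>UNIV. (cmod (z $ i))\<^sup>2)"
    by (simp add: norm_vec_def L2_set_def sum_nonneg)
  then show ?thesis unfolding herm_def by (simp only: of_real_sum complex_norm_square)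
qed

lemma hol_on_herm_diff: "hol_on U (\<lambda>z. herm (z - w) \<zeta>)"
  unfolding herm_diff_left using hol_on_lincomb[OF hol_on_herm hol_on_const, where a = 1 and b = "-1"] by simp

lemma hol_on_expf: "hol_on U (expf \<zeta>)"
  unfolding expf_def by (intro hol_on_exp hol_on_herm)

lemma hol_on_nth_diff: "hol_on U (\<lambda>z. z $ i - c)"
  using hol_on_lincomb[OF hol_on_nth hol_on_const, where a = 1 and b = "-1"] by simp

lemma hol_on_mpow: "hol_on U (\<lambda>z. mpow (z - p) a)"
  unfolding mpow_def by (simp, intro hol_on_prod hol_on_power hol_on_nth_diff)

section \<open>Germs on an absolutely convex body\<close>

lemma germ_cong:
  assumes "open V" "S \<subseteq> V" "\<And>z. z \<in> V \<Longrightarrow> g z = h z"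
  shows "germ S g = germ S h"
proof -
  have *: "germ S g \<subseteq> germ S h" if "\<And>z. z \<in> V \<Longrightarrow> g z = h z" for g h
  proof
    fix k assume "k \<in> germ S g"
    then obtain U where "hol_near S k" "open U" "S \<subseteq> U" "\<forall>z\<in>U. k z = g z"
      unfolding germ_def by blast
    then show "k \<in> germ S h"
      unfolding germ_def using assms(1,2) that by (auto intro!: exI[of _ "U \<inter> V"])
  qed
  show ?thesis using *[of g h] *[of h g] assms(3) by auto
qed

lemma germ_self: "hol_near S h \<Longrightarrow> h \<in> germ S h"
  unfolding germ_def hol_near_def by blast

lemma hol_nearI: "open U \<Longrightarrow> S \<subseteq> U \<Longrightarrow> hol_on U h \<Longrightarrow> hol_near S h"
  unfolding hol_near_def by blast

lemma hol_near_common: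
  assumes "hol_near S g" "hol_near S h"
  obtains U where "open U" "S \<subseteq> U" "hol_on U g" "hol_on U h"
proof -
  obtain U V where "open U" "S \<subseteq> U" "hol_on U g" "open V" "S \<subseteq> V" "hol_on V h"
    using assms unfolding hol_near_def by blast
  then show ?thesis
    using that[of "U \<inter> V"] hol_on_subset[of U g "U \<inter> V"] hol_on_subset[of V h "U \<inter> V"] by auto
qed

lemma dual_germs_linear:
  assumes "\<nu> \<in> dual_germs S" "hol_near S g" "hol_near S h"
  shows "\<nu> (germ S (\<lambda>z. a * g z + b * h z)) = a * \<nu> (germ S g) + b * \<nu> (germ S h)"
proof -
  have "\<forall>g h a b. hol_near S g \<longrightarrow> hol_near S h \<longrightarrow>
      \<nu> (germ S (\<lambda>z. a * g z + b * h z)) = a * \<nu> (germ S g) + b * \<nu> (germ S h)"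
    using assms(1) unfolding dual_germs_def mem_Collect_eq by (elim conjE)
  then show ?thesis using assms(2,3) by simp
qed

text \<open>Functionals in the dual pass to limits that are uniform on compact sets, because they are bounded by a
supremum over one compact set.\<close>

lemma dual_germs_limit:
  assumes \<nu>: "\<nu> \<in> dual_germs S" and U: "open U" "S \<subseteq> U"
    and hol: "\<And>n. hol_on U (g n)" "hol_on U h"
    and lim: "\<And>L. compact L \<Longrightarrow> L \<subseteq> U \<Longrightarrow> uniform_limit L g h sequentially"
  shows "(\<lambda>n. \<nu> (germ S (g n))) \<longlonglongrightarrow> \<nu> (germ S h)"
proof -
  obtain L B where L: "compact L" "L \<noteq> {}" "L \<subseteq> U"
    and B: "\<And>h. hol_on U h \<Longrightarrow> cmod (\<nu> (germ S h)) \<le> B * (SUP z\<in>L. cmod (h z))"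
  proof -
    have "\<forall>U. open U \<longrightarrow> S \<subseteq> U \<longrightarrow> (\<exists>L B. compact L \<and> L \<noteq> {} \<and> L \<subseteq> U
        \<and> (\<forall>h. hol_on U h \<longrightarrow> cmod (\<nu> (germ S h)) \<le> B * (SUP z\<in>L. cmod (h z))))"
      using \<nu> unfolding dual_germs_def mem_Collect_eq by (elim conjE)
    from this[rule_format, OF U] that show ?thesis by auto
  qed
  show ?thesis
  proof (rule tendstoI)
    fix e :: real assume "e > 0"
    define \<eta> where "\<eta> = e / (\<bar>B\<bar> + 1)"
    have "\<eta> > 0" using \<open>e > 0\<close> by (simp add: \<eta>_def)
    from uniform_limitD[OF lim[OF L(1,3)] this]
    show "\<forall>\<^sub>F n in sequentially. dist (\<nu> (germ S (g n))) (\<nu> (germ S h)) < e"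
    proof (rule eventually_mono)
      fix n assume n: "\<forall>z\<in>L. dist (g n z) (h z) < \<eta>"
      let ?d = "\<lambda>z. 1 * g n z + (-1) * h z"
      have le: "cmod (?d z) \<le> \<eta>" if "z \<in> L" for z
        using n that by (auto simp: dist_norm less_imp_le)
      have sup: "(SUP z\<in>L. cmod (?d z)) \<le> \<eta>" using L(2) le by (intro cSUP_least) auto
      have "0 \<le> (SUP z\<in>L. cmod (?d z))"
      proof -
        obtain z where "z \<in> L" using L by auto
        then have "cmod (?d z) \<le> (SUP z\<in>L. cmod (?d z))"
          using le by (intro cSUP_upper bdd_aboveI2[where M = \<eta>]) auto
        then show ?thesis using norm_ge_zero order_trans by blast
      qed
      then have "B * (SUP z\<in>L. cmod (?d z)) \<le> \<bar>B\<bar> * \<eta>"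
        using sup by (intro mult_mono) auto
      moreover have "\<bar>B\<bar> * \<eta> < e" using \<open>e > 0\<close> by (simp add: \<eta>_def field_simps)
      moreover have "\<nu> (germ S ?d) = \<nu> (germ S (g n)) - \<nu> (germ S h)"
        using dual_germs_linear[OF \<nu> hol_nearI[OF U hol(1)] hol_nearI[OF U hol(2)], of 1 n "-1"] by simp
      ultimately show "dist (\<nu> (germ S (g n))) (\<nu> (germ S h)) < e"
        using B[OF hol_on_lincomb[OF hol(1) hol(2), of 1 n "-1"]] by (simp add: dist_norm)
    qed
  qed
qed

definition agree where
  "agree S \<nu> \<nu>' h \<longleftrightarrow> \<nu> (germ S h) = (\<nu>' (germ S h) :: complex)"

lemma agree_lincomb:
  assumes "\<nu> \<in> dual_germs S" "\<nu>' \<in> dual_germs S" "hol_near S g" "hol_near S h"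
    and "agree S \<nu> \<nu>' g" "agree S \<nu> \<nu>' h"
  shows "agree S \<nu> \<nu>' (\<lambda>z. a * g z + b * h z)"
  using assms by (simp add: agree_def dual_germs_linear)

lemma agree_limit:
  assumes "\<nu> \<in> dual_germs S" "\<nu>' \<in> dual_germs S" "open U" "S \<subseteq> U"
    and "\<And>n. hol_on U (g n)" "hol_on U h" "\<And>n. agree S \<nu> \<nu>' (g n)"
    and "\<And>L. compact L \<Longrightarrow> L \<subseteq> U \<Longrightarrow> uniform_limit L g h sequentially"
  shows "agree S \<nu> \<nu>' h"
proof -
  have "(\<lambda>n. \<nu> (germ S (g n))) \<longlonglongrightarrow> \<nu> (germ S h)" "(\<lambda>n. \<nu>' (germ S (g n))) \<longlonglongrightarrow> \<nu>' (germ S h)"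
    using dual_germs_limit[OF assms(1,3,4,5,6,8)] dual_germs_limit[OF assms(2,3,4,5,6,8)] by simp_all
  moreover have "\<nu> (germ S (g n)) = \<nu>' (germ S (g n))" for n using assms(7)[of n] by (simp only: agree_def)
  ultimately show ?thesis unfolding agree_def using LIMSEQ_unique by (simp only:)
qed

lemma hol_near_UNIV: "hol_on UNIV h \<Longrightarrow> hol_near S h"
  by (rule hol_nearI[of UNIV]) auto

lemma agree_sum:
  assumes \<nu>: "\<nu> \<in> dual_germs S" "\<nu>' \<in> dual_germs S"
    and "\<And>j. j \<in> J \<Longrightarrow> hol_on UNIV (g j)" "\<And>j. j \<in> J \<Longrightarrow> agree S \<nu> \<nu>' (g j)"
  shows "agree S \<nu> \<nu>' (\<lambda>z. \<Sum>j\<in>J. g j z)"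
proof -
  have h0: "hol_near S (\<lambda>z. 0)" by (intro hol_near_UNIV hol_on_const)
  have zero: "agree S \<nu> \<nu>' (\<lambda>z. 0)"
    using dual_germs_linear[OF \<nu>(1) h0 h0, of 0 0] dual_germs_linear[OF \<nu>(2) h0 h0, of 0 0]
    by (simp add: agree_def)
  show ?thesis
    using assms(3,4)
  proof (induction J rule: infinite_finite_induct)
    case (insert j J)
    then have "agree S \<nu> \<nu>' (\<lambda>z. 1 * g j z + 1 * (\<Sum>j\<in>J. g j z))"
      by (intro agree_lincomb \<nu> hol_near_UNIV hol_on_sum) auto
    then show ?case using insert.hyps by simp
  qed (auto simp: zero)
qed

lemma expf_shift: "expf (\<zeta> + axis i (complex_of_real t)) z = expf \<zeta> z * exp (complex_of_real t * z $ i)"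
proof -
  have "herm z (axis i (complex_of_real t)) = (\<Sum>j\<in>UNIV. if j = i then complex_of_real t * z $ i else 0)"
    unfolding herm_def by (intro sum.cong) (auto simp: axis_def)
  then show ?thesis by (simp add: expf_def herm_add_right exp_add)
qed

text \<open>The difference quotient \<open>(exp (t z\<^sub>i) - 1) / t\<close> of exponentials converges to \<open>z\<^sub>i\<close> uniformly on compact
sets. Keeping the factor \<open>e\<^sub>\<zeta>\<close> with arbitrary \<open>\<zeta>\<close> allows the step to be iterated.\<close>

lemma agree_times_coordinate:
  assumes "\<nu> \<in> dual_germs S" "\<nu>' \<in> dual_germs S" "hol_on UNIV g"
    and ag: "\<And>\<zeta>. agree S \<nu> \<nu>' (\<lambda>z. expf \<zeta> z * g z)"
  shows "agree S \<nu> \<nu>' (\<lambda>z. expf \<zeta> z * (g z * z $ i))"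
proof -
  define t where "t n = 1 / real (Suc n)" for n
  have t: "0 < t n" "t n \<le> 1" for n by (auto simp: t_def)
  define G where "G n z = complex_of_real (1 / t n) * (expf (\<zeta> + axis i (complex_of_real (t n))) z * g z)
                     + (- complex_of_real (1 / t n)) * (expf \<zeta> z * g z)" for n z
  have hol: "hol_on UNIV (\<lambda>z. expf \<zeta> z * g z)" for \<zeta>
    by (intro hol_on_mult hol_on_expf assms)
  have G: "G n z - expf \<zeta> z * (g z * z $ i)
      = expf \<zeta> z * g z / complex_of_real (t n) * (exp (complex_of_real (t n) * z $ i) - 1 - complex_of_real (t n) * z $ i)" for n z
  proof -
    have "E * g' * X = E * X * g'" "1 / c * (E * X * g') + - (1 / c) * (E * g') - E * (g' * w) = E * g' / c * (X - 1 - c * w)"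
      if "c \<noteq> 0" for E X c g' w :: complex
      using that by (auto simp: field_simps)
    from this(2)[of "complex_of_real (t n)" "expf \<zeta> z" "exp (complex_of_real (t n) * z $ i)" "g z" "z $ i"]
    show ?thesis using t(1)[of n] unfolding G_def expf_shift of_real_divide of_real_1 by simp
  qed
  show ?thesis
  proof (rule agree_limit[OF assms(1,2) open_UNIV subset_UNIV])
    show "hol_on UNIV (G n)" for n unfolding G_def by (rule hol_on_lincomb[OF hol hol])
    show "hol_on UNIV (\<lambda>z. expf \<zeta> z * (g z * z $ i))" by (intro hol_on_mult hol_on_expf assms hol_on_nth)
    show "agree S \<nu> \<nu>' (G n)" for n
      unfolding G_def by (rule agree_lincomb[OF assms(1,2) hol_near_UNIV[OF hol] hol_near_UNIV[OF hol] ag ag])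
    fix L :: "(complex^'a) set" assume L: "compact L"
    obtain M where M: "M > 0" "\<And>z. z \<in> L \<Longrightarrow> cmod (expf \<zeta> z * g z) \<le> M"
      using compact_continuous_bound[OF L continuous_on_subset[OF hol_on_continuous[OF hol[of \<zeta>]] subset_UNIV]] by blast
    obtain W where W: "W > 0" "\<And>z. z \<in> L \<Longrightarrow> norm z \<le> W"
      using compact_continuous_bound[OF L continuous_on_id] by blast
    have err: "cmod (G n z - expf \<zeta> z * (g z * z $ i)) \<le> M * exp W * W\<^sup>2 / real (Suc n)" if "z \<in> L" for n z
    proof -
      let ?w = "complex_of_real (t n) * z $ i"
      have zi: "cmod (z $ i) \<le> W" using W(2)[OF that] Finite_Cartesian_Product.norm_nth_le[of z i] by linarith
      have w: "cmod ?w \<le> t n * W" using t[of n] zi by (simp add: norm_mult)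
      also have "\<dots> \<le> W" using t[of n] W by simp
      finally have w1: "\<bar>Re ?w\<bar> \<le> W" using abs_Re_le_cmod[of ?w] by linarith
      have "cmod (exp ?w - 1 - ?w) \<le> exp \<bar>Re ?w\<bar> * cmod ?w ^ 2"
        using Taylor_exp[of ?w 1] by (simp add: diff_diff_eq power2_eq_square)
      also have "\<dots> \<le> exp W * (t n * W)\<^sup>2"
        using w w1 by (intro mult_mono power_mono) auto
      finally have e: "cmod (exp ?w - 1 - ?w) \<le> exp W * (t n * W)\<^sup>2" .
      have "cmod (G n z - expf \<zeta> z * (g z * z $ i)) \<le> M / t n * (exp W * (t n * W)\<^sup>2)"
      proof -
        have "cmod (a / complex_of_real r * b) = cmod a / r * cmod b" if "r > 0" for a b r
          using that by (simp add: norm_mult norm_divide)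
        moreover have "cmod (expf \<zeta> z * g z) / t n \<le> M / t n"
          using M(2)[OF that] t(1)[of n] by (simp add: divide_right_mono)
        ultimately show ?thesis
          unfolding G using t(1)[of n] e M(1) by (simp only:) (intro mult_mono, auto)
      qed
      also have "\<dots> = M * exp W * W\<^sup>2 * t n" using t[of n] by (simp add: power2_eq_square)
      finally show ?thesis by (simp add: t_def)
    qed
    show "uniform_limit L G (\<lambda>z. expf \<zeta> z * (g z * z $ i)) sequentially"
    proof (rule uniform_limitI)
      fix e :: real assume "e > 0"
      have "(\<lambda>n. M * exp W * W\<^sup>2 / real (Suc n)) \<longlonglongrightarrow> 0"
        by (intro LIMSEQ_Suc lim_const_over_n)
      from order_tendstoD(2)[OF this \<open>e > 0\<close>]
      show "\<forall>\<^sub>F n in sequentially. \<forall>z\<in>L. dist (G n z) (expf \<zeta> z * (g z * z $ i)) < e"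
      proof (rule eventually_mono, intro ballI)
        fix n z assume lt: "M * exp W * W\<^sup>2 / real (Suc n) < e" and "z \<in> L"
        from le_less_trans[OF err[OF this(2)] lt]
        show "dist (G n z) (expf \<zeta> z * (g z * z $ i)) < e" unfolding dist_norm .
      qed
    qed
  qed
qed

lemma mdeg_0_iff: "mdeg a = 0 \<longleftrightarrow> a = (\<lambda>_. 0)"
  by (auto simp: mdeg_def fun_eq_iff)

lemma agree_mpow:
  fixes a :: "'d::finite \<Rightarrow> nat"
  assumes \<nu>: "\<nu> \<in> dual_germs S" "\<nu>' \<in> dual_germs S" and ag: "\<And>\<zeta>. agree S \<nu> \<nu>' (expf \<zeta>)"
  shows "agree S \<nu> \<nu>' (\<lambda>z. mpow (z - p) a)"
proof -
  have "agree S \<nu> \<nu>' (\<lambda>z. expf \<zeta> z * mpow (z - p) a)" for \<zeta>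
  proof (induction "mdeg a" arbitrary: a \<zeta>)
    case 0
    then have "a = (\<lambda>_. 0)" by (simp add: mdeg_0_iff)
    then show ?case using ag[of \<zeta>] by (simp add: mpow_def)
  next
    case (Suc k)
    then have "a \<noteq> (\<lambda>_. 0)" using mdeg_0_iff[of a] by auto
    then obtain i where i: "a i > 0" by (auto simp: fun_eq_iff)
    define b where "b = a(i := a i - 1)"
    have "mdeg a = Suc (mdeg b)"
    proof -
      have "sum b (UNIV - {i}) = sum a (UNIV - {i})" by (intro sum.cong) (auto simp: b_def)
      then show ?thesis using i
        by (simp only: mdeg_def sum.remove[OF finite UNIV_I[of i]]) (simp add: b_def)
    qed
    with Suc have IH: "agree S \<nu> \<nu>' (\<lambda>z. expf \<zeta> z * mpow (z - p) b)" for \<zeta> by auto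
    have m: "mpow x a = mpow x b * x $ i" for x
    proof -
      have "(\<Prod>j\<in>UNIV - {i}. (x $ j) ^ b j) = (\<Prod>j\<in>UNIV - {i}. (x $ j) ^ a j)"
        by (intro prod.cong) (auto simp: b_def)
      moreover have "(x $ i) ^ a i = (x $ i) ^ b i * x $ i"
        using power_minus_mult[OF i, of "x $ i"] by (simp add: b_def)
      ultimately show ?thesis
        by (simp only: mpow_def prod.remove[OF finite UNIV_I[of i]]) (simp only: mult_ac)
    qed
    have "agree S \<nu> \<nu>' (\<lambda>z. 1 * (expf \<zeta> z * (mpow (z - p) b * z $ i)) + (- p $ i) * (expf \<zeta> z * mpow (z - p) b))"
      by (rule agree_lincomb[OF \<nu> hol_near_UNIV hol_near_UNIV agree_times_coordinate[OF \<nu> hol_on_mpow IH] IH])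
         (intro hol_on_mult hol_on_expf hol_on_mpow hol_on_nth)+
    then show ?case by (simp add: m algebra_simps)
  qed
  from this[of 0] show ?thesis by (simp add: expf_def herm_def)
qed

text \<open>The body is balanced about its centre \<open>p\<close>, so each of its points lies on a complex disc through \<open>p\<close>
inside it; this is what makes slices through \<open>p\<close> sufficient.\<close>

locale abs_convex_body =
  fixes p :: "complex^'d" and K0 :: "(complex^'d) set"
  assumes compact_K0: "compact K0" and abs_convex_K0: "abs_convex K0" and zero_interior: "0 \<in> interior K0"
begin

definition "K = (\<lambda>x. p + x) ` K0"

lemma zero_mem: "0 \<in> K0"
  using zero_interior interior_subset by blast

lemma smult_mem: "y \<in> K0 \<Longrightarrow> cmod t \<le> 1 \<Longrightarrow> t *s y \<in> K0"
  using bspec[OF bspec[OF abs_convex_K0[unfolded abs_convex_def], of y] zero_mem, THEN spec, THEN spec, of t 0] by simp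

lemma scaleR_smult: "r *\<^sub>R x = complex_of_real r *s (x :: complex^'e)"
proof -
  have "r *\<^sub>R c = complex_of_real r * c" for c by (rule scaleR_conv_of_real)
  then show ?thesis by (simp only: Finite_Cartesian_Product.vec_eq_iff vector_scaleR_component vector_smult_component simp_thms)
qed

lemma convex_K0: "convex K0"
proof (rule convexI)
  fix x y u v assume "x \<in> K0" "y \<in> K0" and uv: "0 \<le> u" "0 \<le> v" "u + v = (1::real)"
  moreover have "cmod (complex_of_real u) + cmod (complex_of_real v) \<le> 1" using uv by simp
  ultimately show "u *\<^sub>R x + v *\<^sub>R y \<in> K0"
    unfolding scaleR_smult using abs_convex_K0[unfolded abs_convex_def, rule_format, of x y] by blast
qed

lemma compact_K: "compact K"
  unfolding K_def using compact_translation[OF compact_K0] .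

lemma p_mem_K: "p \<in> K"
  unfolding K_def using zero_mem by (auto intro: image_eqI[of _ _ 0])

text \<open>Compactness: a neighbourhood of the body contains a uniform neighbourhood of it, hence a slightly larger
dilation.\<close>

lemma dilation_in_open:
  assumes "open U" "K \<subseteq> U"
  obtains \<theta> where "\<theta> > 1" "\<And>y t. y \<in> K0 \<Longrightarrow> cmod t \<le> \<theta> \<Longrightarrow> p + t *s y \<in> U"
proof -
  obtain e where e: "e > 0" "(\<Union>x\<in>K. ball x e) \<subseteq> U"
    using compact_subset_open_imp_ball_epsilon_subset[OF compact_K assms] by blast
  obtain b where b: "b > 0" "\<And>y. y \<in> K0 \<Longrightarrow> norm y \<le> b"
    using compact_continuous_bound[OF compact_K0 continuous_on_id] by blast
  define \<theta> where "\<theta> = 1 + e / (2 * b)"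
  have \<theta>: "\<theta> > 1" using e b by (simp add: \<theta>_def)
  moreover have "p + t *s y \<in> U" if y: "y \<in> K0" and t: "cmod t \<le> \<theta>" for y t
  proof -
    define y' where "y' = (t / complex_of_real \<theta>) *s y"
    have y': "y' \<in> K0" unfolding y'_def using y t \<theta> by (intro smult_mem) (auto simp: norm_divide)
    have ty: "t *s y = complex_of_real \<theta> *s y'" using \<theta> by (simp add: y'_def)
    have "complex_of_real \<theta> *s y' - y' = complex_of_real (\<theta> - 1) *s y'"
      by (simp add: Finite_Cartesian_Product.vec_eq_iff ring_distribs)
    then have "norm (complex_of_real \<theta> *s y' - y') = (\<theta> - 1) * norm y'"
      using \<theta> by (simp only: norm_smult_vec norm_of_real)
    also have "\<dots> \<le> e / 2" using b(1) b(2)[OF y'] e by (simp add: \<theta>_def field_simps)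
    finally have "p + t *s y \<in> ball (p + y') e"
      unfolding ty using e by (simp add: dist_norm norm_minus_commute)
    moreover have "p + y' \<in> K" using y' unfolding K_def by blast
    ultimately show ?thesis using e(2) by blast
  qed
  ultimately show ?thesis using that by blast
qed

lemma bounded_on_dilation:
  assumes "hol_on U h" "\<theta> > 0" "\<And>y t. y \<in> K0 \<Longrightarrow> cmod t \<le> \<theta> \<Longrightarrow> p + t *s y \<in> U"
  obtains B where "B > 0" "\<And>y t. y \<in> K0 \<Longrightarrow> cmod t \<le> \<theta> \<Longrightarrow> cmod (h (p + t *s y)) \<le> B"
proof -
  let ?X = "(\<lambda>y. p + complex_of_real \<theta> *s y) ` K0"
  have "?X = (\<lambda>x. p + x) ` ((\<lambda>y. \<theta> *\<^sub>R y) ` K0)"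
    by (simp add: image_image scaleR_smult)
  then have "compact ?X" using compact_K0 by (auto intro: compact_scaling compact_translation)
  moreover have "?X \<subseteq> U" using assms by auto
  ultimately obtain B where B: "B > 0" "\<And>z. z \<in> ?X \<Longrightarrow> cmod (h z) \<le> B"
    using compact_continuous_bound[of ?X h] continuous_on_subset[OF hol_on_continuous[OF assms(1)]] by blast
  have "cmod (h (p + t *s y)) \<le> B" if "y \<in> K0" "cmod t \<le> \<theta>" for y t
  proof (rule B(2))
    have "(t / complex_of_real \<theta>) *s y \<in> K0" using that assms by (intro smult_mem) (auto simp: norm_divide)
    moreover have "p + t *s y = p + complex_of_real \<theta> *s ((t / complex_of_real \<theta>) *s y)"
      using assms by simp
    ultimately show "p + t *s y \<in> ?X" by blast
  qed
  with B(1) that show ?thesis by blast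
qed

lemma open_dilation:
  assumes "s > 1"
  shows "open ((\<lambda>y. p + s *\<^sub>R y) ` interior K0)" "K \<subseteq> (\<lambda>y. p + s *\<^sub>R y) ` interior K0"
proof -
  have "(\<lambda>y. p + s *\<^sub>R y) ` interior K0 = (\<lambda>x. p + x) ` ((\<lambda>y. s *\<^sub>R y) ` interior K0)"
    by (simp add: image_image)
  then show "open ((\<lambda>y. p + s *\<^sub>R y) ` interior K0)"
    using assms by (auto intro!: open_translation open_scaling)
  show "K \<subseteq> (\<lambda>y. p + s *\<^sub>R y) ` interior K0"
  proof
    fix z assume "z \<in> K"
    then obtain y where y: "y \<in> K0" "z = p + y" by (auto simp: K_def)
    have "y - (1 - 1 / s) *\<^sub>R (y - 0) \<in> interior K0"
      using assms y by (intro mem_interior_convex_shrink[OF convex_K0 zero_interior]) auto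
    then have "(1 / s) *\<^sub>R y \<in> interior K0" by (simp add: scaleR_diff_left)
    moreover have "z = p + s *\<^sub>R ((1 / s) *\<^sub>R y)" using y assms by simp
    ultimately show "z \<in> (\<lambda>y. p + s *\<^sub>R y) ` interior K0" by blast
  qed
qed

text \<open>Equality on the body determines the derivatives at \<open>p\<close> of all slices, hence both power series on a larger
dilation.\<close>

lemma germ_eq_of_eq_on_K:
  assumes "hol_near K g" "hol_near K h" "\<And>z. z \<in> K \<Longrightarrow> g z = h z"
  shows "germ K g = germ K h"
proof -
  obtain U where U: "open U" "K \<subseteq> U" "hol_on U g" "hol_on U h"
    using hol_near_common assms by blast
  obtain \<theta> where \<theta>: "\<theta> > 1" "\<And>y t. y \<in> K0 \<Longrightarrow> cmod t \<le> \<theta> \<Longrightarrow> p + t *s y \<in> U"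
    using dilation_in_open[OF U(1,2)] by blast
  define s where "s = (1 + \<theta>) / 2"
  have s: "s > 1" "s < \<theta>" using \<theta> by (auto simp: s_def)
  have o: "open ((\<lambda>x. p + x) ` interior K0)" by (intro open_translation) auto
  have "hom_part g p k x = hom_part h p k x" for k x
  proof (rule hom_part_cong[OF o])
    show "p \<in> (\<lambda>x. p + x) ` interior K0" using zero_interior by (intro image_eqI[of _ _ 0]) auto
    fix z assume "z \<in> (\<lambda>x. p + x) ` interior K0"
    then show "g z = h z" using assms(3) interior_subset unfolding K_def by blast
  qed
  show ?thesis
  proof (rule germ_cong[OF open_dilation[OF s(1)]])
    fix z assume "z \<in> (\<lambda>y. p + s *\<^sub>R y) ` interior K0"
    then obtain y where y: "y \<in> K0" "z = p + complex_of_real s *s y"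
      using interior_subset by (auto simp: scaleR_smult)
    have "(\<lambda>k. hom_part g p k y * complex_of_real s ^ k) sums g z"
      "(\<lambda>k. hom_part h p k y * complex_of_real s ^ k) sums h z"
      unfolding y(2) using \<theta> y s
      by (auto intro!: hom_part_sums[where \<theta> = \<theta>] U(3,4))
    then show "g z = h z" using \<open>\<And>k x. hom_part g p k x = hom_part h p k x\<close> sums_unique2 by simp
  qed
qed

text \<open>The partial sums of the homogeneous expansion are polynomials that converge uniformly on a dilation of the
body by some factor \<open>s > 1\<close>, whose interior version is an open neighbourhood of the body.\<close>

lemma agree_all:
  assumes \<nu>: "\<nu> \<in> dual_germs K" "\<nu>' \<in> dual_germs K" and ag: "\<And>\<zeta>. agree K \<nu> \<nu>' (expf \<zeta>)"
    and "hol_near K h"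
  shows "agree K \<nu> \<nu>' h"
proof -
  obtain U where U: "open U" "K \<subseteq> U" "hol_on U h" using assms(4) unfolding hol_near_def by blast
  have p: "p \<in> U" using U p_mem_K by blast
  obtain \<theta> where \<theta>: "\<theta> > 1" "\<And>y t. y \<in> K0 \<Longrightarrow> cmod t \<le> \<theta> \<Longrightarrow> p + t *s y \<in> U"
    using dilation_in_open[OF U(1,2)] by blast
  obtain B where B: "B > 0" "\<And>y t. y \<in> K0 \<Longrightarrow> cmod t \<le> \<theta> \<Longrightarrow> cmod (h (p + t *s y)) \<le> B"
  proof -
    have "\<theta> > 0" using \<theta>(1) by simp
    from bounded_on_dilation[OF U(3) this \<theta>(2)] that show ?thesis by blast
  qed
  define s where "s = (1 + \<theta>) / 2"
  have s: "s > 1" "s < \<theta>" using \<theta> by (auto simp: s_def)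
  \<comment> \<open>The margin between \<open>s\<close> and \<open>\<theta>\<close> gives the geometric decay \<open>(s / \<theta>)\<^bsup>n\<^esup>\<close> of the tail.\<close>
  let ?V = "(\<lambda>y. p + s *\<^sub>R y) ` interior K0"
  define G where "G n z = (\<Sum>k\<le>n. hom_part h p k (z - p))" for n z
  have G: "G n = (\<lambda>z. \<Sum>k\<le>n. \<Sum>a | mdeg a = k. taylor_coeff h p a * mpow (z - p) a)" for n
    unfolding G_def hom_part_poly[OF U(3,1) p] by simp
  have mono: "agree K \<nu> \<nu>' (\<lambda>z. c * mpow (z - p) a)" for c a
    using agree_lincomb[OF \<nu> hol_near_UNIV[OF hol_on_mpow] hol_near_UNIV[OF hol_on_expf] agree_mpow[OF \<nu> ag] ag,
        where a = c and b = 0] by simp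
  show ?thesis
  proof (rule agree_limit[OF \<nu> open_dilation[OF s(1)]])
    show "hol_on ?V (G n)" for n
      unfolding G by (intro hol_on_sum hol_on_mult hol_on_const hol_on_mpow)
    have "?V \<subseteq> U"
    proof
      fix z assume "z \<in> ?V"
      then obtain y where "y \<in> interior K0" "z = p + complex_of_real s *s y" by (auto simp: scaleR_smult)
      moreover have "cmod (complex_of_real s) \<le> \<theta>" using s by simp
      ultimately show "z \<in> U" using \<theta>(2) subsetD[OF interior_subset] by blast
    qed
    then show "hol_on ?V h" using U(3) hol_on_subset by blast
    have hm: "hol_on UNIV (\<lambda>z. c * mpow (z - p) a)" for c a
      by (intro hol_on_mult hol_on_const hol_on_mpow)
    show "agree K \<nu> \<nu>' (G n)" for n
      unfolding G by (rule agree_sum[OF \<nu>], rule hol_on_sum, rule hm, rule agree_sum[OF \<nu> hm mono])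
    fix L assume L: "L \<subseteq> ?V"
    have err: "cmod (G n z - h z) \<le> B * (s / \<theta>) ^ Suc n / (1 - s / \<theta>)" if zL: "z \<in> L" for n z
    proof -
      obtain y where y: "y \<in> K0" "z = p + complex_of_real s *s y"
        using subsetD[OF L zL] subsetD[OF interior_subset[of K0]] by (auto simp: scaleR_smult)
      have "G n z = (\<Sum>k\<le>n. hom_part h p k y * complex_of_real s ^ k)"
        unfolding G_def y(2) by (simp add: hom_part_scale[OF U(3,1) p] mult.commute)
      then have "cmod (h z - G n z) \<le> B * (cmod (complex_of_real s) / \<theta>) ^ Suc n / (1 - cmod (complex_of_real s) / \<theta>)"
        unfolding y(2) using \<theta> B y s by (simp only:) (intro hom_part_remainder[OF U(3)], auto)
      then show ?thesis using s by (simp add: norm_minus_commute)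
    qed
    have lim: "(\<lambda>n. B * (s / \<theta>) ^ Suc n / (1 - s / \<theta>)) \<longlonglongrightarrow> B * 0 / (1 - s / \<theta>)"
      using s \<theta> by (intro tendsto_intros LIMSEQ_Suc LIMSEQ_realpow_zero) auto
    show "uniform_limit L G h sequentially"
    proof (rule uniform_limitI)
      fix e :: real assume "e > 0"
      then have "B * 0 / (1 - s / \<theta>) < e" by simp
      from order_tendstoD(2)[OF lim this]
      show "\<forall>\<^sub>F n in sequentially. \<forall>z\<in>L. dist (G n z) (h z) < e"
      proof (rule eventually_mono, intro ballI)
        fix n z assume lt: "B * (s / \<theta>) ^ Suc n / (1 - s / \<theta>) < e" and "z \<in> L"
        from le_less_trans[OF err[OF this(2)] lt]
        show "dist (G n z) (h z) < e" unfolding dist_norm .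
      qed
    qed
  qed
qed

theorem inj_on_FB_conj: "inj_on (FB_conj K) (dual_germs K)"
proof (rule inj_onI)
  fix \<nu> \<nu>' assume \<nu>: "\<nu> \<in> dual_germs K" "\<nu>' \<in> dual_germs K" and eq: "FB_conj K \<nu> = FB_conj K \<nu>'"
  have "agree K \<nu> \<nu>' (expf \<zeta>)" for \<zeta>
    using fun_cong[OF eq, of \<zeta>] by (simp add: FB_conj_def agree_def)
  then have "\<nu> (germ K h) = \<nu>' (germ K h)" if "hol_near K h" for h
    using agree_all[OF \<nu> _ that] by (simp add: agree_def)
  moreover have "\<nu> \<in> extensional (germs K)" "\<nu>' \<in> extensional (germs K)"
    using \<nu> by (auto simp: dual_germs_def)
  ultimately show "\<nu> = \<nu>'" by (intro extensionalityI[of _ "germs K"]) (auto simp: germs_def)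
qed

end

section \<open>The push-forward in the Fock bases\<close>

text \<open>The members of the two bases, indexed by the multi-index itself instead of its number.\<close>

definition fock :: "complex^'d \<Rightarrow> ('d::finite \<Rightarrow> nat) \<Rightarrow> complex^'d \<Rightarrow> complex" where
  "fock p a z = complex_of_real (exp (- (norm p)\<^sup>2 / 2) / sqrt (real (mfact a)))
     * mpow (z - p) a * exp (herm z p)"

lemma fock_basis_eq: "fock_basis \<alpha> p i = fock p (\<alpha> i)"
  by (simp add: fun_eq_iff fock_basis_def fock_def)

lemma mfact_pos: "mfact a > 0"
  by (simp add: mfact_def prod_pos)

lemma hol_on_fock: "hol_on U (fock p a)"
  unfolding fock_def by (intro hol_on_mult hol_on_const hol_on_mpow hol_on_exp hol_on_herm)

text \<open>The functional whose conjugate transform is \<open>fock p a\<close>. As \<open>taylor_coeff\<close> is \<open>1 / a!\<close> times a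
derivative, the factor \<open>sqrt (a!)\<close> here is \<open>a! / sqrt (a!)\<close>.\<close>

definition fock_functional :: "complex^'d \<Rightarrow> ('d::finite \<Rightarrow> nat) \<Rightarrow> (complex^'d \<Rightarrow> complex) \<Rightarrow> complex" where
  "fock_functional p a h = complex_of_real (exp (- (norm p)\<^sup>2 / 2) * sqrt (real (mfact a)))
     * taylor_coeff (\<lambda>z. exp (- herm (z - p) p) * h z) p a"

lemma hol_on_damp: "hol_on U (\<lambda>z. exp (- herm (z - p) p))"
proof -
  have "hol_on U (\<lambda>z. 0 * 0 + (- 1) * herm (z - p) p)"
    by (intro hol_on_lincomb hol_on_const hol_on_herm_diff)
  then show ?thesis by (intro hol_on_exp) simp
qed

lemma higher_deriv_exp:
  "(deriv ^^ k) (\<lambda>t. A * exp (c * t)) = (\<lambda>t. A * c ^ k * exp (c * t :: complex))"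
proof (induction k)
  case (Suc k)
  have "deriv (\<lambda>t. A * c ^ k * exp (c * t)) t = A * c ^ Suc k * exp (c * t)" for t
    by (rule DERIV_imp_deriv) (auto intro!: derivative_eq_intros simp: mult_ac)
  then show ?case unfolding funpow.simps(2) comp_apply Suc.IH by (rule ext)
qed simp

text \<open>Along each slice the function is a one-variable exponential, and the multinomial theorem expands its
homogeneous parts.\<close>

lemma taylor_coeff_exp: "taylor_coeff (\<lambda>z. A * exp (herm (z - p) w)) p a = A * cnj (mpow w a) / of_nat (mfact a)"
proof (rule taylor_coeff_unique[where c = "\<lambda>a. A * cnj (mpow w a) / of_nat (mfact a)", OF _ refl])
  fix x
  let ?y = "\<chi> i. x $ i * cnj (w $ i)"
  have m: "mpow ?y b = mpow x b * cnj (mpow w b)" for b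
    by (simp add: mpow_def power_mult_distrib prod.distrib)
  have "hom_part (\<lambda>z. A * exp (herm (z - p) w)) p (mdeg a) x = A * (herm x w ^ mdeg a / fact (mdeg a))"
    using higher_deriv_exp[of "mdeg a" A "herm x w"]
    by (simp add: hom_part_def herm_scale_left mult.commute)
  also have "herm x w ^ mdeg a / fact (mdeg a) = (\<Sum>b | mdeg b = mdeg a. mpow x b * cnj (mpow w b) / of_nat (mfact b))"
    using multinomial[of ?y "mdeg a"] unfolding m by (simp add: herm_def)
  finally show "hom_part (\<lambda>z. A * exp (herm (z - p) w)) p (mdeg a) x
     = (\<Sum>b | mdeg b = mdeg a. A * cnj (mpow w b) / of_nat (mfact b) * mpow x b)"
    by (simp add: sum_distrib_left mult_ac)
qed

lemma sqrt_over_self: "x > 0 \<Longrightarrow> sqrt x / x = 1 / sqrt x"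
  by (simp add: field_simps)

lemma fock_functional_expf: "fock_functional p a (expf \<zeta>) = cnj (fock p a \<zeta>)"
proof -
  have "exp (- herm (z - p) p) * expf \<zeta> z = exp (herm p \<zeta>) * exp (herm (z - p) (\<zeta> - p))" for z
    unfolding expf_def exp_add[symmetric] by (simp add: herm_diff_left herm_diff_right algebra_simps)
  then have "fock_functional p a (expf \<zeta>) = complex_of_real (exp (- (norm p)\<^sup>2 / 2) * sqrt (real (mfact a)))
      * (exp (herm p \<zeta>) * cnj (mpow (\<zeta> - p) a) / of_nat (mfact a))"
    unfolding fock_functional_def by (simp only: taylor_coeff_exp)
  also have "\<dots> = complex_of_real (exp (- (norm p)\<^sup>2 / 2) * (sqrt (real (mfact a)) / real (mfact a)))
      * cnj (mpow (\<zeta> - p) a) * exp (herm p \<zeta>)"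
    by simp
  also have "\<dots> = cnj (fock p a \<zeta>)"
    using mfact_pos[of a] by (simp add: sqrt_over_self fock_def cnj_herm exp_cnj)
  finally show ?thesis .
qed

lemma fock_functional_cong:
  assumes "open U" "p \<in> U" "\<And>z. z \<in> U \<Longrightarrow> g z = h z"
  shows "fock_functional p a g = fock_functional p a h"
proof -
  have "taylor_coeff (\<lambda>z. exp (- herm (z - p) p) * g z) p a = taylor_coeff (\<lambda>z. exp (- herm (z - p) p) * h z) p a"
    by (rule taylor_coeff_cong[OF assms(1,2)]) (simp add: assms(3))
  then show ?thesis by (simp add: fock_functional_def)
qed

lemma fock_functional_linear:
  assumes "hol_on U g" "hol_on U h" "open U" "p \<in> U"
  shows "fock_functional p a (\<lambda>z. s * g z + t * h z) = s * fock_functional p a g + t * fock_functional p a h"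
proof -
  let ?E = "\<lambda>z. exp (- herm (z - p) p)"
  have "taylor_coeff (\<lambda>z. s * (?E z * g z) + t * (?E z * h z)) p a = s * taylor_coeff (\<lambda>z. ?E z * g z) p a + t * taylor_coeff (\<lambda>z. ?E z * h z) p a"
    by (rule taylor_coeff_linear[OF hol_on_mult[OF hol_on_damp assms(1)] hol_on_mult[OF hol_on_damp assms(2)] assms(3,4)])
  moreover have "(\<lambda>z. s * (?E z * g z) + t * (?E z * h z)) = (\<lambda>z. ?E z * (s * g z + t * h z))"
    by (simp add: fun_eq_iff algebra_simps)
  ultimately show ?thesis by (simp add: fock_functional_def algebra_simps)
qed

lemma fock_functional_sum:
  assumes "finite J" "\<And>j. j \<in> J \<Longrightarrow> hol_on U (h j)" "open U" "p \<in> U"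
  shows "fock_functional p a (\<lambda>z. \<Sum>j\<in>J. c j * h j z) = (\<Sum>j\<in>J. c j * fock_functional p a (h j))"
  using assms(1,2)
proof (induction J rule: finite_induct)
  case empty
  show ?case using fock_functional_linear[OF hol_on_const hol_on_const assms(3,4), where s = 0 and t = 0] by simp
next
  case (insert j J)
  have "fock_functional p a (\<lambda>z. c j * h j z + 1 * (\<Sum>j\<in>J. c j * h j z))
      = c j * fock_functional p a (h j) + 1 * fock_functional p a (\<lambda>z. \<Sum>j\<in>J. c j * h j z)"
    using insert.prems by (intro fock_functional_linear[OF _ _ assms(3,4)] hol_on_sum hol_on_mult hol_on_const) auto
  then show ?case using insert by simp
qed

lemma sum_mdeg_le:
  fixes F :: "('d::finite \<Rightarrow> nat) \<Rightarrow> 'b::comm_monoid_add"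
  shows "(\<Sum>a | mdeg a \<le> m. F a) = (\<Sum>k\<le>m. \<Sum>a | mdeg a = k. F a)"
proof -
  have "{a :: 'd \<Rightarrow> nat. mdeg a \<le> m} = (\<Union>k\<in>{..m}. {a. mdeg a = k})" by auto
  then show ?thesis by (simp only:) (rule sum.UNION_disjoint, auto simp: finite_mdeg)
qed

text \<open>The functions \<open>fock q b\<close> are an orthonormal basis of the Fock space with reproducing kernel \<open>expf\<close>. The
partial sum over degrees at most \<open>m\<close> is the kernel with the exponential series in
\<open>herm (w - q) (\<zeta> - q)\<close> truncated.\<close>

lemma fock_kernel:
  "(\<Sum>b | mdeg b \<le> m. cnj (fock q b \<zeta>) * fock q b w)
     = exp (herm q \<zeta> + herm w q - herm q q) * (\<Sum>k\<le>m. herm (w - q) (\<zeta> - q) ^ k / fact k)"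
proof -
  let ?y = "\<chi> i. (w - q) $ i * cnj ((\<zeta> - q) $ i)"
  have one: "cnj (fock q b \<zeta>) * fock q b w
      = exp (herm q \<zeta> + herm w q - herm q q) * (mpow ?y b / of_nat (mfact b))" for b
  proof -
    let ?c = "exp (- (norm q)\<^sup>2 / 2) / sqrt (real (mfact b))"
    have "?c * ?c = exp (- (norm q)\<^sup>2) / real (mfact b)"
      using mfact_pos[of b] by (simp add: exp_add[symmetric])
    then have "complex_of_real ?c * complex_of_real ?c = complex_of_real (exp (- (norm q)\<^sup>2) / real (mfact b))"
      by (simp only: of_real_mult[symmetric])
    also have "\<dots> = exp (- herm q q) / of_nat (mfact b)"
      by (simp only: of_real_divide exp_of_real[symmetric] of_real_minus of_real_of_nat_eq herm_self)
    finally have "complex_of_real ?c * complex_of_real ?c = exp (- herm q q) / of_nat (mfact b)" .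
    moreover have "mpow ?y b = mpow (w - q) b * cnj (mpow (\<zeta> - q) b)"
      by (simp add: mpow_def power_mult_distrib prod.distrib)
    moreover have "cnj (fock q b \<zeta>) * fock q b w = (complex_of_real ?c * complex_of_real ?c)
        * (mpow (w - q) b * cnj (mpow (\<zeta> - q) b)) * (exp (herm q \<zeta>) * exp (herm w q))"
      by (simp only: fock_def complex_cnj_mult complex_cnj_complex_of_real exp_cnj cnj_herm mult_ac)
    ultimately show ?thesis by (simp add: exp_add exp_diff exp_minus field_simps)
  qed
  have "(\<Sum>b | mdeg b = k. cnj (fock q b \<zeta>) * fock q b w)
     = exp (herm q \<zeta> + herm w q - herm q q) * (herm (w - q) (\<zeta> - q) ^ k / fact k)" for k
    using multinomial[of ?y k] unfolding one sum_distrib_left[symmetric] by (simp add: herm_def)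
  then show ?thesis unfolding sum_mdeg_le sum_distrib_left by simp
qed

lemma expf_kernel: "expf \<zeta> w = exp (herm q \<zeta> + herm w q - herm q q) * exp (herm (w - q) (\<zeta> - q))"
  unfolding expf_def exp_add[symmetric] by (simp add: herm_diff_left herm_diff_right)

text \<open>Cauchy estimates on discs of radius \<open>\<theta>\<close> give the bound \<open>C \<theta>\<^bsup>m + 1 - k\<^esup>\<close>, and \<open>\<theta>\<close> tends to \<open>0\<close>.\<close>

lemma hom_part_vanish:
  assumes "hol_on U h" "open U" "p \<in> U" "k \<le> m" "\<delta> > 0"
    and small: "\<And>t. cmod t < \<delta> \<Longrightarrow> cmod (h (p + t *s x)) \<le> C * cmod t ^ Suc m"
  shows "hom_part h p k x = 0"
proof -
  have "open {t. p + t *s x \<in> U}" "0 \<in> {t. p + t *s x \<in> U}" using assms open_slice by auto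
  then obtain r where r0: "r > 0" "cball 0 r \<subseteq> {t. p + t *s x \<in> U}"
    unfolding open_contains_cball by blast
  have r: "p + t *s x \<in> U" if "cmod t \<le> r" for t
    using r0 subsetD[OF r0(2), of t] that by auto
  define \<eta> where "\<eta> = min 1 (min r (\<delta> / 2))"
  have \<eta>: "\<eta> > 0" "\<eta> \<le> 1" "\<eta> \<le> r" "\<eta> < \<delta>" using r0(1) assms(5) by (auto simp: \<eta>_def)
  have C: "C \<ge> 0"
  proof -
    have "0 \<le> C * cmod (complex_of_real \<eta>) ^ Suc m"
      by (rule order_trans[OF norm_ge_zero small]) (use \<eta> in simp)
    then have "0 \<le> C * \<eta> ^ Suc m" using \<eta> by simp
    moreover have "\<eta> ^ Suc m > 0" using \<eta>(1) by (rule zero_less_power)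
    ultimately show ?thesis by (simp only: zero_le_mult_iff) linarith
  qed
  have bound: "cmod (hom_part h p k x) \<le> C * \<theta>" if \<theta>: "0 < \<theta>" "\<theta> \<le> \<eta>" for \<theta>
  proof -
    have "cmod (hom_part h p k x) \<le> C * \<theta> ^ Suc m / \<theta> ^ k"
    proof (rule hom_part_bound[OF assms(1)])
      fix t assume t: "cmod t \<le> \<theta>"
      show "p + t *s x \<in> U" using t \<theta> \<eta> by (intro r) simp
      have "cmod (h (p + t *s x)) \<le> C * cmod t ^ Suc m" using t \<theta> \<eta> by (intro small) simp
      also have "\<dots> \<le> C * \<theta> ^ Suc m" using t C by (intro mult_left_mono power_mono) auto
      finally show "cmod (h (p + t *s x)) \<le> C * \<theta> ^ Suc m" .
    qed (fact \<theta>)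
    also have "\<dots> = C * (\<theta> * \<theta> ^ (m - k))"
      using \<theta> assms(4) by (simp add: power_diff)
    also have "\<dots> \<le> C * (\<theta> * 1)"
      using \<theta> \<eta> C by (intro mult_left_mono power_le_one) auto
    finally show ?thesis by simp
  qed
  have "(\<lambda>n. C * (\<eta> / real (Suc n))) \<longlonglongrightarrow> C * 0"
    by (intro tendsto_intros LIMSEQ_Suc lim_const_over_n)
  moreover have "cmod (hom_part h p k x) \<le> C * (\<eta> / real (Suc n))" for n
    using \<eta> by (intro bound) (auto simp: divide_le_eq)
  ultimately have "cmod (hom_part h p k x) \<le> C * 0"
    by (intro LIMSEQ_le_const) auto
  then show ?thesis by simp
qed

lemma fock_functional_eq_0:
  assumes "hol_on U h" "open U" "p \<in> U" "mdeg a \<le> m"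
    and "\<And>x. \<exists>\<delta>>0. \<exists>C. \<forall>t. cmod t < \<delta> \<longrightarrow> cmod (exp (- herm (t *s x) p) * h (p + t *s x)) \<le> C * cmod t ^ Suc m"
  shows "fock_functional p a h = 0"
proof -
  have "hom_part (\<lambda>z. exp (- herm (z - p) p) * h z) p (mdeg a) x = 0" for x
  proof -
    obtain \<delta> C where "\<delta> > 0" "\<And>t. cmod t < \<delta> \<Longrightarrow> cmod (exp (- herm (t *s x) p) * h (p + t *s x)) \<le> C * cmod t ^ Suc m"
      using assms(5) by blast
    then show ?thesis
      by (intro hom_part_vanish[OF hol_on_mult[OF hol_on_damp assms(1)] assms(2-4), where C = C and \<delta> = \<delta>]) auto
  qed
  then show ?thesis by (simp add: fock_functional_def taylor_coeff_def grid_coeff_def)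
qed

text \<open>The two sides differ by the functional applied to a kernel remainder, which has order \<open>m + 1\<close> in
\<open>g z - g p\<close> and therefore in \<open>z - p\<close>; a Taylor coefficient of degree at most \<open>m\<close> does not see it. Thus the
finite sum is exact.\<close>

lemma fock_functional_expf_compose:
  fixes g :: "complex^'d \<Rightarrow> complex^'r"
  assumes g: "hol_map_on U g" and U: "open U" "p \<in> U" and a: "mdeg a \<le> m"
  shows "fock_functional p a (\<lambda>z. expf \<zeta> (g z)) = (\<Sum>b | mdeg b \<le> m. cnj (fock (g p) b \<zeta>) * fock_functional p a (\<lambda>z. fock (g p) b (g z)))"
proof -
  define q where "q = g p"
  define Y where "Y z = herm (g z - q) (\<zeta> - q)" for z
  define A where "A z = exp (- herm (z - p) p) * exp (herm q \<zeta> + herm (g z) q - herm q q)" for z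
  define S where "S z = (\<Sum>b | mdeg b \<le> m. cnj (fock q b \<zeta>) * fock q b (g z))" for z
  have hY: "hol_on U Y" unfolding Y_def by (rule hol_on_compose_map[OF g hol_on_herm_diff])
  have hA: "hol_on U A"
  proof -
    have "hol_on U (\<lambda>z. (herm q \<zeta> - herm q q) + herm (g z) q)"
      by (intro hol_on_add hol_on_const hol_on_compose_map[OF g] hol_on_herm)
    then have "hol_on U (\<lambda>z. herm q \<zeta> + herm (g z) q - herm q q)" by (simp add: algebra_simps)
    then show ?thesis unfolding A_def by (intro hol_on_mult hol_on_damp hol_on_exp)
  qed
  have hS: "hol_on U S" unfolding S_def
    by (intro hol_on_sum hol_on_mult hol_on_const hol_on_compose_map[OF g hol_on_fock])
  have hE: "hol_on U (\<lambda>z. expf \<zeta> (g z))" by (rule hol_on_compose_map[OF g hol_on_expf])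
  have R: "exp (- herm (z - p) p) * (1 * expf \<zeta> (g z) + (-1) * S z) = A z * (exp (Y z) - (\<Sum>k\<le>m. Y z ^ k / fact k))" for z
    unfolding S_def fock_kernel expf_kernel[of \<zeta> "g z" q] A_def Y_def by (simp add: algebra_simps)
  have zero: "fock_functional p a (\<lambda>z. 1 * expf \<zeta> (g z) + (-1) * S z) = 0"
  proof (rule fock_functional_eq_0[OF hol_on_lincomb[OF hE hS] U a])
    fix x :: "complex^'d"
    obtain \<delta>1 M1 where 1: "\<delta>1 > 0" "cball p \<delta>1 \<subseteq> U" "\<And>z. z \<in> cball p \<delta>1 \<Longrightarrow> cmod (A z) \<le> M1" "M1 > 0"
      using hol_on_local_bound[OF hA U] by blast
    obtain \<delta>2 M2 where 2: "\<delta>2 > 0" "cball p \<delta>2 \<subseteq> U" "\<And>z. z \<in> cball p \<delta>2 \<Longrightarrow> cmod (Y z) \<le> M2" "M2 > 0"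
      using hol_on_local_bound[OF hY U] by blast
    define \<theta> where "\<theta> = min \<delta>1 \<delta>2 / (norm x + 1)"
    have n1: "norm x + 1 > 0" by (simp add: add_nonneg_pos)
    have \<theta>: "\<theta> > 0" using 1(1) 2(1) n1 by (simp add: \<theta>_def)
    have inb: "p + t *s x \<in> cball p \<delta>1" "p + t *s x \<in> cball p \<delta>2" if "cmod t \<le> \<theta>" for t
    proof -
      have "cmod t * norm x \<le> \<theta> * (norm x + 1)" using that \<theta> by (intro mult_mono) auto
      also have "\<dots> = min \<delta>1 \<delta>2" using n1 by (simp add: \<theta>_def)
      finally show "p + t *s x \<in> cball p \<delta>1" "p + t *s x \<in> cball p \<delta>2"
        unfolding mem_cball dist_add_right_norm norm_smult_vec by auto
    qed
    \<comment> \<open>\<open>Y\<close> vanishes at \<open>p\<close>, so the remainder estimate of order \<open>0\<close> bounds it linearly in \<open>t\<close>.\<close>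
    have Ybound: "cmod (Y (p + t *s x)) \<le> 2 * M2 / \<theta> * cmod t" if t: "cmod t < \<theta> / 2" for t
    proof -
      have Y0: "hom_part Y p 0 x = 0" by (simp add: hom_part_def Y_def q_def herm_def)
      have q: "cmod t / \<theta> \<le> 1 / 2" "0 \<le> cmod t / \<theta>" using t \<theta> by (auto simp: field_simps)
      then have q1: "0 < (1 - cmod t / \<theta>) * (1 / 2)" by (intro mult_pos_pos) linarith+
      have "cmod (Y (p + t *s x) - (\<Sum>k\<le>0. hom_part Y p k x * t ^ k)) \<le> M2 * (cmod t / \<theta>) ^ Suc 0 / (1 - cmod t / \<theta>)"
        using inb(2) 2 t \<theta> by (intro hom_part_remainder[OF hY]) auto
      also have "\<dots> \<le> M2 * (cmod t / \<theta>) ^ Suc 0 / (1 / 2)"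
      proof (rule divide_left_mono[OF _ _ q1])
        show "1 / 2 \<le> 1 - cmod t / \<theta>" using q(1) by linarith
        show "0 \<le> M2 * (cmod t / \<theta>) ^ Suc 0" using q(2) 2(4) by (intro mult_nonneg_nonneg zero_le_power) auto
      qed
      finally show ?thesis by (simp add: Y0 mult_ac)
    qed
    have main: "cmod (exp (- herm (t *s x) p) * (1 * expf \<zeta> (g (p + t *s x)) + (-1) * S (p + t *s x)))
        \<le> (M1 * (exp M2 * (2 * M2 / \<theta>) ^ Suc m)) * cmod t ^ Suc m" if t: "cmod t < \<theta> / 2" for t
    proof -
      let ?z = "p + t *s x"
      have t': "cmod t \<le> \<theta>" using t \<theta> by simp
      have Y2: "cmod (Y ?z) \<le> M2" using inb(2)[OF t'] 2(3) by blast
      have "cmod (exp (Y ?z) - (\<Sum>k\<le>m. Y ?z ^ k / fact k)) \<le> exp \<bar>Re (Y ?z)\<bar> * cmod (Y ?z) ^ Suc m / fact m"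
        using Taylor_exp[of "Y ?z" m] by simp
      also have "\<dots> \<le> exp \<bar>Re (Y ?z)\<bar> * cmod (Y ?z) ^ Suc m / 1"
        by (intro divide_left_mono mult_nonneg_nonneg) auto
      also have "\<dots> \<le> exp M2 * (2 * M2 / \<theta> * cmod t) ^ Suc m"
        unfolding div_by_1 using abs_Re_le_cmod[of "Y ?z"] Y2 Ybound[OF t] by (intro mult_mono power_mono) auto
      finally have "cmod (A ?z * (exp (Y ?z) - (\<Sum>k\<le>m. Y ?z ^ k / fact k))) \<le> M1 * (exp M2 * (2 * M2 / \<theta> * cmod t) ^ Suc m)"
        unfolding norm_mult using 1(3)[OF inb(1)[OF t']] 1(4) by (intro mult_mono) auto
      then show ?thesis using R[of ?z] by (simp only: add_diff_cancel_left' power_mult_distrib mult.assoc)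
    qed
    show "\<exists>\<delta>>0. \<exists>C. \<forall>t. cmod t < \<delta> \<longrightarrow>
        cmod (exp (- herm (t *s x) p) * (1 * expf \<zeta> (g (p + t *s x)) + (-1) * S (p + t *s x))) \<le> C * cmod t ^ Suc m"
    proof (intro exI conjI allI impI)
      show "\<theta> / 2 > 0" using \<theta> by simp
    qed (rule main)
  qed
  have "fock_functional p a S = (\<Sum>b | mdeg b \<le> m. cnj (fock q b \<zeta>) * fock_functional p a (\<lambda>z. fock q b (g z)))"
    unfolding S_def by (rule fock_functional_sum[OF finite_mdeg_le _ U]) (rule hol_on_compose_map[OF g hol_on_fock])
  then show ?thesis
    using zero fock_functional_linear[OF hE hS U, of a 1 "-1"] by (simp add: q_def)
qed

text \<open>The functional on germs. Any representative may be chosen, as the value depends only on the function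
near \<open>p\<close>.\<close>

definition fock_germ :: "(complex^'d) set \<Rightarrow> complex^'d \<Rightarrow> ('d::finite \<Rightarrow> nat) \<Rightarrow> (complex^'d \<Rightarrow> complex) set \<Rightarrow> complex" where
  "fock_germ S p a = (\<lambda>G\<in>germs S. fock_functional p a (SOME h. h \<in> G))"

lemma fock_germ_germ:
  assumes "hol_near S h" "p \<in> S"
  shows "fock_germ S p a (germ S h) = fock_functional p a h"
proof -
  have "(SOME g. g \<in> germ S h) \<in> germ S h" by (rule someI[where P = "\<lambda>g. g \<in> germ S h", OF germ_self[OF assms(1)]])
  then obtain U where "open U" "S \<subseteq> U" "\<And>z. z \<in> U \<Longrightarrow> (SOME g. g \<in> germ S h) z = h z"
    unfolding germ_def by blast
  then have "fock_functional p a (SOME g. g \<in> germ S h) = fock_functional p a h"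
    using assms(2) by (intro fock_functional_cong[of U]) auto
  moreover have "germ S h \<in> germs S" using assms(1) by (auto simp: germs_def)
  ultimately show ?thesis by (simp add: fock_germ_def)
qed

lemma fock_independent:
  assumes "finite B" "\<And>w :: complex^'d. (\<Sum>b\<in>B. c b * fock q b w) = 0" "b \<in> B"
  shows "c b = 0"
proof -
  let ?\<kappa> = "\<lambda>b. complex_of_real (exp (- (norm q)\<^sup>2 / 2) / sqrt (real (mfact b)))"
  have "(\<Sum>b\<in>B. (c b * ?\<kappa> b) * mpow x b) = 0" for x
  proof -
    have "(\<Sum>b\<in>B. (c b * ?\<kappa> b) * mpow x b) * exp (herm (q + x) q) = (\<Sum>b\<in>B. c b * fock q b (q + x))"
      unfolding sum_distrib_right by (intro sum.cong) (simp_all add: fock_def)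
    then show ?thesis using assms(2) by simp
  qed
  from mpow_independent[OF assms(1) this assms(3)] show ?thesis
    using mfact_pos[of b] by simp
qed

context abs_convex_body
begin

text \<open>A Taylor coefficient is a combination of homogeneous parts at finitely many nodes, and each of these is
bounded by the Cauchy estimate on a small disc inside the body. Hence the body itself serves as the compact
set in the continuity condition.\<close>

lemma taylor_coeff_bound:
  "\<exists>B\<ge>0. \<forall>h U M. open U \<longrightarrow> K \<subseteq> U \<longrightarrow> hol_on U h \<longrightarrow> (\<forall>z\<in>K. cmod (h z) \<le> M) \<longrightarrow> cmod (taylor_coeff h p a) \<le> B * M"
proof -
  obtain e where e: "e > 0" "ball 0 e \<subseteq> K0"
    using zero_interior unfolding mem_interior by blast
  define \<delta> where "\<delta> s = e / (2 * (norm (node s :: complex^'d) + 1))" for s :: "'d \<Rightarrow> nat"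
  have n1: "norm (node s :: complex^'d) + 1 > 0" for s :: "'d \<Rightarrow> nat" by (simp add: add_nonneg_pos)
  have \<delta>: "\<delta> s > 0" for s using e n1[of s] by (simp add: \<delta>_def)
  have inK: "p + t *s node s \<in> K" if "cmod t \<le> \<delta> s" for t s
  proof -
    have "cmod t * norm (node s :: complex^'d) \<le> \<delta> s * (norm (node s :: complex^'d) + 1)"
      using that \<delta>[of s] by (intro mult_mono) auto
    also have "\<dots> = e / 2" using n1[of s] by (simp add: \<delta>_def field_simps)
    finally have "t *s node s \<in> ball (0 :: complex^'d) e" using e by (simp add: norm_smult_vec)
    then show ?thesis using e unfolding K_def by blast
  qed
  let ?k = "mdeg a"
  let ?c = "\<lambda>s :: 'd \<Rightarrow> nat. \<Prod>i\<in>UNIV. Polynomial.coeff (lagrange_poly ?k (s i)) (a i)"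
  define B where "B = (\<Sum>s\<in>index_box ?k. cmod (?c s) / \<delta> s ^ ?k)"
  have "cmod (taylor_coeff h p a) \<le> B * M" if h: "open U" "K \<subseteq> U" "hol_on U h" "\<And>z. z \<in> K \<Longrightarrow> cmod (h z) \<le> M" for h U M
  proof -
    have "cmod (hom_part h p ?k (node s)) \<le> M / \<delta> s ^ ?k" for s
    proof (rule hom_part_bound[OF h(3) _ \<delta>])
      show "p + t *s node s \<in> U" if "cmod t \<le> \<delta> s" for t using inK[OF that] h(2) by blast
      show "cmod (h (p + t *s node s)) \<le> M" if "cmod t \<le> \<delta> s" for t using inK[OF that] h(4) by blast
    qed
    then have "cmod (taylor_coeff h p a) \<le> (\<Sum>s\<in>index_box ?k. cmod (?c s) * (M / \<delta> s ^ ?k))"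
      unfolding taylor_coeff_def grid_coeff_def
      by (intro sum_norm_le) (simp only: norm_mult, rule mult_left_mono, auto)
    then show ?thesis by (simp add: B_def sum_distrib_right)
  qed
  moreover have "B \<ge> 0" unfolding B_def using \<delta> by (intro sum_nonneg divide_nonneg_pos zero_less_power) auto
  ultimately show ?thesis
  proof (intro exI[of _ B] conjI allI impI)
  qed auto
qed

lemma fock_germ_dual: "fock_germ K p a \<in> dual_germs K"
proof -
  from taylor_coeff_bound[of a] obtain B where B: "B \<ge> 0"
    and B2: "\<forall>h U M. open U \<longrightarrow> K \<subseteq> U \<longrightarrow> hol_on U h \<longrightarrow> (\<forall>z\<in>K. cmod (h z) \<le> M) \<longrightarrow> cmod (taylor_coeff h p a) \<le> B * M"
    by (elim exE conjE) (rule that)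
  obtain M where M: "M > 0" "\<And>z. z \<in> K \<Longrightarrow> cmod (exp (- herm (z - p) p)) \<le> M"
    using compact_continuous_bound[OF compact_K hol_on_continuous[OF hol_on_damp]] by blast
  define c where "c = cmod (complex_of_real (exp (- (norm p)\<^sup>2 / 2) * sqrt (real (mfact a))))"
  have lin: "fock_germ K p a (germ K (\<lambda>z. s * g z + t * h z)) = s * fock_germ K p a (germ K g) + t * fock_germ K p a (germ K h)"
    if gh: "hol_near K g" "hol_near K h" for g h s t
  proof -
    obtain U where U: "open U" "K \<subseteq> U" "hol_on U g" "hol_on U h" using hol_near_common[OF gh] by blast
    have "hol_near K (\<lambda>z. s * g z + t * h z)" by (rule hol_nearI[OF U(1,2) hol_on_lincomb[OF U(3,4)]])
    then show ?thesis using fock_functional_linear[OF U(3,4,1), of p a s t] U(2) p_mem_K gh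
      by (auto simp: fock_germ_germ)
  qed
  have bound: "cmod (fock_germ K p a (germ K h)) \<le> (c * (B * M)) * (SUP z\<in>K. cmod (h z))"
    if U: "open U" "K \<subseteq> U" "hol_on U h" for U h
  proof -
    let ?S = "SUP z\<in>K. cmod (h z)"
    have "compact ((\<lambda>z. cmod (h z)) ` K)"
      using continuous_on_subset[OF hol_on_continuous[OF U(3)] U(2)] compact_K
      by (intro compact_continuous_image continuous_on_norm)
    then have "bdd_above ((\<lambda>z. cmod (h z)) ` K)"
      by (intro bounded_imp_bdd_above compact_imp_bounded)
    then have S: "cmod (h z) \<le> ?S" if "z \<in> K" for z using that by (rule cSUP_upper2[OF _ _ order_refl])
    have "cmod (taylor_coeff (\<lambda>z. exp (- herm (z - p) p) * h z) p a) \<le> B * (M * ?S)"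
    proof (rule B2[rule_format, OF U(1,2) hol_on_mult[OF hol_on_damp U(3)]])
      fix z assume z: "z \<in> K"
      show "cmod (exp (- herm (z - p) p) * h z) \<le> M * ?S"
        unfolding norm_mult using M(2)[OF z] S[OF z] M(1) by (intro mult_mono) auto
    qed
    then have "c * cmod (taylor_coeff (\<lambda>z. exp (- herm (z - p) p) * h z) p a) \<le> c * (B * (M * ?S))"
      by (rule mult_left_mono) (simp add: c_def)
    then show ?thesis
      unfolding fock_germ_germ[OF hol_nearI[OF U] p_mem_K] fock_functional_def norm_mult[of "complex_of_real _"] c_def[symmetric]
      by (simp only: mult.assoc)
  qed
  have "\<exists>L B. compact L \<and> L \<noteq> {} \<and> L \<subseteq> U \<and> (\<forall>h. hol_on U h \<longrightarrow> cmod (fock_germ K p a (germ K h)) \<le> B * (SUP z\<in>L. cmod (h z)))"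
    if "open U" "K \<subseteq> U" for U
    using bound[OF that] compact_K p_mem_K that by (intro exI[of _ K] exI[of _ "c * (B * M)"]) auto
  then show ?thesis
    unfolding dual_germs_def using lin by (simp add: fock_germ_def)
qed

lemma FB_conj_fock_germ: "FB_conj K (fock_germ K p a) = fock p a"
  unfolding FB_conj_def
  by (simp add: fun_eq_iff fock_germ_germ[OF hol_near_UNIV[OF hol_on_expf] p_mem_K] fock_functional_expf)

lemma germ_of_restriction_eq:
  assumes "hol_near K h" "\<And>z. z \<in> K \<Longrightarrow> h z = k z"
  shows "germ_of_restriction K k = germ K h"
  unfolding germ_of_restriction_def
proof (rule the_equality)
  show "germ K h \<in> germs K \<and> (\<forall>g\<in>germ K h. \<forall>z\<in>K. g z = k z)"
    using assms unfolding germs_def germ_def by auto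
  fix G assume G: "G \<in> germs K \<and> (\<forall>g\<in>G. \<forall>z\<in>K. g z = k z)"
  then obtain g where g: "hol_near K g" "G = germ K g" by (auto simp: germs_def)
  have "g z = h z" if "z \<in> K" for z using G g germ_self[OF g(1)] that assms(2) by auto
  then show "G = germ K h" using germ_eq_of_eq_on_K[OF g(1) assms(1)] g(2) by simp
qed

text \<open>Injectivity of the transform identifies the chosen preimage of \<open>fock p a\<close> with the explicit functional.\<close>

lemma push_tilde_fock:
  fixes g f :: "complex^'d \<Rightarrow> complex^'r"
  assumes g: "hol_map_on U g" and U: "open U" "K \<subseteq> U" and fg: "\<forall>z\<in>K. g z = f z"
  shows "push_tilde K f (fock p a) = (\<lambda>\<zeta>. cnj (fock_functional p a (\<lambda>z. expf \<zeta> (g z))))"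
proof
  fix \<zeta>
  have "inv_into (dual_germs K) (FB_conj K) (fock p a) = fock_germ K p a"
    by (rule inv_into_f_eq) (rule inj_on_FB_conj fock_germ_dual FB_conj_fock_germ)+
  moreover have "germ UNIV (expf \<zeta> :: complex^'r \<Rightarrow> complex) = {expf \<zeta>}"
  proof
    show "germ UNIV (expf \<zeta> :: complex^'r \<Rightarrow> complex) \<subseteq> {expf \<zeta>}"
      by (auto simp: germ_def fun_eq_iff top_unique)
  qed (simp add: germ_self[OF hol_near_UNIV[OF hol_on_expf]])
  moreover have "germ UNIV (expf \<zeta> :: complex^'r \<Rightarrow> complex) \<in> germs UNIV"
    unfolding germs_def using hol_near_UNIV[OF hol_on_expf] by blast
  moreover have n: "hol_near K (\<lambda>z. expf \<zeta> (g z))"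
    by (rule hol_nearI[OF U hol_on_compose_map[OF g hol_on_expf]])
  moreover have "germ_of_restriction K (expf \<zeta> \<circ> f) = germ K (\<lambda>z. expf \<zeta> (g z))"
    by (rule germ_of_restriction_eq[OF n]) (simp add: fg)
  ultimately show "push_tilde K f (fock p a) \<zeta> = cnj (fock_functional p a (\<lambda>z. expf \<zeta> (g z)))"
    by (simp add: push_tilde_def FB_conj_def push_forward_def fock_germ_germ[OF n p_mem_K])
qed

text \<open>The expansion of the push-forward gives one representation matrix, and linear independence of the target
basis shows that it is the only one.\<close>

lemma C_mat_eq:
  fixes g f :: "complex^'d \<Rightarrow> complex^'r" and \<alpha> :: "nat \<Rightarrow> 'd \<Rightarrow> nat" and \<beta> :: "nat \<Rightarrow> 'r \<Rightarrow> nat"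
  assumes g: "hol_map_on U g" and U: "open U" "K \<subseteq> U" and fg: "\<forall>z\<in>K. g z = f z"
    and \<alpha>: "numbering \<alpha>" and \<beta>: "numbering \<beta>"
  shows "C_mat \<alpha> \<beta> K f p m = Matrix.mat (rdim CARD('r) m) (rdim CARD('d) m)
           (\<lambda>(i, j). cnj (fock_functional p (\<alpha> j) (\<lambda>z. fock (f p) (\<beta> i) (g z))))"
proof -
  let ?l = "rdim CARD('r) m" and ?k = "rdim CARD('d) m"
  let ?D = "\<lambda>b j. fock_functional p (\<alpha> j) (\<lambda>z. fock (f p) b (g z))"
  have gp: "g p = f p" using fg p_mem_K by blast
  have push: "push_tilde K f (fock_basis \<alpha> p j) = (\<lambda>w. \<Sum>i<?l. cnj (?D (\<beta> i) j) * fock_basis \<beta> (f p) i w)" if j: "j < ?k" for j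
  proof
    fix w
    have "mdeg (\<alpha> j) \<le> m" using j numbering_less_iff[OF \<alpha>] by blast
    from fock_functional_expf_compose[OF g U(1) subsetD[OF U(2) p_mem_K] this]
    have "push_tilde K f (fock_basis \<alpha> p j) w
        = cnj (\<Sum>b | mdeg b \<le> m. cnj (fock (f p) b w) * ?D b j)"
      unfolding fock_basis_eq push_tilde_fock[OF g U fg] by (simp only: gp)
    also have "\<dots> = (\<Sum>b | mdeg b \<le> m. cnj (?D b j) * fock (f p) b w)"
      by (simp add: mult.commute)
    also have "\<dots> = (\<Sum>i<?l. cnj (?D (\<beta> i) j) * fock (f p) (\<beta> i) w)"
      by (rule sum.reindex_bij_betw[OF numbering_bij[OF \<beta>], symmetric])
    finally show "push_tilde K f (fock_basis \<alpha> p j) w = (\<Sum>i<?l. cnj (?D (\<beta> i) j) * fock_basis \<beta> (f p) i w)"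
      by (simp add: fock_basis_eq)
  qed
  have indep: "c i = 0" if z: "\<And>w. (\<Sum>i<?l. c i * fock_basis \<beta> (f p) i w) = 0" and i: "i < ?l" for c i
  proof -
    define \<iota> where "\<iota> = inv_into {..<?l} \<beta>"
    have inj: "inj_on \<beta> {..<?l}" using numbering_bij[OF \<beta>] by (rule bij_betw_imp_inj_on)
    have \<iota>: "\<iota> (\<beta> i) = i" if "i < ?l" for i unfolding \<iota>_def using that inj by (simp add: inv_into_f_f)
    have "(\<Sum>b\<in>\<beta> ` {..<?l}. c (\<iota> b) * fock (f p) b w) = 0" for w
      unfolding sum.reindex[OF inj] using z[of w] by (simp add: fock_basis_eq \<iota>)
    from fock_independent[OF _ this, of "\<beta> i"] show ?thesis using i by (simp add: \<iota>)
  qed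
  show ?thesis
    unfolding C_mat_def rep_matrix_def
  proof (rule the_equality)
    show "Matrix.mat ?l ?k (\<lambda>(i, j). cnj (?D (\<beta> i) j)) \<in> carrier_mat ?l ?k \<and>
      (\<forall>j<?k. push_tilde K f (fock_basis \<alpha> p j)
         = (\<lambda>w. \<Sum>i<?l. Matrix.mat ?l ?k (\<lambda>(i, j). cnj (?D (\<beta> i) j)) $$ (i, j) * fock_basis \<beta> (f p) i w))"
      using push by auto
    fix A assume A: "A \<in> carrier_mat ?l ?k \<and>
      (\<forall>j<?k. push_tilde K f (fock_basis \<alpha> p j) = (\<lambda>w. \<Sum>i<?l. A $$ (i, j) * fock_basis \<beta> (f p) i w))"
    show "A = Matrix.mat ?l ?k (\<lambda>(i, j). cnj (?D (\<beta> i) j))"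
    proof (rule eq_matI)
      fix i j assume "i < dim_row (Matrix.mat ?l ?k (\<lambda>(i, j). cnj (?D (\<beta> i) j)))"
        "j < dim_col (Matrix.mat ?l ?k (\<lambda>(i, j). cnj (?D (\<beta> i) j)))"
      then have ij: "i < ?l" "j < ?k" by auto
      have "(\<Sum>i<?l. (A $$ (i, j) - cnj (?D (\<beta> i) j)) * fock_basis \<beta> (f p) i w) = 0" for w
        using A push[OF ij(2)] ij(2) by (auto simp: left_diff_distrib sum_subtractf fun_eq_iff)
      from indep[OF this ij(1)] show "A $$ (i, j) = Matrix.mat ?l ?k (\<lambda>(i, j). cnj (?D (\<beta> i) j)) $$ (i, j)"
        using ij by simp
    qed (use A in auto)
  qed
qed

end

section \<open>The Taylor remainder\<close>

lemma sum_power_over_mfact: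
  assumes "s \<ge> 0"
  shows "(\<Sum>b :: 'd::finite \<Rightarrow> nat | mdeg b \<le> m. s ^ mdeg b / real (mfact b)) \<le> exp (real CARD('d) * s)"
proof -
  let ?y = "(\<chi> i. complex_of_real s) :: complex^'d"
  have mp: "mpow ?y b = complex_of_real (s ^ mdeg b)" for b
    by (simp add: mpow_def mdeg_def power_sum)
  have "complex_of_real (\<Sum>b :: 'd \<Rightarrow> nat | mdeg b = k. s ^ mdeg b / real (mfact b)) = complex_of_real ((real CARD('d) * s) ^ k / fact k)" for k
    using multinomial[of ?y k] unfolding mp by simp
  then have "(\<Sum>b :: 'd \<Rightarrow> nat | mdeg b = k. s ^ mdeg b / real (mfact b)) = (real CARD('d) * s) ^ k / fact k" for k
    unfolding of_real_eq_iff .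
  then have "(\<Sum>b :: 'd \<Rightarrow> nat | mdeg b \<le> m. s ^ mdeg b / real (mfact b)) = (\<Sum>k\<le>m. (real CARD('d) * s) ^ k / fact k)"
    unfolding sum_mdeg_le by simp
  also have "\<dots> \<le> (\<Sum>k. (real CARD('d) * s) ^ k / fact k)"
    using assms summable_exp[of "real CARD('d) * s"]
    by (intro sum_le_suminf) (auto simp: field_simps)
  also have "\<dots> = exp (real CARD('d) * s)"
    by (simp add: exp_def field_simps)
  finally show ?thesis .
qed

text \<open>The factor \<open>1 / sqrt (b!)\<close> makes these bounds square summable over all \<open>b\<close>, whatever the size of
\<open>s\<close>.\<close>

lemma norm_fock_le:
  assumes "s \<ge> 0" "\<And>i. cmod ((w - q) $ i) \<le> s" "cmod (exp (herm w q)) \<le> M"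
  shows "cmod (fock q b w) \<le> M * s ^ mdeg b / sqrt (real (mfact b))"
proof -
  have "cmod (mpow (w - q) b) = (\<Prod>i\<in>UNIV. cmod ((w - q) $ i) ^ b i)"
    by (simp add: mpow_def norm_power flip: prod_norm)
  also have "\<dots> \<le> (\<Prod>i\<in>UNIV. s ^ b i)"
    using assms(2) by (intro prod_mono) (auto intro: power_mono)
  also have "\<dots> = s ^ mdeg b" by (simp add: mdeg_def power_sum)
  finally have 1: "cmod (mpow (w - q) b) \<le> s ^ mdeg b" .
  have 2: "exp (- (norm q)\<^sup>2 / 2) \<le> 1" by simp
  have 3: "exp (- (norm q)\<^sup>2 / 2) / sqrt (real (mfact b)) \<le> 1 / sqrt (real (mfact b))"
    using 2 by (intro divide_right_mono) auto
  have "cmod (fock q b w) = exp (- (norm q)\<^sup>2 / 2) / sqrt (real (mfact b)) * cmod (mpow (w - q) b) * cmod (exp (herm w q))"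
    unfolding fock_def norm_mult by (simp add: norm_divide)
  also have "\<dots> \<le> 1 / sqrt (real (mfact b)) * s ^ mdeg b * M"
    using 1 3 assms by (intro mult_mono) auto
  finally show ?thesis by (simp add: mult_ac)
qed

context abs_convex_body
begin

text \<open>The gauge is an infimum, so the bound passes to it by continuity; the restriction \<open>t \<le> 1\<close> is harmless
because \<open>x\<close> itself is in the body.\<close>

lemma minkowski_gauge_power_bound:
  assumes "x \<in> K0" "c \<ge> 0"
    and bound: "\<And>t y. 0 < t \<Longrightarrow> t \<le> 1 \<Longrightarrow> y \<in> K0 \<Longrightarrow> x = t *\<^sub>R y \<Longrightarrow> v \<le> c * t ^ n"
  shows "v \<le> c * minkowski_gauge K0 x ^ n"
proof (rule ccontr)
  let ?T = "{t. t > 0 \<and> x \<in> (\<lambda>x. t *\<^sub>R x) ` K0}"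
  let ?g = "minkowski_gauge K0 x"
  assume "\<not> ?thesis"
  then have less: "c * ?g ^ n < v" by simp
  have one: "1 \<in> ?T" using assms(1) by force
  have bdd: "bdd_below ?T" by (rule bdd_belowI[of _ 0]) auto
  have cont: "((\<lambda>t. c * t ^ n) \<longlongrightarrow> c * ?g ^ n) (at ?g)" by (intro tendsto_intros)
  have "\<forall>\<^sub>F t in at ?g. c * t ^ n < v" using order_tendstoD(2)[OF cont less] .
  then obtain d where d: "d > 0" "\<And>t. t \<noteq> ?g \<Longrightarrow> dist t ?g < d \<Longrightarrow> c * t ^ n < v"
    unfolding eventually_at by auto
  have near: "c * t ^ n < v" if "\<bar>t - ?g\<bar> < d" for t
    using d(2)[of t] less that by (cases "t = ?g") (auto simp: dist_real_def)
  have "Inf ?T < ?g + d" using d(1) by (simp add: minkowski_gauge_def)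
  then obtain t where t: "t \<in> ?T" "t < ?g + d" using cInf_lessD[of ?T] one by blast
  have "?g \<le> t" unfolding minkowski_gauge_def using t(1) bdd by (rule cInf_lower)
  then have lt: "c * t ^ n < v" using t(2) d(1) by (intro near) auto
  show False
  proof (cases "t \<le> 1")
    case True
    obtain y where "y \<in> K0" "x = t *\<^sub>R y" using t(1) by blast
    then have "v \<le> c * t ^ n" using bound[of t y] t(1) True by simp
    with lt show False by simp
  next
    case False
    have "v \<le> c * 1 ^ n" using assms(1) by (intro bound) auto
    also have "\<dots> \<le> c * t ^ n" using False assms(2) by (intro mult_left_mono power_mono) auto
    finally show False using lt by simp
  qed
qed

lemma minkowski_gauge_bounds:
  assumes "x \<in> K0"
  shows "0 \<le> minkowski_gauge K0 x" "minkowski_gauge K0 x \<le> 1"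
proof -
  let ?T = "{t. t > 0 \<and> x \<in> (\<lambda>x. t *\<^sub>R x) ` K0}"
  have one: "1 \<in> ?T" using assms by force
  show "0 \<le> minkowski_gauge K0 x"
    unfolding minkowski_gauge_def
  proof (rule cInf_greatest)
    show "?T \<noteq> {}" using one by blast
  qed simp
  show "minkowski_gauge K0 x \<le> 1"
    unfolding minkowski_gauge_def by (rule cInf_lower[OF one bdd_belowI[of _ 0]]) simp
qed

text \<open>Writing \<open>x = t y\<close> with \<open>y\<close> in the body, the slice through \<open>y\<close> is holomorphic on a disc of radius
\<open>\<theta> > 1\<close>, and \<open>(t / \<theta>)\<^bsup>n + 1\<^esup> \<le> t\<^bsup>n\<^esup>\<close>.\<close>

lemma taylor_remainder:
  assumes h: "hol_on U h" "open U" and \<theta>: "\<theta> > 1" "\<And>y t. y \<in> K0 \<Longrightarrow> cmod t \<le> \<theta> \<Longrightarrow> p + t *s y \<in> U"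
    and B: "\<And>y t. y \<in> K0 \<Longrightarrow> cmod t \<le> \<theta> \<Longrightarrow> cmod (h (p + t *s y)) \<le> B" and "B \<ge> 0" and x: "x \<in> K0"
  shows "cmod (h (p + x) - (\<Sum>a | mdeg a \<le> n. taylor_coeff h p a * mpow x a))
           \<le> B / (1 - 1 / \<theta>) * minkowski_gauge K0 x ^ n"
proof (rule minkowski_gauge_power_bound[OF x])
  have q: "1 / \<theta> < 1" using \<theta>(1) by simp
  show "0 \<le> B / (1 - 1 / \<theta>)" using q assms(6) by (intro divide_nonneg_pos) auto
  fix t y assume t: "0 < t" "t \<le> 1" and y: "y \<in> K0" "x = t *\<^sub>R y"
  have p: "p \<in> U" using \<theta>(2)[OF zero_mem, of 0] \<theta>(1) by simp
  have xt: "x = complex_of_real t *s y" using y(2) by (simp add: scaleR_smult)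
  have "(\<Sum>a | mdeg a \<le> n. taylor_coeff h p a * mpow x a) = (\<Sum>k\<le>n. hom_part h p k x)"
    unfolding sum_mdeg_le by (simp add: hom_part_poly[OF h p])
  also have "\<dots> = (\<Sum>k\<le>n. hom_part h p k y * complex_of_real t ^ k)"
    unfolding xt by (simp add: hom_part_scale[OF h p] mult.commute)
  finally have "cmod (h (p + x) - (\<Sum>a | mdeg a \<le> n. taylor_coeff h p a * mpow x a))
      = cmod (h (p + complex_of_real t *s y) - (\<Sum>k\<le>n. hom_part h p k y * complex_of_real t ^ k))"
    unfolding xt by simp
  also have "\<dots> \<le> B * (cmod (complex_of_real t) / \<theta>) ^ Suc n / (1 - cmod (complex_of_real t) / \<theta>)"
    using t y(1) \<theta> B by (intro hom_part_remainder[OF h(1)]) auto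
  also have "\<dots> = B * (t / \<theta>) ^ Suc n / (1 - t / \<theta>)" using t by simp
  also have "\<dots> \<le> B * t ^ n / (1 - 1 / \<theta>)"
  proof (rule frac_le)
    have "t / \<theta> \<le> t" "0 \<le> t / \<theta>" using t \<theta>(1) by (auto simp: divide_le_eq)
    then have "(t / \<theta>) ^ Suc n \<le> t ^ Suc n" by (intro power_mono)
    also have "\<dots> \<le> t ^ n" using t by (intro power_decreasing) auto
    finally show "B * (t / \<theta>) ^ Suc n \<le> B * t ^ n" using assms(6) by (rule mult_left_mono)
    show "1 - 1 / \<theta> \<le> 1 - t / \<theta>" using t \<theta>(1) by (simp add: divide_right_mono)
    show "0 < 1 - 1 / \<theta>" using q by simp
    show "0 \<le> B * t ^ n" using t assms(6) by simp
  qed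
  finally show "cmod (h (p + x) - (\<Sum>a | mdeg a \<le> n. taylor_coeff h p a * mpow x a)) \<le> B / (1 - 1 / \<theta>) * t ^ n"
    by simp
qed

text \<open>The normalising constants of the functional and of the basis function multiply to \<open>exp (- |p|\<^sup>2)\<close>, which
cancels against \<open>exp (herm p p)\<close>: the expansion in \<open>fock p a\<close> is the Taylor expansion of the damped
function.\<close>

lemma fock_expansion:
  "(\<Sum>a\<in>A. fock_functional p a h * fock p a (p + x))
     = exp (herm x p) * (\<Sum>a\<in>A. taylor_coeff (\<lambda>z. exp (- herm (z - p) p) * h z) p a * mpow x a)"
proof -
  have "fock_functional p a h * fock p a (p + x) = exp (herm x p) * (taylor_coeff (\<lambda>z. exp (- herm (z - p) p) * h z) p a * mpow x a)" for a
  proof -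
    let ?e = "exp (- (norm p)\<^sup>2 / 2)" and ?s = "sqrt (real (mfact a))"
    have "(?e * ?s) * (?e / ?s) = exp (- (norm p)\<^sup>2)"
      using mfact_pos[of a] by (simp add: exp_add[symmetric])
    then have "complex_of_real (?e * ?s) * complex_of_real (?e / ?s) = complex_of_real (exp (- (norm p)\<^sup>2))"
      by (simp only: of_real_mult[symmetric])
    also have "\<dots> = exp (- herm p p)"
      by (simp only: exp_of_real[symmetric] of_real_minus herm_self)
    finally have "complex_of_real (?e * ?s) * complex_of_real (?e / ?s) * exp (herm (p + x) p) = exp (herm x p)"
      by (simp only: exp_add[symmetric] herm_add_left) simp
    moreover have "fock_functional p a h * fock p a (p + x)
      = (complex_of_real (?e * ?s) * complex_of_real (?e / ?s) * exp (herm (p + x) p))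
        * (taylor_coeff (\<lambda>z. exp (- herm (z - p) p) * h z) p a * mpow x a)"
      unfolding fock_functional_def fock_def by (simp only: add_diff_cancel_left' mult_ac)
    ultimately show ?thesis by simp
  qed
  then show ?thesis by (simp add: sum_distrib_left)
qed

text \<open>The constant is uniform in \<open>m\<close> and \<open>n\<close>: on the dilated body the functions \<open>fock q b \<circ> g\<close> are bounded
by multiples of \<open>s\<^bsup>|b|\<^esup> / sqrt (b!)\<close>, whose squares have sum at most \<open>exp (r s\<^sup>2)\<close>.\<close>

lemma fock_expansion_remainder:
  fixes g f :: "complex^'d \<Rightarrow> complex^'r"
  assumes g: "hol_map_on U g" and U: "open U" "K \<subseteq> U" and fg: "\<forall>z\<in>K. g z = f z"
  shows "\<exists>C>0. \<forall>m n. \<forall>x\<in>K0.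
    (\<Sum>b | mdeg b \<le> m. (cmod (fock (f p) b (f (p + x))
        - (\<Sum>a | mdeg a \<le> n. fock_functional p a (\<lambda>z. fock (f p) b (g z)) * fock p a (p + x))))\<^sup>2)
     \<le> (C * minkowski_gauge K0 x ^ n)\<^sup>2"
proof -
  define q where "q = f p"
  obtain \<theta> where \<theta>: "\<theta> > 1" "\<And>y t. y \<in> K0 \<Longrightarrow> cmod t \<le> \<theta> \<Longrightarrow> p + t *s y \<in> U"
    using dilation_in_open[OF U] by blast
  have "\<theta> > 0" using \<theta>(1) by simp
  have bd: "\<exists>B>0. \<forall>y t. y \<in> K0 \<longrightarrow> cmod t \<le> \<theta> \<longrightarrow> cmod (h (p + t *s y)) \<le> B" if hU: "hol_on U h" for h
  proof (rule bounded_on_dilation[OF hU \<open>\<theta> > 0\<close> \<theta>(2)])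
    fix B assume "B > 0" "\<And>y t. y \<in> K0 \<Longrightarrow> cmod t \<le> \<theta> \<Longrightarrow> cmod (h (p + t *s y)) \<le> B"
    then show ?thesis by (intro exI[of _ B]) simp
  qed
  obtain M1 where M1: "M1 > 0" "\<forall>y t. y \<in> K0 \<longrightarrow> cmod t \<le> \<theta> \<longrightarrow> cmod (exp (- herm ((p + t *s y) - p) p)) \<le> M1"
    using bd[OF hol_on_damp[of U p]] by (elim exE conjE) (rule that)
  obtain M2 where M2: "M2 > 0" "\<forall>y t. y \<in> K0 \<longrightarrow> cmod t \<le> \<theta> \<longrightarrow> cmod (exp (herm (g (p + t *s y)) q)) \<le> M2"
    using bd[OF hol_on_exp[OF hol_on_compose_map[OF g hol_on_herm[of _ q]]]] by (elim exE conjE) (rule that)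
  obtain M3 where M3: "M3 > 0" "\<forall>x\<in>K0. cmod (exp (herm x p)) \<le> M3"
    using compact_continuous_bound[OF compact_K0 hol_on_continuous[OF hol_on_exp[OF hol_on_herm[of _ p]]]]
    by (elim exE conjE) (rule that)
  have "\<forall>i. \<exists>B. B > 0 \<and> (\<forall>y t. y \<in> K0 \<longrightarrow> cmod t \<le> \<theta> \<longrightarrow> cmod (g (p + t *s y) $ i - q $ i) \<le> B)"
    by (intro allI bd[OF hol_on_compose_map[OF g hol_on_nth_diff]])
  from choice[OF this] obtain S where
    "\<forall>i. S i > 0 \<and> (\<forall>y t. y \<in> K0 \<longrightarrow> cmod t \<le> \<theta> \<longrightarrow> cmod (g (p + t *s y) $ i - q $ i) \<le> S i)" ..
  then have S: "\<And>i. S i > 0" "\<And>i y t. y \<in> K0 \<Longrightarrow> cmod t \<le> \<theta> \<Longrightarrow> cmod (g (p + t *s y) $ i - q $ i) \<le> S i"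
    by simp_all
  define s where "s = (\<Sum>i\<in>UNIV. S i)"
  have s: "S i \<le> s" for i
    unfolding s_def using S(1) by (intro member_le_sum) (auto intro: less_imp_le)
  have s0: "s \<ge> 0" unfolding s_def using S(1) by (intro sum_nonneg) (auto intro: less_imp_le)
  define h where "h b z = exp (- herm (z - p) p) * fock q b (g z)" for b z
  define Bb where "Bb b = M1 * (M2 * s ^ mdeg b / sqrt (real (mfact b)))" for b :: "'r \<Rightarrow> nat"
  have Bb: "Bb b \<ge> 0" for b unfolding Bb_def using M1(1) M2(1) s0 by simp
  have hol: "hol_on U (h b)" for b
    unfolding h_def by (intro hol_on_mult hol_on_damp hol_on_compose_map[OF g hol_on_fock])
  have hB: "cmod (h b (p + t *s y)) \<le> Bb b" if "y \<in> K0" "cmod t \<le> \<theta>" for b y t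
  proof -
    have "cmod (fock q b (g (p + t *s y))) \<le> M2 * s ^ mdeg b / sqrt (real (mfact b))"
    proof (rule norm_fock_le[OF s0 _ M2(2)[rule_format, OF that]])
      show "cmod ((g (p + t *s y) - q) $ i) \<le> s" for i
        using order_trans[OF S(2)[OF that] s] by simp
    qed
    then show ?thesis
      unfolding h_def Bb_def norm_mult using M1(1) M1(2)[rule_format, OF that]
      by (intro mult_mono) (simp_all only: norm_ge_zero less_imp_le)
  qed
  define D where "D = M3 * (1 / (1 - 1 / \<theta>))"
  have D: "D \<ge> 0" unfolding D_def using M3(1) \<theta>(1) by (intro mult_nonneg_nonneg divide_nonneg_nonneg) auto
  have rem: "cmod (fock q b (f (p + x)) - (\<Sum>a | mdeg a \<le> n. fock_functional p a (\<lambda>z. fock q b (g z)) * fock p a (p + x)))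
      \<le> D * Bb b * minkowski_gauge K0 x ^ n" if x: "x \<in> K0" for x n b
  proof -
    have xK: "p + x \<in> K" using x by (simp add: K_def)
    have "exp (herm x p) * exp (- herm ((p + x) - p) p) = 1" by (simp add: exp_add[symmetric])
    then have "fock q b (f (p + x)) = exp (herm x p) * h b (p + x)"
      using fg xK by (simp add: h_def mult.assoc[symmetric])
    then have "fock q b (f (p + x)) - (\<Sum>a | mdeg a \<le> n. fock_functional p a (\<lambda>z. fock q b (g z)) * fock p a (p + x))
       = exp (herm x p) * (h b (p + x) - (\<Sum>a | mdeg a \<le> n. taylor_coeff (h b) p a * mpow x a))"
      unfolding fock_expansion h_def[abs_def] by (simp add: right_diff_distrib)
    then have "cmod (fock q b (f (p + x)) - (\<Sum>a | mdeg a \<le> n. fock_functional p a (\<lambda>z. fock q b (g z)) * fock p a (p + x)))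
       = cmod (exp (herm x p)) * cmod (h b (p + x) - (\<Sum>a | mdeg a \<le> n. taylor_coeff (h b) p a * mpow x a))"
      by (simp only: norm_mult)
    also have "\<dots> \<le> M3 * (Bb b / (1 - 1 / \<theta>) * minkowski_gauge K0 x ^ n)"
      using M3(1) M3(2)[rule_format, OF x] taylor_remainder[OF hol U(1) \<theta> hB Bb x]
      by (intro mult_mono) (simp_all only: norm_ge_zero less_imp_le)
    finally show ?thesis by (simp add: D_def mult_ac)
  qed
  define C where "C = D * M1 * M2 * exp (real CARD('r) * s\<^sup>2 / 2) + 1"
  have C0: "0 \<le> D * M1 * M2 * exp (real CARD('r) * s\<^sup>2 / 2)" using D M1(1) M2(1) by simp
  have "(\<Sum>b | mdeg b \<le> m. (cmod (fock q b (f (p + x))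
        - (\<Sum>a | mdeg a \<le> n. fock_functional p a (\<lambda>z. fock q b (g z)) * fock p a (p + x))))\<^sup>2)
     \<le> (C * minkowski_gauge K0 x ^ n)\<^sup>2" if x: "x \<in> K0" for x m n
  proof -
    let ?G = "minkowski_gauge K0 x ^ n"
    have "(\<Sum>b | mdeg b \<le> m. (cmod (fock q b (f (p + x))
        - (\<Sum>a | mdeg a \<le> n. fock_functional p a (\<lambda>z. fock q b (g z)) * fock p a (p + x))))\<^sup>2)
      \<le> (\<Sum>b | mdeg b \<le> m. (D * Bb b * ?G)\<^sup>2)"
      using rem[OF x] by (intro sum_mono power_mono) auto
    also have "\<dots> = (D * M1 * M2 * ?G)\<^sup>2 * (\<Sum>b :: 'r \<Rightarrow> nat | mdeg b \<le> m. (s\<^sup>2) ^ mdeg b / real (mfact b))"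
      unfolding sum_distrib_left Bb_def
      by (intro sum.cong refl) (simp add: power_mult_distrib power_divide power_mult[symmetric] mult.commute)
    also have "\<dots> \<le> (D * M1 * M2 * ?G)\<^sup>2 * exp (real CARD('r) * s\<^sup>2)"
      by (intro mult_left_mono sum_power_over_mfact) auto
    also have "\<dots> = (D * M1 * M2 * exp (real CARD('r) * s\<^sup>2 / 2) * ?G)\<^sup>2"
      by (simp add: power_mult_distrib exp_double[symmetric])
    also have "\<dots> \<le> (C * ?G)\<^sup>2"
      using C0 D M1(1) M2(1) minkowski_gauge_bounds[OF x]
      by (intro power_mono mult_right_mono mult_nonneg_nonneg) (auto simp: C_def)
    finally show ?thesis .
  qed
  moreover have "C > 0" using C0 by (simp add: C_def add_nonneg_pos)
  ultimately show ?thesis unfolding q_def by blast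
qed

end

section \<open>Hermitian matrices\<close>

lemma mat_adjoint_eq: "mat_adjoint A = Matrix.mat (dim_col A) (dim_row A) (\<lambda>(i, j). cnj (A $$ (j, i)))"
  by (rule eq_matI) (auto simp: mat_adjoint_def mat_of_rows_def)

lemma dim_mat_adjoint [simp]: "dim_row (mat_adjoint A) = dim_col (A :: complex mat)" "dim_col (mat_adjoint A) = dim_row A"
  by (simp_all add: mat_adjoint_eq)

lemma mat_adjoint_carrier: "A \<in> carrier_mat n m \<Longrightarrow> mat_adjoint A \<in> carrier_mat m (n::nat)" for A :: "complex mat"
  by (auto simp: mat_adjoint_eq)

lemma index_mat_adjoint [simp]:
  "i < dim_col A \<Longrightarrow> j < dim_row A \<Longrightarrow> mat_adjoint A $$ (i, j) = cnj (A $$ (j, i))"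
  by (simp add: mat_adjoint_eq)

lemma mat_adjoint_adjoint [simp]: "mat_adjoint (mat_adjoint A) = (A :: complex mat)"
  by (rule eq_matI) auto

lemma mat_adjoint_mult:
  fixes A B :: "complex mat"
  assumes "A \<in> carrier_mat n m" "B \<in> carrier_mat m k"
  shows "mat_adjoint (A * B) = mat_adjoint B * mat_adjoint A"
  using assms by (intro eq_matI) (auto simp: scalar_prod_def mult.commute)

lemma mat_adjoint_one [simp]: "mat_adjoint (1\<^sub>m n :: complex mat) = 1\<^sub>m n"
  by (rule eq_matI) auto

lemma mult_mat_index:
  "A \<in> carrier_mat n m \<Longrightarrow> B \<in> carrier_mat m k \<Longrightarrow> i < n \<Longrightarrow> j < k
    \<Longrightarrow> (A * B) $$ (i, j) = (\<Sum>l<m. A $$ (i, l) * B $$ (l, j))"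
  by (auto simp: scalar_prod_def atLeast0LessThan intro!: sum.cong)

lemma cscalar_prod_sum:
  fixes v w :: "complex Matrix.vec"
  shows "dim_vec w = n \<Longrightarrow> v \<bullet>c w = (\<Sum>i<n. vec_index v i * cnj (vec_index w i))"
  by (simp add: scalar_prod_def atLeast0LessThan)

lemma mult_mat_vec_index:
  "A \<in> carrier_mat n m \<Longrightarrow> v \<in> carrier_vec m \<Longrightarrow> i < n \<Longrightarrow> vec_index (A *\<^sub>v v) i = (\<Sum>j<m. A $$ (i, j) * vec_index v j)"
  by (auto simp: scalar_prod_def atLeast0LessThan)

lemma cscalar_prod_adjoint:
  fixes A :: "complex mat"
  assumes A: "A \<in> carrier_mat n m" and v: "v \<in> carrier_vec m" and w: "w \<in> carrier_vec n"
  shows "(A *\<^sub>v v) \<bullet>c w = v \<bullet>c (mat_adjoint A *\<^sub>v w)"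
proof -
  have "(A *\<^sub>v v) \<bullet>c w = (\<Sum>i<n. (\<Sum>j<m. A $$ (i, j) * vec_index v j) * cnj (vec_index w i))"
    using assms by (subst cscalar_prod_sum[of _ n]) (auto simp: mult_mat_vec_index simp del: index_mult_mat_vec)
  also have "\<dots> = (\<Sum>j<m. vec_index v j * cnj (\<Sum>i<n. mat_adjoint A $$ (j, i) * vec_index w i))"
    unfolding sum_distrib_right by (subst sum.swap) (use A in \<open>auto simp: sum_distrib_left mult_ac intro!: sum.cong\<close>)
  also have "\<dots> = (\<Sum>j<m. vec_index v j * cnj (vec_index (mat_adjoint A *\<^sub>v w) j))"
    using mult_mat_vec_index[OF mat_adjoint_carrier[OF A] w] by (intro sum.cong) auto
  also have "\<dots> = v \<bullet>c (mat_adjoint A *\<^sub>v w)"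
    using assms by (subst cscalar_prod_sum[of _ m]) auto
  finally show ?thesis .
qed

lemma l2_vec_nonneg: "0 \<le> l2_vec v"
  by (simp add: l2_vec_def sum_nonneg)

lemma l2_vec_L2_set: "l2_vec v = L2_set (\<lambda>i. cmod (vec_index v i)) {..<dim_vec v}"
  by (simp add: l2_vec_def L2_set_def)

lemma l2_vec_square: "(l2_vec v)\<^sup>2 = (\<Sum>i<dim_vec v. (cmod (vec_index v i))\<^sup>2)"
  by (simp add: l2_vec_def sum_nonneg)

lemma cscalar_prod_self: "v \<bullet>c v = complex_of_real ((l2_vec v)\<^sup>2)"
proof -
  have "v \<bullet>c v = (\<Sum>i<dim_vec v. vec_index v i * cnj (vec_index v i))" by (rule cscalar_prod_sum) simp
  then show ?thesis unfolding l2_vec_square by (simp only: of_real_sum complex_norm_square)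
qed

lemma cscalar_prod_le:
  assumes "dim_vec v = n" "dim_vec w = n"
  shows "cmod (v \<bullet>c w) \<le> l2_vec v * l2_vec w"
proof -
  have "cmod (v \<bullet>c w) \<le> (\<Sum>i<n. cmod (vec_index v i) * cmod (vec_index w i))"
    using assms by (subst cscalar_prod_sum[of _ n]) (auto intro!: sum_norm_le simp: norm_mult)
  also have "\<dots> \<le> l2_vec v * l2_vec w"
    using L2_set_mult_ineq[of "\<lambda>i. cmod (vec_index v i)" "\<lambda>i. cmod (vec_index w i)" "{..<n}"] assms
    by (simp add: l2_vec_L2_set)
  finally show ?thesis .
qed

lemma l2_vec_eq_0:
  assumes "l2_vec v = 0"
  shows "v = 0\<^sub>v (dim_vec v)"
proof (rule eq_vecI)
  have "(\<Sum>i<dim_vec v. (cmod (vec_index v i))\<^sup>2) = 0" using l2_vec_square[of v] assms by simp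
  then have "\<forall>i\<in>{..<dim_vec v}. (cmod (vec_index v i))\<^sup>2 = 0" by (subst (asm) sum_nonneg_eq_0_iff) auto
  then show "vec_index v i = vec_index (0\<^sub>v (dim_vec v)) i" if "i < dim_vec (0\<^sub>v (dim_vec v))" for i
    using that by simp
qed simp

definition diag_real :: "nat \<Rightarrow> (nat \<Rightarrow> real) \<Rightarrow> complex mat" where
  "diag_real n d = Matrix.mat n n (\<lambda>(i, j). if i = j then complex_of_real (d i) else 0)"

lemma diag_real_carrier [simp]: "diag_real n d \<in> carrier_mat n n" "dim_row (diag_real n d) = n" "dim_col (diag_real n d) = n"
  by (simp_all add: diag_real_def)

lemma diag_real_mult: "diag_real n d * diag_real n e = diag_real n (\<lambda>i. d i * e i)"
proof (rule eq_matI)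
  fix i j assume "i < dim_row (diag_real n (\<lambda>i. d i * e i))" "j < dim_col (diag_real n (\<lambda>i. d i * e i))"
  then have ij: "i < n" "j < n" by auto
  have "(diag_real n d * diag_real n e) $$ (i, j) = (\<Sum>k<n. (if i = k then complex_of_real (d i) else 0) * (if k = j then complex_of_real (e k) else 0))"
    using ij by (auto simp: diag_real_def scalar_prod_def atLeast0LessThan intro!: sum.cong)
  also have "\<dots> = (\<Sum>k<n. if k = i then (if i = j then complex_of_real (d i * e i) else 0) else 0)"
    by (intro sum.cong) auto
  also have "\<dots> = diag_real n (\<lambda>i. d i * e i) $$ (i, j)" using ij by (simp add: diag_real_def)
  finally show "(diag_real n d * diag_real n e) $$ (i, j) = diag_real n (\<lambda>i. d i * e i) $$ (i, j)" .
qed auto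

lemma diag_real_mult_vec: "v \<in> carrier_vec n \<Longrightarrow> i < n \<Longrightarrow> vec_index (diag_real n d *\<^sub>v v) i = complex_of_real (d i) * vec_index v i"
proof -
  assume v: "v \<in> carrier_vec n" and i: "i < n"
  have "vec_index (diag_real n d *\<^sub>v v) i = (\<Sum>j<n. diag_real n d $$ (i, j) * vec_index v j)"
    by (rule mult_mat_vec_index[OF diag_real_carrier(1) v i])
  also have "\<dots> = (\<Sum>j<n. if j = i then complex_of_real (d i) * vec_index v i else 0)"
    using i by (intro sum.cong) (auto simp: diag_real_def)
  finally show ?thesis using i by simp
qed

lemma mat_adjoint_diag_real: "mat_adjoint (diag_real n d) = diag_real n d"
  by (rule eq_matI) (auto simp: diag_real_def)

lemma diag_real_one: "diag_real n (\<lambda>_. 1) = 1\<^sub>m n"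
  by (rule eq_matI) (auto simp: diag_real_def)

text \<open>Gram-Schmidt produces orthogonal columns starting with \<open>v\<close>; they still have to be normalised.\<close>

lemma unitary_with_first_column:
  fixes v :: "complex Matrix.vec"
  assumes v: "v \<in> carrier_vec n" "v \<noteq> 0\<^sub>v n"
  obtains W c where "W \<in> carrier_mat n n" "mat_adjoint W * W = 1\<^sub>m n" "c \<noteq> 0" "\<And>i. i < n \<Longrightarrow> W $$ (i, 0) = c * vec_index v i"
proof -
  interpret cof_vec_space n "TYPE(complex)" .
  define b where "b = basis_completion v"
  define ws where "ws = gram_schmidt n b"
  from basis_completion[OF v, folded b_def]
  have b: "distinct b" "\<not> lin_dep (set b)" "set b \<subseteq> carrier_vec n" "hd b = v" "length b = n" by auto
  have n: "n \<noteq> 0" using v by (cases n) auto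
  then obtain vs where bv: "b = v # vs" using b by (cases b) auto
  from gram_schmidt_result[OF b(3,1,2) refl, folded ws_def]
  have ws: "set ws \<subseteq> carrier_vec n" "corthogonal ws" "length ws = n" using b by auto
  have hd: "hd ws = v" using gram_schmidt_hd[OF v(1), of vs, folded bv] unfolding ws_def .
  define W0 where "W0 = mat_of_cols n ws"
  have W0: "W0 \<in> carrier_mat n n" using ws by (simp add: W0_def mat_of_cols_carrier(1)[of n ws, simplified] carrier_matI)
  have orth: "corthogonal_mat W0" using orthogonal_mat_of_cols ws unfolding W0_def by blast
  define \<rho> where "\<rho> j = l2_vec (col W0 j)" for j
  have ort: "col W0 i \<bullet>c col W0 j = 0 \<longleftrightarrow> i \<noteq> j" if "i < n" "j < n" for i j
    using corthogonal_matD[OF orth, of i j] that W0 by auto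
  have \<rho>: "\<rho> j > 0" if "j < n" for j
    using ort[OF that that] l2_vec_nonneg[of "col W0 j"] unfolding cscalar_prod_self \<rho>_def by (simp add: less_le)
  define W where "W = Matrix.mat n n (\<lambda>(i, j). W0 $$ (i, j) / complex_of_real (\<rho> j))"
  have WW: "mat_adjoint W * W = 1\<^sub>m n"
  proof (rule eq_matI)
    fix i j assume "i < dim_row (1\<^sub>m n :: complex mat)" "j < dim_col (1\<^sub>m n :: complex mat)"
    then have ij: "i < n" "j < n" by auto
    have "(mat_adjoint W * W) $$ (i, j) = (\<Sum>k<n. cnj (W $$ (k, i)) * W $$ (k, j))"
      using ij by (auto simp: W_def scalar_prod_def atLeast0LessThan intro!: sum.cong)
    also have "\<dots> = (\<Sum>k<n. W0 $$ (k, j) * cnj (W0 $$ (k, i))) / complex_of_real (\<rho> i * \<rho> j)"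
      using ij unfolding sum_divide_distrib by (intro sum.cong) (auto simp: W_def)
    also have "(\<Sum>k<n. W0 $$ (k, j) * cnj (W0 $$ (k, i))) = col W0 j \<bullet>c col W0 i"
      using ij W0 by (subst cscalar_prod_sum[of _ n]) auto
    also have "\<dots> / complex_of_real (\<rho> i * \<rho> j) = 1\<^sub>m n $$ (i, j)"
    proof (cases "i = j")
      case True
      then show ?thesis using ij \<rho>[of i] by (simp add: cscalar_prod_self \<rho>_def power2_eq_square)
    next
      case False
      then show ?thesis using ort[of j i] ij by simp
    qed
    finally show "(mat_adjoint W * W) $$ (i, j) = 1\<^sub>m n $$ (i, j)" .
  qed (auto simp: W_def)
  show ?thesis
  proof (rule that)
    show "W \<in> carrier_mat n n" by (simp add: W_def)
    show "mat_adjoint W * W = 1\<^sub>m n" by (rule WW)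
    show "1 / complex_of_real (\<rho> 0) \<noteq> 0" using \<rho>[of 0] n by simp
    fix i assume i: "i < n"
    have "ws ! 0 = v" using hd ws n by (cases ws) auto
    then have "W0 $$ (i, 0) = vec_index v i"
      using i n ws unfolding W0_def by (subst mat_of_cols_index) auto
    then show "W $$ (i, 0) = 1 / complex_of_real (\<rho> 0) * vec_index v i" using i n by (simp add: W_def)
  qed
qed

lemma block_one:
  assumes "B \<in> carrier_mat n n"
  shows "four_block_mat (Matrix.mat 1 1 (\<lambda>_. a)) (0\<^sub>m 1 n) (0\<^sub>m n 1) B
    = Matrix.mat (Suc n) (Suc n) (\<lambda>(i, j). if i = 0 \<and> j = 0 then a else if i = 0 \<or> j = 0 then 0 else B $$ (i - 1, j - 1))"
  using assms by (intro eq_matI) auto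

lemma assoc_mult_mat_nested:
  fixes V D V' W W' :: "'a::semiring_0 mat"
  assumes "W \<in> carrier_mat n n" "V \<in> carrier_mat n n" "D \<in> carrier_mat n n" "V' \<in> carrier_mat n n" "W' \<in> carrier_mat n n"
  shows "W * (V * D * V') * W' = W * V * D * (V' * W')"
proof -
  have "V * D * V' \<in> carrier_mat n n" "D * V' \<in> carrier_mat n n" "V' * W' \<in> carrier_mat n n"
    using assms by auto
  then show ?thesis using assms by (simp add: assoc_mult_mat[of _ n n _ n _ n])
qed

text \<open>Induction on the size: a unitary matrix whose first column is an eigenvector conjugates \<open>A\<close> into a matrix
whose first column, and by symmetry whose first row, vanishes off the diagonal; the remaining block is
again Hermitian.\<close>

theorem hermitian_diagonalisation:
  assumes "A \<in> carrier_mat n n" "mat_adjoint A = A"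
  shows "\<exists>U d. U \<in> carrier_mat n n \<and> mat_adjoint U * U = 1\<^sub>m n \<and> A = U * diag_real n d * mat_adjoint U"
  using assms
proof (induction n arbitrary: A)
  case 0
  show ?case by (intro exI[of _ "1\<^sub>m 0"] exI[of _ "\<lambda>_. 0"]) (use 0 in \<open>auto intro!: eq_matI\<close>)
next
  case (Suc n)
  note A = Suc.prems(1)
  obtain e where "eigenvalue A e"
    using spectrum_non_empty[OF A] unfolding spectrum_def by auto
  then obtain v where v: "v \<in> carrier_vec (Suc n)" "v \<noteq> 0\<^sub>v (Suc n)" "A *\<^sub>v v = e \<cdot>\<^sub>v v"
    using A unfolding eigenvalue_def eigenvector_def by auto
  obtain W c where W: "W \<in> carrier_mat (Suc n) (Suc n)" "mat_adjoint W * W = 1\<^sub>m (Suc n)"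
    and c: "c \<noteq> 0" "\<And>i. i < Suc n \<Longrightarrow> W $$ (i, 0) = c * vec_index v i"
    using unitary_with_first_column[OF v(1,2)] by blast
  let ?W' = "mat_adjoint W"
  have W': "?W' \<in> carrier_mat (Suc n) (Suc n)" using W(1) by (rule mat_adjoint_carrier)
  have WW: "W * ?W' = 1\<^sub>m (Suc n)" by (rule mat_mult_left_right_inverse[OF W' W(1) W(2)])
  define A' where "A' = ?W' * (A * W)"
  have AW: "A * W \<in> carrier_mat (Suc n) (Suc n)" using A W by auto
  have A': "A' \<in> carrier_mat (Suc n) (Suc n)" unfolding A'_def using W' AW by auto
  have hA': "mat_adjoint A' = A'"
  proof -
    have "mat_adjoint A' = mat_adjoint (A * W) * mat_adjoint ?W'"
      unfolding A'_def by (rule mat_adjoint_mult[OF W' AW])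
    also have "mat_adjoint (A * W) = ?W' * A" using mat_adjoint_mult[OF A W(1)] Suc.prems(2) by simp
    finally show ?thesis unfolding A'_def mat_adjoint_adjoint by (simp only: assoc_mult_mat[OF W' A W(1)])
  qed
  have AW0: "(A * W) $$ (i, 0) = e * W $$ (i, 0)" if i: "i < Suc n" for i
  proof -
    have "(A * W) $$ (i, 0) = (\<Sum>k<Suc n. A $$ (i, k) * (c * vec_index v k))"
      using i A W c(2) by (auto simp: scalar_prod_def atLeast0LessThan intro!: sum.cong)
    also have "\<dots> = c * vec_index (A *\<^sub>v v) i"
      unfolding mult_mat_vec_index[OF A v(1) i] sum_distrib_left by (intro sum.cong) auto
    also have "\<dots> = e * W $$ (i, 0)" unfolding v(3) using i v(1) c(2)[OF i] by simp
    finally show ?thesis .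
  qed
  have col0: "A' $$ (i, 0) = (if i = 0 then e else 0)" if i: "i < Suc n" for i
  proof -
    have "A' $$ (i, 0) = (\<Sum>k<Suc n. ?W' $$ (i, k) * (A * W) $$ (k, 0))"
      unfolding A'_def by (rule mult_mat_index[OF W' AW i]) simp
    also have "\<dots> = e * (\<Sum>k<Suc n. ?W' $$ (i, k) * W $$ (k, 0))"
      unfolding sum_distrib_left by (intro sum.cong) (auto simp: AW0)
    also have "(\<Sum>k<Suc n. ?W' $$ (i, k) * W $$ (k, 0)) = (?W' * W) $$ (i, 0)"
      by (rule mult_mat_index[OF W' W(1) i, symmetric]) simp
    finally show ?thesis unfolding W(2) using i by simp
  qed
  have sym: "A' $$ (i, j) = cnj (A' $$ (j, i))" if "i < Suc n" "j < Suc n" for i j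
    using index_mat_adjoint[of i A' j] hA' A' that by auto
  have row0: "A' $$ (0, j) = (if j = 0 then e else 0)" if j: "j < Suc n" for j
  proof -
    have "A' $$ (0, 0) = e" using col0[of 0] by simp
    moreover have "A' $$ (0, j) = cnj (A' $$ (j, 0))" using j by (intro sym) simp_all
    ultimately show ?thesis using col0[OF j] by (cases "j = 0") simp_all
  qed
  have ereal: "complex_of_real (Re e) = e"
  proof -
    have "A' $$ (0, 0) = cnj (A' $$ (0, 0))" by (intro sym) simp_all
    moreover have "A' $$ (0, 0) = e" using col0[of 0] by simp
    ultimately have "e = cnj e" by (simp only:)
    then have "Im e = 0" using complex_eq_iff[of e "cnj e"] by simp
    then show ?thesis by (simp add: complex_eq_iff)
  qed
  define A3 where "A3 = Matrix.mat n n (\<lambda>(i, j). A' $$ (Suc i, Suc j))"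
  have A3: "A3 \<in> carrier_mat n n" by (simp add: A3_def)
  have "mat_adjoint A3 = A3"
  proof (rule eq_matI)
    fix i j assume "i < dim_row A3" "j < dim_col A3"
    then have ij: "i < n" "j < n" by (auto simp: A3_def)
    then have "A' $$ (Suc i, Suc j) = cnj (A' $$ (Suc j, Suc i))" by (intro sym) simp_all
    then show "mat_adjoint A3 $$ (i, j) = A3 $$ (i, j)" using ij by (simp add: A3_def)
  qed (auto simp: A3_def)
  from Suc.IH[OF A3 this] obtain U3 d3 where U3: "U3 \<in> carrier_mat n n" "mat_adjoint U3 * U3 = 1\<^sub>m n"
    "A3 = U3 * diag_real n d3 * mat_adjoint U3" by blast
  let ?bl = "\<lambda>a B. four_block_mat (Matrix.mat 1 1 (\<lambda>_. a)) (0\<^sub>m 1 n) (0\<^sub>m n 1) B"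
  have blc: "?bl a B \<in> carrier_mat (Suc n) (Suc n)" if "B \<in> carrier_mat n n" for a :: complex and B
    unfolding block_one[OF that] by simp
  have blm: "?bl a B * ?bl b D = ?bl (a * b) (B * D)" if "B \<in> carrier_mat n n" "D \<in> carrier_mat n n" for a b :: complex and B D
  proof -
    have "?bl a B * ?bl b D = four_block_mat (Matrix.mat 1 1 (\<lambda>_. a) * Matrix.mat 1 1 (\<lambda>_. b) + 0\<^sub>m 1 n * 0\<^sub>m n 1)
      (Matrix.mat 1 1 (\<lambda>_. a) * 0\<^sub>m 1 n + 0\<^sub>m 1 n * D) (0\<^sub>m n 1 * Matrix.mat 1 1 (\<lambda>_. b) + B * 0\<^sub>m n 1) (0\<^sub>m n 1 * 0\<^sub>m 1 n + B * D)"
      using that by (intro mult_four_block_mat) auto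
    moreover have "Matrix.mat 1 1 (\<lambda>_. a) * Matrix.mat 1 1 (\<lambda>_. b) + 0\<^sub>m 1 n * 0\<^sub>m n 1 = Matrix.mat 1 1 (\<lambda>_. a * b)"
      by (intro eq_matI) (auto simp: scalar_prod_def)
    moreover have "Matrix.mat 1 1 (\<lambda>_. a) * 0\<^sub>m 1 n + 0\<^sub>m 1 n * D = 0\<^sub>m 1 n"
      using that by (intro eq_matI) (auto simp: scalar_prod_def)
    moreover have "0\<^sub>m n 1 * Matrix.mat 1 1 (\<lambda>_. b) + B * 0\<^sub>m n 1 = 0\<^sub>m n 1"
      using that by (intro eq_matI) (auto simp: scalar_prod_def)
    moreover have "0\<^sub>m n 1 * 0\<^sub>m 1 n + B * D = B * D"
      using that by (intro eq_matI) (auto simp: scalar_prod_def)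
    ultimately show ?thesis by simp
  qed
  have bla: "mat_adjoint (?bl a B) = ?bl (cnj a) (mat_adjoint B)" if B: "B \<in> carrier_mat n n" for a B
    unfolding block_one[OF B] block_one[OF mat_adjoint_carrier[OF B]] using B by (intro eq_matI) auto
  define d where "d i = (if i = 0 then Re e else d3 (i - 1))" for i
  have A'bl: "A' = ?bl e A3"
    unfolding block_one[OF A3] using A' col0 row0 by (intro eq_matI) (auto simp: A3_def)
  have dbl: "diag_real (Suc n) d = ?bl e (diag_real n d3)"
    unfolding block_one[OF diag_real_carrier(1)] using ereal by (intro eq_matI) (auto simp: diag_real_def d_def)
  have onebl: "?bl 1 (1\<^sub>m n) = (1\<^sub>m (Suc n) :: complex mat)"
    unfolding block_one[OF one_carrier_mat] by (intro eq_matI) auto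
  let ?U' = "?bl 1 U3"
  have U': "?U' \<in> carrier_mat (Suc n) (Suc n)" by (rule blc[OF U3(1)])
  have aU3: "mat_adjoint U3 \<in> carrier_mat n n" using U3(1) by (rule mat_adjoint_carrier)
  have aU': "mat_adjoint ?U' = ?bl 1 (mat_adjoint U3)" using bla[OF U3(1), of 1] by simp
  have U'U': "mat_adjoint ?U' * ?U' = 1\<^sub>m (Suc n)"
    unfolding aU' blm[OF aU3 U3(1)] U3(2) using onebl by simp
  have A'eq: "A' = ?U' * diag_real (Suc n) d * mat_adjoint ?U'"
    unfolding aU' dbl blm[OF U3(1) diag_real_carrier(1)] A'bl
    by (subst blm) (use U3 aU3 in auto)
  define U where "U = W * ?U'"
  have U: "U \<in> carrier_mat (Suc n) (Suc n)" unfolding U_def using W(1) U' by auto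
  have aU: "mat_adjoint U = mat_adjoint ?U' * ?W'" unfolding U_def by (rule mat_adjoint_mult[OF W(1) U'])
  have aU'c: "mat_adjoint ?U' \<in> carrier_mat (Suc n) (Suc n)" using U' by (rule mat_adjoint_carrier)
  have "mat_adjoint U * U = mat_adjoint ?U' * (?W' * W) * ?U'"
    unfolding aU unfolding U_def using aU'c W' W(1) U' by (simp add: assoc_mult_mat[of _ "Suc n" "Suc n" _ "Suc n" _ "Suc n"])
  then have UU: "mat_adjoint U * U = 1\<^sub>m (Suc n)" unfolding W(2) by (simp only: right_mult_one_mat[OF aU'c] U'U')
  have "A = W * (?W' * (A * W)) * ?W'"
  proof -
    have "W * (?W' * (A * W)) * ?W' = (W * ?W') * A * (W * ?W')"
      using W(1) W' A by (simp add: assoc_mult_mat[of _ "Suc n" "Suc n" _ "Suc n" _ "Suc n"])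
    then show ?thesis unfolding WW using A by simp
  qed
  also have "\<dots> = W * (?U' * diag_real (Suc n) d * mat_adjoint ?U') * ?W'"
    unfolding A'_def[symmetric] using A'eq by simp
  also have "\<dots> = U * diag_real (Suc n) d * mat_adjoint U"
    unfolding aU unfolding U_def by (rule assoc_mult_mat_nested[OF W(1) U' diag_real_carrier(1) aU'c W'])
  finally show ?case using U UU by blast
qed

lemma quadratic_form_diagonal:
  assumes U: "U \<in> carrier_mat n n" and v: "v \<in> carrier_vec n"
  shows "((U * diag_real n d * mat_adjoint U) *\<^sub>v v) \<bullet>c v
     = complex_of_real (\<Sum>i<n. d i * (cmod (vec_index (mat_adjoint U *\<^sub>v v) i))\<^sup>2)"
proof -
  let ?w = "mat_adjoint U *\<^sub>v v"
  have U': "mat_adjoint U \<in> carrier_mat n n" using U by (rule mat_adjoint_carrier)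
  have w: "?w \<in> carrier_vec n" by (rule mult_mat_vec_carrier[OF U' v])
  have Dw: "diag_real n d *\<^sub>v ?w \<in> carrier_vec n" by (rule mult_mat_vec_carrier[OF diag_real_carrier(1) w])
  have "(U * diag_real n d * mat_adjoint U) *\<^sub>v v = U *\<^sub>v (diag_real n d *\<^sub>v ?w)"
  proof -
    have "U * diag_real n d \<in> carrier_mat n n" using U by auto
    from assoc_mult_mat_vec[OF this U' v] show ?thesis
      by (simp only: assoc_mult_mat_vec[OF U diag_real_carrier(1) w])
  qed
  then have "((U * diag_real n d * mat_adjoint U) *\<^sub>v v) \<bullet>c v = (diag_real n d *\<^sub>v ?w) \<bullet>c ?w"
    using cscalar_prod_adjoint[OF U Dw v] by simp
  also have "\<dots> = (\<Sum>i<n. vec_index (diag_real n d *\<^sub>v ?w) i * cnj (vec_index ?w i))"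
    by (rule cscalar_prod_sum[OF carrier_vecD[OF w]])
  also have "\<dots> = (\<Sum>i<n. complex_of_real (d i * (cmod (vec_index ?w i))\<^sup>2))"
    using diag_real_mult_vec[OF w] by (intro sum.cong) (simp_all only: lessThan_iff of_real_mult complex_norm_square mult.assoc)
  finally show ?thesis by simp
qed

lemma l2_vec_unitary:
  assumes U: "U \<in> carrier_mat n n" "mat_adjoint U * U = 1\<^sub>m n" and v: "v \<in> carrier_vec n"
  shows "l2_vec (mat_adjoint U *\<^sub>v v) = l2_vec v"
proof -
  have U': "mat_adjoint U \<in> carrier_mat n n" using U(1) by (rule mat_adjoint_carrier)
  have w: "mat_adjoint U *\<^sub>v v \<in> carrier_vec n" by (rule mult_mat_vec_carrier[OF U' v])
  have UU: "U * mat_adjoint U = 1\<^sub>m n" by (rule mat_mult_left_right_inverse[OF U' U])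
  have "(mat_adjoint U *\<^sub>v v) \<bullet>c (mat_adjoint U *\<^sub>v v) = (U *\<^sub>v (mat_adjoint U *\<^sub>v v)) \<bullet>c v"
    using cscalar_prod_adjoint[OF U(1) w v] by simp
  also have "U *\<^sub>v (mat_adjoint U *\<^sub>v v) = v"
    using assoc_mult_mat_vec[OF U(1) U' v] v unfolding UU by simp
  finally have "(l2_vec (mat_adjoint U *\<^sub>v v))\<^sup>2 = (l2_vec v)\<^sup>2"
    unfolding cscalar_prod_self of_real_eq_iff .
  then show ?thesis using l2_vec_nonneg by (simp add: power2_eq_iff_nonneg)
qed

lemma diagonal_eigenvalue:
  assumes U: "U \<in> carrier_mat n n" "mat_adjoint U * U = 1\<^sub>m n" and A: "A = U * diag_real n d * mat_adjoint U" and i: "i < n"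
  shows "A *\<^sub>v col U i = complex_of_real (d i) \<cdot>\<^sub>v col U i" "col U i \<in> carrier_vec n" "col U i \<noteq> 0\<^sub>v n"
proof -
  have U': "mat_adjoint U \<in> carrier_mat n n" using U(1) by (rule mat_adjoint_carrier)
  have UD: "U * diag_real n d \<in> carrier_mat n n" by (rule mult_carrier_mat[OF U(1) diag_real_carrier(1)])
  have Ac: "A \<in> carrier_mat n n" unfolding A by (rule mult_carrier_mat[OF UD U'])
  show c: "col U i \<in> carrier_vec n" using U i by auto
  have "A * U = U * diag_real n d * (mat_adjoint U * U)"
  proof -
    have "U * diag_real n d \<in> carrier_mat n n" using U(1) by auto
    from assoc_mult_mat[OF this U' U(1)] show ?thesis unfolding A .
  qed
  then have AU: "A * U = U * diag_real n d" unfolding U(2) by (simp only: right_mult_one_mat[OF mult_carrier_mat[OF U(1) diag_real_carrier(1)]])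
  have "A *\<^sub>v col U i = col (A * U) i" by (rule col_mult2[OF Ac U(1) i, symmetric])
  also have "\<dots> = complex_of_real (d i) \<cdot>\<^sub>v col U i"
  proof (rule eq_vecI)
    fix k assume "k < dim_vec (complex_of_real (d i) \<cdot>\<^sub>v col U i)"
    then have k: "k < n" using U(1) by auto
    have "(U * diag_real n d) $$ (k, i) = (\<Sum>l<n. U $$ (k, l) * diag_real n d $$ (l, i))"
      by (rule mult_mat_index[OF U(1) diag_real_carrier(1) k i])
    also have "\<dots> = (\<Sum>l<n. if l = i then U $$ (k, i) * complex_of_real (d i) else 0)"
      using i by (intro sum.cong) (auto simp: diag_real_def)
    also have "\<dots> = complex_of_real (d i) * U $$ (k, i)" using i by simp
    finally show "vec_index (col (A * U) i) k = vec_index (complex_of_real (d i) \<cdot>\<^sub>v col U i) k"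
      unfolding AU using U(1) k i by simp
  qed (use Ac U(1) in simp)
  finally show "A *\<^sub>v col U i = complex_of_real (d i) \<cdot>\<^sub>v col U i" .
  show "col U i \<noteq> 0\<^sub>v n"
  proof
    assume z: "col U i = 0\<^sub>v n"
    have "U $$ (k, i) = 0" if "k < n" for k
      using arg_cong[OF z, of "\<lambda>v. vec_index v k"] that U(1) i by simp
    then have "(\<Sum>k<n. mat_adjoint U $$ (i, k) * U $$ (k, i)) = 0"
      by (intro sum.neutral) simp
    then have "(mat_adjoint U * U) $$ (i, i) = 0"
      unfolding mult_mat_index[OF U' U(1) i i] .
    then show False unfolding U(2) using i by simp
  qed
qed

lemma l2_vec_pos:
  assumes "v \<in> carrier_vec n" "v \<noteq> 0\<^sub>v n"
  shows "l2_vec v > 0"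
  using l2_vec_eq_0[of v] l2_vec_nonneg[of v] assms(2) unfolding carrier_vecD[OF assms(1)]
  by (cases "l2_vec v = 0") simp_all

lemma finite_real_eigenvalues:
  assumes "A \<in> carrier_mat n n"
  shows "finite {x. eigenvalue A (complex_of_real x)}"
proof -
  have "finite (complex_of_real -` Collect (eigenvalue A))"
    using card_finite_spectrum(1)[OF assms] unfolding spectrum_def
    by (intro finite_vimageI inj_of_real)
  then show ?thesis by (simp add: vimage_def)
qed

lemma min_eigenvalue_le:
  assumes U: "U \<in> carrier_mat n n" "mat_adjoint U * U = 1\<^sub>m n" and A: "A = U * diag_real n d * mat_adjoint U" and i: "i < n"
  shows "min_eigenvalue A \<le> d i"
proof -
  have Ac: "A \<in> carrier_mat n n"
    unfolding A by (rule mult_carrier_mat[OF mult_carrier_mat[OF U(1) diag_real_carrier(1)] mat_adjoint_carrier[OF U(1)]])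
  have "eigenvalue A (complex_of_real (d i))"
    unfolding eigenvalue_def eigenvector_def carrier_matD(1)[OF Ac]
    using diagonal_eigenvalue[OF U A i] by blast
  then show ?thesis
    unfolding min_eigenvalue_def using finite_real_eigenvalues[OF Ac] by (intro Min_le) auto
qed

lemma min_eigenvalue_quadratic_form:
  assumes A: "A \<in> carrier_mat n n" "mat_adjoint A = A" and v: "v \<in> carrier_vec n"
  shows "min_eigenvalue A * (l2_vec v)\<^sup>2 \<le> Re ((A *\<^sub>v v) \<bullet>c v)"
proof -
  obtain U d where U: "U \<in> carrier_mat n n" "mat_adjoint U * U = 1\<^sub>m n" and Ad: "A = U * diag_real n d * mat_adjoint U"
    using hermitian_diagonalisation[OF A] by (elim exE conjE) (rule that)
  let ?w = "mat_adjoint U *\<^sub>v v"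
  have w: "dim_vec ?w = n" using U(1) by simp
  have "min_eigenvalue A * (l2_vec v)\<^sup>2 = (\<Sum>i<n. min_eigenvalue A * (cmod (vec_index ?w i))\<^sup>2)"
    using l2_vec_square[of ?w] unfolding l2_vec_unitary[OF U v] w by (simp only: sum_distrib_left)
  also have "\<dots> \<le> (\<Sum>i<n. d i * (cmod (vec_index ?w i))\<^sup>2)"
    using min_eigenvalue_le[OF U Ad] by (intro sum_mono mult_right_mono) auto
  also have "\<dots> = Re ((A *\<^sub>v v) \<bullet>c v)"
    using quadratic_form_diagonal[OF U(1) v, of d] unfolding Ad[symmetric] by (simp only: Re_complex_of_real)
  finally show ?thesis .
qed

lemma min_eigenvalue_pos:
  assumes A: "A \<in> carrier_mat n n" "psd_mat A" and B: "B \<in> carrier_mat n n" "B * A = 1\<^sub>m n" and n: "n > 0"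
  shows "min_eigenvalue A > 0"
proof -
  have hA: "mat_adjoint A = A" using A(2) by (simp add: psd_mat_def)
  obtain U d where U: "U \<in> carrier_mat n n" "mat_adjoint U * U = 1\<^sub>m n" and Ad: "A = U * diag_real n d * mat_adjoint U"
    using hermitian_diagonalisation[OF A(1) hA] by (elim exE conjE) (rule that)
  let ?S = "{x. eigenvalue A (complex_of_real x)}"
  have "eigenvalue A (complex_of_real (d 0))"
    unfolding eigenvalue_def eigenvector_def carrier_matD(1)[OF A(1)]
    using diagonal_eigenvalue[OF U Ad n] by blast
  then have "?S \<noteq> {}" by blast
  then have "min_eigenvalue A \<in> ?S"
    unfolding min_eigenvalue_def using finite_real_eigenvalues[OF A(1)] by (intro Min_in)
  then obtain v where v: "v \<in> carrier_vec n" "v \<noteq> 0\<^sub>v n" "A *\<^sub>v v = complex_of_real (min_eigenvalue A) \<cdot>\<^sub>v v"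
    using A(1) unfolding eigenvalue_def eigenvector_def by auto
  have l: "l2_vec v > 0" by (rule l2_vec_pos[OF v(1,2)])
  have "(A *\<^sub>v v) \<bullet>c v = complex_of_real (min_eigenvalue A) * (v \<bullet>c v)"
    unfolding v(3) using v(1) by simp
  then have "Re ((A *\<^sub>v v) \<bullet>c v) = min_eigenvalue A * (l2_vec v)\<^sup>2" unfolding cscalar_prod_self by simp
  moreover have "Re ((A *\<^sub>v v) \<bullet>c v) \<ge> 0" using A v(1) by (auto simp: psd_mat_def)
  ultimately have ge: "min_eigenvalue A \<ge> 0" using l by (simp add: zero_le_mult_iff)
  have "min_eigenvalue A \<noteq> 0"
  proof
    assume "min_eigenvalue A = 0"
    then have z: "A *\<^sub>v v = 0\<^sub>v n" unfolding v(3) using v(1) by auto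
    have "v = (B * A) *\<^sub>v v" unfolding B(2) using v(1) by simp
    also have "\<dots> = B *\<^sub>v (A *\<^sub>v v)" by (rule assoc_mult_mat_vec[OF B(1) A(1) v(1)])
    also have "\<dots> = 0\<^sub>v n" unfolding z using B(1) by auto
    finally show False using v(2) by simp
  qed
  with ge show ?thesis by simp
qed

lemma psd_mat_diagonal:
  assumes U: "U \<in> carrier_mat n n" and d: "\<And>i. i < n \<Longrightarrow> d i \<ge> 0"
  shows "psd_mat (U * diag_real n d * mat_adjoint U)"
proof -
  let ?A = "U * diag_real n d * mat_adjoint U"
  have U': "mat_adjoint U \<in> carrier_mat n n" using U by (rule mat_adjoint_carrier)
  have UD: "U * diag_real n d \<in> carrier_mat n n" by (rule mult_carrier_mat[OF U diag_real_carrier(1)])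
  have A: "?A \<in> carrier_mat n n" by (rule mult_carrier_mat[OF UD U'])
  have "mat_adjoint ?A = U * (diag_real n d * mat_adjoint U)"
    unfolding mat_adjoint_mult[OF UD U'] mat_adjoint_mult[OF U diag_real_carrier(1)] mat_adjoint_diag_real by simp
  then have "mat_adjoint ?A = ?A" by (simp only: assoc_mult_mat[OF U diag_real_carrier(1) U'])
  moreover have "Re ((?A *\<^sub>v v) \<bullet>c v) \<ge> 0" if "v \<in> carrier_vec (dim_row ?A)" for v
  proof -
    have v: "v \<in> carrier_vec n" using that carrier_matD(1)[OF U] by simp
    show ?thesis unfolding quadratic_form_diagonal[OF U v] Re_complex_of_real using d by (intro sum_nonneg) simp
  qed
  ultimately show ?thesis unfolding psd_mat_def using carrier_matD[OF A] by (intro conjI ballI) simp_all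
qed

section \<open>Inverse square roots and relative perturbations\<close>

lemma minus_vec_eqD:
  fixes a b c :: "complex Matrix.vec"
  assumes "a \<in> carrier_vec n" "b \<in> carrier_vec n" "c \<in> carrier_vec n" "a - b = c"
  shows "a = b + c"
  unfolding assms(4)[symmetric] using assms(1,2) by (intro eq_vecI) auto

text \<open>For an eigenvector \<open>u\<close> of \<open>B - C\<close> with eigenvalue \<open>d\<close>, equality of \<open>|B u|\<^sup>2\<close> and \<open>|C u|\<^sup>2\<close> gives
\<open>d (\<langle>B u, u\<rangle> + \<langle>C u, u\<rangle>) = 0\<close>, and the first form is positive definite. So \<open>d = 0\<close> for every
eigenvector.\<close>

lemma psd_square_root_unique:
  assumes B: "B \<in> carrier_mat n n" "psd_mat B" and C: "C \<in> carrier_mat n n" "psd_mat C"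
    and eq: "B * B = C * C" and inv: "A \<in> carrier_mat n n" "A * (B * B) = 1\<^sub>m n" and n: "n > 0"
  shows "B = C"
proof -
  have hB: "mat_adjoint B = B" and hC: "mat_adjoint C = C" using B C by (auto simp: psd_mat_def)
  have AB: "A * B \<in> carrier_mat n n" using inv(1) B(1) by auto
  have "(A * B) * B = 1\<^sub>m n" using inv B by (simp add: assoc_mult_mat[of _ n n _ n _ n])
  from min_eigenvalue_pos[OF B AB this n] have posB: "min_eigenvalue B > 0" .
  let ?D = "B - C"
  have D: "?D \<in> carrier_mat n n" using B C by auto
  have hD: "mat_adjoint ?D = ?D"
  proof (rule eq_matI)
    fix i j assume "i < dim_row ?D" "j < dim_col ?D"
    then have ij: "i < n" "j < n" using C by auto
    then show "mat_adjoint ?D $$ (i, j) = ?D $$ (i, j)"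
      using index_mat_adjoint[of i B j] index_mat_adjoint[of i C j] hB hC B(1) C(1) by auto
  qed (use C in auto)
  obtain U d where U: "U \<in> carrier_mat n n" "mat_adjoint U * U = 1\<^sub>m n" and Dd: "?D = U * diag_real n d * mat_adjoint U"
    using hermitian_diagonalisation[OF D hD] by (elim exE conjE) (rule that)
  have "d i = 0" if i: "i < n" for i
  proof -
    let ?u = "col U i"
    note u = diagonal_eigenvalue[OF U Dd i]
    have Bu: "B *\<^sub>v ?u \<in> carrier_vec n" and Cu: "C *\<^sub>v ?u \<in> carrier_vec n"
      using mult_mat_vec_carrier[OF B(1) u(2)] mult_mat_vec_carrier[OF C(1) u(2)] by simp_all
    have Du: "?D *\<^sub>v ?u = B *\<^sub>v ?u - C *\<^sub>v ?u" using B(1) C(1) u(2) by (rule minus_mult_distrib_mat_vec)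
    let ?l = "complex_of_real (d i)"
    have BC: "B *\<^sub>v ?u = C *\<^sub>v ?u + ?l \<cdot>\<^sub>v ?u"
      using u(2) by (intro minus_vec_eqD[OF Bu Cu _ u(1)[unfolded Du]]) simp
    have "(B *\<^sub>v (B *\<^sub>v ?u)) = (C *\<^sub>v (C *\<^sub>v ?u))"
      using arg_cong[OF eq, of "\<lambda>M. M *\<^sub>v ?u"] B(1) C(1) u(2) by (simp add: assoc_mult_mat_vec[of _ n n _ n])
    then have "(B *\<^sub>v (B *\<^sub>v ?u)) \<bullet>c ?u = (C *\<^sub>v (C *\<^sub>v ?u)) \<bullet>c ?u" by simp
    then have "(B *\<^sub>v ?u) \<bullet>c (B *\<^sub>v ?u) = (C *\<^sub>v ?u) \<bullet>c (C *\<^sub>v ?u)"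
      using cscalar_prod_adjoint[OF B(1) Bu u(2)] cscalar_prod_adjoint[OF C(1) Cu u(2)] hB hC by simp
    moreover have "(B *\<^sub>v ?u) \<bullet>c (B *\<^sub>v ?u) - (C *\<^sub>v ?u) \<bullet>c (C *\<^sub>v ?u)
       = ?l * ((B *\<^sub>v ?u) \<bullet>c ?u) + ?l * cnj ((C *\<^sub>v ?u) \<bullet>c ?u)"
    proof -
      let ?b = "vec_index (B *\<^sub>v ?u)" and ?c = "vec_index (C *\<^sub>v ?u)" and ?x = "vec_index ?u"
      have bc: "?b k = ?c k + ?l * ?x k" if "k < n" for k
        using arg_cong[OF BC, of "\<lambda>w. vec_index w k"] that Cu u(2) carrier_matD(1)[OF C(1)] carrier_matD(1)[OF U(1)]
        by (simp del: index_mult_mat_vec)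
      have "(B *\<^sub>v ?u) \<bullet>c (B *\<^sub>v ?u) - (C *\<^sub>v ?u) \<bullet>c (C *\<^sub>v ?u) = (\<Sum>k<n. ?b k * cnj (?b k) - ?c k * cnj (?c k))"
        by (simp only: cscalar_prod_sum[OF carrier_vecD[OF Bu]] cscalar_prod_sum[OF carrier_vecD[OF Cu]] sum_subtractf)
      also have "\<dots> = (\<Sum>k<n. ?l * (?b k * cnj (?x k)) + ?l * (cnj (?c k) * ?x k))"
      proof (intro sum.cong refl)
        fix k assume "k \<in> {..<n}"
        then have "?b k = ?c k + ?l * ?x k" using bc by simp
        then show "?b k * cnj (?b k) - ?c k * cnj (?c k) = ?l * (?b k * cnj (?x k)) + ?l * (cnj (?c k) * ?x k)"
          by (simp only: complex_cnj_add complex_cnj_mult complex_cnj_complex_of_real) (simp add: algebra_simps)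
      qed
      also have "\<dots> = ?l * ((B *\<^sub>v ?u) \<bullet>c ?u) + ?l * cnj ((C *\<^sub>v ?u) \<bullet>c ?u)"
        by (simp only: cscalar_prod_sum[OF carrier_vecD[OF u(2)]] sum.distrib sum_distrib_left cnj_sum
            complex_cnj_mult complex_cnj_cnj)
      finally show ?thesis .
    qed
    ultimately have "?l * ((B *\<^sub>v ?u) \<bullet>c ?u + cnj ((C *\<^sub>v ?u) \<bullet>c ?u)) = 0" by (simp add: ring_distribs)
    moreover have "Re (?l * (X + cnj Y)) = d i * (Re X + Re Y)" for X Y by simp
    ultimately have z: "d i * (Re ((B *\<^sub>v ?u) \<bullet>c ?u) + Re ((C *\<^sub>v ?u) \<bullet>c ?u)) = 0"
      by (metis zero_complex.sel(1))
    have l: "l2_vec ?u > 0" by (rule l2_vec_pos[OF u(2,3)])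
    then have "0 < min_eigenvalue B * (l2_vec ?u)\<^sup>2" using posB by simp
    also have "\<dots> \<le> Re ((B *\<^sub>v ?u) \<bullet>c ?u)" by (rule min_eigenvalue_quadratic_form[OF B(1) hB u(2)])
    finally have "Re ((B *\<^sub>v ?u) \<bullet>c ?u) > 0" .
    moreover have "Re ((C *\<^sub>v ?u) \<bullet>c ?u) \<ge> 0" using C u(2) by (auto simp: psd_mat_def)
    ultimately show ?thesis using z by (simp only: mult_eq_0_iff) linarith
  qed
  then have "diag_real n d = 0\<^sub>m n n" by (intro eq_matI) (auto simp: diag_real_def)
  then have "?D = 0\<^sub>m n n" unfolding Dd using U(1) mat_adjoint_carrier[OF U(1)] by simp
  show "B = C"
  proof (rule eq_matI)
    fix i j assume "i < dim_row C" "j < dim_col C"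
    then have ij: "i < n" "j < n" using C by auto
    have "?D $$ (i, j) = 0" unfolding \<open>?D = 0\<^sub>m n n\<close> using ij by simp
    then show "B $$ (i, j) = C $$ (i, j)" using ij B(1) C(1) by simp
  qed (use B C in auto)
qed

lemma conjugation_mult:
  fixes U D V E :: "'a::semiring_1 mat"
  assumes U: "U \<in> carrier_mat n n" and D: "D \<in> carrier_mat n n" and V: "V \<in> carrier_mat n n" and E: "E \<in> carrier_mat n n"
    and VU: "V * U = 1\<^sub>m n"
  shows "(U * D * V) * (U * E * V) = U * (D * E) * V"
proof -
  note c = mult_carrier_mat[of _ n n _ n]
  have "(U * D * V) * (U * E * V) = (U * D) * (V * (U * E * V))"
    by (rule assoc_mult_mat[OF c[OF U D] V c[OF c[OF U E] V]])
  also have "V * (U * E * V) = (V * U) * (E * V)"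
    unfolding assoc_mult_mat[OF U E V] by (rule assoc_mult_mat[OF V U c[OF E V], symmetric])
  also have "\<dots> = E * V" unfolding VU by (rule left_mult_one_mat[OF c[OF E V]])
  also have "U * D * (E * V) = U * (D * E * V)"
    unfolding assoc_mult_mat[OF D E V] by (rule assoc_mult_mat[OF U D c[OF E V]])
  also have "\<dots> = U * (D * E) * V" by (rule assoc_mult_mat[OF U c[OF D E] V, symmetric])
  finally show ?thesis .
qed

text \<open>The definite description in \<open>inv_sqrt_mat\<close> denotes: diagonalisation yields one square root of the inverse,
and \<open>psd_square_root_unique\<close> excludes any other.\<close>

theorem inv_sqrt_mat_properties:
  assumes A: "A \<in> carrier_mat n n" "psd_mat A" "invertible_mat A" and n: "n > 0"
  shows "inv_sqrt_mat A \<in> carrier_mat n n" "psd_mat (inv_sqrt_mat A)"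
    "A * (inv_sqrt_mat A * inv_sqrt_mat A) = 1\<^sub>m n" "min_eigenvalue A > 0"
proof -
  have hA: "mat_adjoint A = A" using A(2) by (simp add: psd_mat_def)
  obtain A1 where A1: "A * A1 = 1\<^sub>m n" "A1 * A = 1\<^sub>m (dim_row A1)"
    using A(3) unfolding invertible_mat_def inverts_mat_def carrier_matD(1)[OF A(1)]
    by (elim conjE exE) (rule that)
  have col: "dim_col A1 = n" using arg_cong[OF A1(1), of dim_col] by simp
  have row: "dim_row A1 = n"
    using arg_cong[OF A1(2), of dim_col] carrier_matD(2)[OF A(1)] by simp
  have A1c: "A1 \<in> carrier_mat n n" "A1 * A = 1\<^sub>m n"
    by (rule carrier_matI[OF row col]) (use A1(2) in \<open>simp only: row\<close>)
  show pos: "min_eigenvalue A > 0" by (rule min_eigenvalue_pos[OF A(1,2) A1c n])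
  obtain U d where U: "U \<in> carrier_mat n n" "mat_adjoint U * U = 1\<^sub>m n" and Ad: "A = U * diag_real n d * mat_adjoint U"
    using hermitian_diagonalisation[OF A(1) hA] by (elim exE conjE) (rule that)
  have U': "mat_adjoint U \<in> carrier_mat n n" using U(1) by (rule mat_adjoint_carrier)
  have UU: "U * mat_adjoint U = 1\<^sub>m n" by (rule mat_mult_left_right_inverse[OF U' U])
  have d: "d i > 0" if "i < n" for i using min_eigenvalue_le[OF U Ad that] pos by linarith
  have mult: "(U * diag_real n a * mat_adjoint U) * (U * diag_real n b * mat_adjoint U) = U * diag_real n (\<lambda>i. a i * b i) * mat_adjoint U" for a b
    unfolding diag_real_mult[symmetric] by (rule conjugation_mult[OF U(1) diag_real_carrier(1) U' diag_real_carrier(1) U(2)])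
  define B where "B = U * diag_real n (\<lambda>i. 1 / sqrt (d i)) * mat_adjoint U"
  have B: "B \<in> carrier_mat n n"
    unfolding B_def by (rule mult_carrier_mat[OF mult_carrier_mat[OF U(1) diag_real_carrier(1)] U'])
  have psdB: "psd_mat B" unfolding B_def using d by (intro psd_mat_diagonal[OF U(1)]) (simp add: less_imp_le)
  have one: "U * diag_real n a * mat_adjoint U = 1\<^sub>m n" if "\<And>i. i < n \<Longrightarrow> a i = 1" for a
  proof -
    have "diag_real n a = 1\<^sub>m n" unfolding diag_real_one[symmetric] using that by (intro eq_matI) (auto simp: diag_real_def)
    then show ?thesis using UU by (simp only: right_mult_one_mat[OF U(1)])
  qed
  have dd: "d i * (1 / sqrt (d i) * (1 / sqrt (d i))) = 1" "(1 / sqrt (d i) * (1 / sqrt (d i))) * d i = 1" if "i < n" for i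
    using d[OF that] by simp_all
  have AB: "A * (B * B) = 1\<^sub>m n"
    unfolding B_def mult Ad by (rule one, rule dd)
  have BA: "(B * B) * A = 1\<^sub>m n"
    unfolding B_def mult Ad by (rule one, rule dd)
  have "inv_sqrt_mat A = B"
    unfolding inv_sqrt_mat_def
  proof (rule the_equality)
    show "B \<in> carrier_mat (dim_row A) (dim_row A) \<and> psd_mat B \<and> inverts_mat A (B * B) \<and> inverts_mat (B * B) A"
      using B psdB AB BA carrier_matD(1)[OF mult_carrier_mat[OF B B]]
      unfolding inverts_mat_def carrier_matD(1)[OF A(1)] by (simp only: simp_thms)
    fix C assume C: "C \<in> carrier_mat (dim_row A) (dim_row A) \<and> psd_mat C \<and> inverts_mat A (C * C) \<and> inverts_mat (C * C) A"
    then have Cc: "C \<in> carrier_mat n n" "psd_mat C" "A * (C * C) = 1\<^sub>m n"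
      unfolding inverts_mat_def carrier_matD(1)[OF A(1)] by simp_all
    have CC: "C * C \<in> carrier_mat n n" by (rule mult_carrier_mat[OF Cc(1) Cc(1)])
    have BB: "B * B \<in> carrier_mat n n" by (rule mult_carrier_mat[OF B B])
    have "C * C = (B * B) * A * (C * C)" unfolding BA by (rule left_mult_one_mat[OF CC, symmetric])
    also have "\<dots> = (B * B) * (A * (C * C))" by (rule assoc_mult_mat[OF BB A(1) CC])
    finally have "C * C = B * B" unfolding Cc(3) by (simp only: right_mult_one_mat[OF BB])
    then show "C = B" using psd_square_root_unique[OF Cc(1,2) B psdB _ A(1) Cc(3) n] by simp
  qed
  then show "inv_sqrt_mat A \<in> carrier_mat n n" "psd_mat (inv_sqrt_mat A)" "A * (inv_sqrt_mat A * inv_sqrt_mat A) = 1\<^sub>m n"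
    using B psdB AB by auto
qed

text \<open>The supremum is taken over a set that is bounded by the sum of the moduli of all entries.\<close>

lemma op_norm_bound:
  assumes T: "T \<in> carrier_mat n m" and v: "v \<in> carrier_vec m"
  shows "l2_vec (T *\<^sub>v v) \<le> op_norm T * l2_vec v"
proof -
  let ?S = "{v \<in> carrier_vec (dim_col T). l2_vec v \<le> 1}"
  define M where "M = (\<Sum>i<n. \<Sum>j<m. cmod (T $$ (i, j)))"
  have bnd: "l2_vec (T *\<^sub>v x) \<le> M" if x: "x \<in> ?S" for x
  proof -
    have xc: "x \<in> carrier_vec m" "l2_vec x \<le> 1" using x T by auto
    have xj: "cmod (vec_index x j) \<le> 1" if "j < m" for j
    proof -
      have "cmod (vec_index x j) \<le> l2_vec x"
        unfolding l2_vec_L2_set using that xc by (intro member_le_L2_set) auto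
      then show ?thesis using xc by simp
    qed
    have "l2_vec (T *\<^sub>v x) \<le> (\<Sum>i<n. cmod (vec_index (T *\<^sub>v x) i))"
      unfolding l2_vec_L2_set using T by (simp add: L2_set_le_sum del: index_mult_mat_vec)
    also have "\<dots> \<le> M" unfolding M_def
    proof (rule sum_mono)
      fix i assume "i \<in> {..<n}"
      then have "vec_index (T *\<^sub>v x) i = (\<Sum>j<m. T $$ (i, j) * vec_index x j)"
        by (intro mult_mat_vec_index[OF T xc(1)]) simp
      also have "cmod \<dots> \<le> (\<Sum>j<m. cmod (T $$ (i, j)) * 1)"
        using xj by (intro sum_norm_le) (auto simp: norm_mult intro: mult_left_le)
      finally show "cmod (vec_index (T *\<^sub>v x) i) \<le> (\<Sum>j<m. cmod (T $$ (i, j)))" by simp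
    qed
    finally show ?thesis .
  qed
  have up: "l2_vec (T *\<^sub>v x) \<le> op_norm T" if "x \<in> ?S" for x
    unfolding op_norm_def using bnd that by (intro cSUP_upper bdd_aboveI2[where M = M])
  show ?thesis
  proof (cases "l2_vec v = 0")
    case True
    then have "v = 0\<^sub>v m" using l2_vec_eq_0[of v] v by simp
    then have "T *\<^sub>v v = 0\<^sub>v n" using T by auto
    then show ?thesis using True by (simp add: l2_vec_def)
  next
    case False
    have scale: "l2_vec (complex_of_real c \<cdot>\<^sub>v x) = \<bar>c\<bar> * l2_vec x" for c x
    proof -
      have "L2_set (\<lambda>i. cmod (vec_index (complex_of_real c \<cdot>\<^sub>v x) i)) {..<dim_vec x}
          = L2_set (\<lambda>i. \<bar>c\<bar> * cmod (vec_index x i)) {..<dim_vec x}"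
        by (intro L2_set_cong) (auto simp: norm_mult)
      then show ?thesis unfolding l2_vec_L2_set by (simp add: L2_set_right_distrib)
    qed
    have pos: "l2_vec v > 0" using False l2_vec_nonneg[of v] by simp
    let ?x = "complex_of_real (1 / l2_vec v) \<cdot>\<^sub>v v"
    have "?x \<in> ?S" using T v pos unfolding mem_Collect_eq scale by auto
    from up[OF this] have "l2_vec (complex_of_real (1 / l2_vec v) \<cdot>\<^sub>v (T *\<^sub>v v)) \<le> op_norm T"
      using mult_mat_vec[OF T v, of "complex_of_real (1 / l2_vec v)"] by simp
    then show ?thesis unfolding scale using pos by (simp add: field_simps)
  qed
qed

text \<open>With \<open>w = A\<^bsup>-1/2\<^esup> v\<close> one has \<open>\<langle>A' w, w\<rangle> = |v|\<^sup>2 - \<langle>(I - A\<^bsup>-1/2\<^esup> A' A\<^bsup>-1/2\<^esup>) v, v\<rangle> \<ge> \<gamma> |v|\<^sup>2\<close>,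
and \<open>|v|\<^sup>2 = \<langle>A w, w\<rangle>\<close>.\<close>

theorem relative_perturbation:
  assumes A: "A \<in> carrier_mat n n" "psd_mat A" "invertible_mat A" and n: "n > 0" and A': "A' \<in> carrier_mat n n"
    and op: "op_norm (1\<^sub>m n - inv_sqrt_mat A * A' * inv_sqrt_mat A) \<le> 1 - \<gamma>" and \<gamma>: "\<gamma> > 0"
    and w: "w \<in> carrier_vec n"
  shows "\<gamma> * min_eigenvalue A * (l2_vec w)\<^sup>2 \<le> Re ((A' *\<^sub>v w) \<bullet>c w)"
proof -
  define B where "B = inv_sqrt_mat A"
  have B: "B \<in> carrier_mat n n" "psd_mat B" "A * (B * B) = 1\<^sub>m n"
    using inv_sqrt_mat_properties[OF A n] by (auto simp: B_def)
  have hB: "mat_adjoint B = B" using B by (simp add: psd_mat_def)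
  have hA: "mat_adjoint A = A" using A by (simp add: psd_mat_def)
  have AB: "A * B \<in> carrier_mat n n" and BA: "B * A \<in> carrier_mat n n"
    by (rule mult_carrier_mat[OF A(1) B(1)], rule mult_carrier_mat[OF B(1) A(1)])
  have "(A * B) * B = 1\<^sub>m n" using assoc_mult_mat[OF A(1) B(1) B(1)] B(3) by (simp only:)
  from mat_mult_left_right_inverse[OF AB B(1) this]
  have BAB: "B * (A * B) = 1\<^sub>m n" .
  define v where "v = (A * B) *\<^sub>v w"
  have v: "v \<in> carrier_vec n" unfolding v_def by (rule mult_mat_vec_carrier[OF AB w])
  have Bv: "B *\<^sub>v v = w"
    unfolding v_def assoc_mult_mat_vec[OF B(1) AB w, symmetric] BAB by (rule one_mult_mat_vec[OF w])
  have ABBA: "A * B = B * A"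
  proof -
    have "B * A = B * A * (B * (A * B))" unfolding BAB by (rule right_mult_one_mat[OF BA, symmetric])
    also have "\<dots> = B * A * B * (A * B)" by (rule assoc_mult_mat[OF BA B(1) AB, symmetric])
    also have "B * A * B = B * (A * B)" by (rule assoc_mult_mat[OF B(1) A(1) B(1)])
    finally show ?thesis unfolding BAB by (simp only: left_mult_one_mat[OF AB])
  qed
  have Aw: "A *\<^sub>v w \<in> carrier_vec n" by (rule mult_mat_vec_carrier[OF A(1) w])
  have vv: "v \<bullet>c v = (A *\<^sub>v w) \<bullet>c w"
  proof -
    have "v \<bullet>c v = (B *\<^sub>v (A *\<^sub>v w)) \<bullet>c v"
      unfolding assoc_mult_mat_vec[OF B(1) A(1) w, symmetric] ABBA[symmetric] v_def[symmetric] ..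
    also have "\<dots> = (A *\<^sub>v w) \<bullet>c (B *\<^sub>v v)" using cscalar_prod_adjoint[OF B(1) Aw v] hB by simp
    finally show ?thesis unfolding Bv .
  qed
  have BA': "B * A' \<in> carrier_mat n n" by (rule mult_carrier_mat[OF B(1) A'])
  have BA'B: "B * A' * B \<in> carrier_mat n n" by (rule mult_carrier_mat[OF BA' B(1)])
  let ?T = "1\<^sub>m n - B * A' * B"
  have T: "?T \<in> carrier_mat n n" by (rule minus_carrier_mat[OF BA'B])
  have A'w: "A' *\<^sub>v w \<in> carrier_vec n" by (rule mult_mat_vec_carrier[OF A' w])
  have Bv': "(B * A' * B) *\<^sub>v v = B *\<^sub>v (A' *\<^sub>v w)"
    unfolding assoc_mult_mat_vec[OF BA' B(1) v] Bv assoc_mult_mat_vec[OF B(1) A' w] ..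
  have q: "((B * A' * B) *\<^sub>v v) \<bullet>c v = (A' *\<^sub>v w) \<bullet>c w"
    unfolding Bv' using cscalar_prod_adjoint[OF B(1) A'w v] hB Bv by simp
  have Tv: "?T *\<^sub>v v = v - (B * A' * B) *\<^sub>v v"
    unfolding minus_mult_distrib_mat_vec[OF one_carrier_mat BA'B v] one_mult_mat_vec[OF v] ..
  have "(?T *\<^sub>v v) \<bullet>c v = v \<bullet>c v - ((B * A' * B) *\<^sub>v v) \<bullet>c v"
    unfolding Tv using v by (intro minus_scalar_prod_distrib[OF v mult_mat_vec_carrier[OF BA'B v]]) simp
  then have "(A' *\<^sub>v w) \<bullet>c w = v \<bullet>c v - (?T *\<^sub>v v) \<bullet>c v" using q by simp
  then have "Re ((A' *\<^sub>v w) \<bullet>c w) = (l2_vec v)\<^sup>2 - Re ((?T *\<^sub>v v) \<bullet>c v)" by (simp add: cscalar_prod_self)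
  moreover have "Re ((?T *\<^sub>v v) \<bullet>c v) \<le> (1 - \<gamma>) * (l2_vec v)\<^sup>2"
  proof -
    have "Re ((?T *\<^sub>v v) \<bullet>c v) \<le> l2_vec (?T *\<^sub>v v) * l2_vec v"
      using complex_Re_le_cmod[of "(?T *\<^sub>v v) \<bullet>c v"] cscalar_prod_le[OF carrier_vecD[OF mult_mat_vec_carrier[OF T v]] carrier_vecD[OF v]]
      by linarith
    also have "\<dots> \<le> (op_norm ?T * l2_vec v) * l2_vec v"
      by (intro mult_right_mono op_norm_bound[OF T v] l2_vec_nonneg)
    also have "\<dots> \<le> ((1 - \<gamma>) * l2_vec v) * l2_vec v"
      using op unfolding B_def[symmetric] by (intro mult_right_mono l2_vec_nonneg)
    finally show ?thesis by (simp add: power2_eq_square)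
  qed
  moreover have "min_eigenvalue A * (l2_vec w)\<^sup>2 \<le> (l2_vec v)\<^sup>2"
    using min_eigenvalue_quadratic_form[OF A(1) hA w] unfolding vv[symmetric] cscalar_prod_self by simp
  then have "\<gamma> * (min_eigenvalue A * (l2_vec w)\<^sup>2) \<le> \<gamma> * (l2_vec v)\<^sup>2"
    using \<gamma> by (intro mult_left_mono) auto
  ultimately show ?thesis by (simp add: algebra_simps)
qed

section \<open>Pseudo-inverses of matrices of full rank\<close>

text \<open>\<open>M\<^sup>* M\<close> is invertible with Hermitian inverse \<open>G\<close>, and \<open>M G\<close> satisfies the four Penrose equations,
which have at most one solution.\<close>

lemma penrose_inverse_full_rank:
  fixes M :: "complex mat"
  assumes M: "M \<in> carrier_mat N n" and inj: "\<And>y. y \<in> carrier_vec n \<Longrightarrow> M *\<^sub>v y = 0\<^sub>v N \<Longrightarrow> y = 0\<^sub>v n"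
  obtains G where "G \<in> carrier_mat n n" "penrose_inverse (mat_adjoint M) = M * G"
    "mat_adjoint M * (M * G) = 1\<^sub>m n"
proof -
  let ?A = "mat_adjoint M"
  have A: "?A \<in> carrier_mat n N" using M by (rule mat_adjoint_carrier)
  have H: "?A * M \<in> carrier_mat n n" by (rule mult_carrier_mat[OF A M])
  have hH: "mat_adjoint (?A * M) = ?A * M" using mat_adjoint_mult[OF A M] by simp
  have "det (?A * M) \<noteq> 0"
  proof
    assume "det (?A * M) = 0"
    then obtain y where y: "y \<in> carrier_vec n" "y \<noteq> 0\<^sub>v n" "(?A * M) *\<^sub>v y = 0\<^sub>v n"
      using det_0_iff_vec_prod_zero_field[OF H] by blast
    have My: "M *\<^sub>v y \<in> carrier_vec N" by (rule mult_mat_vec_carrier[OF M y(1)])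
    have "(M *\<^sub>v y) \<bullet>c (M *\<^sub>v y) = (?A *\<^sub>v (M *\<^sub>v y)) \<bullet>c y"
      using cscalar_prod_adjoint[OF A My y(1)] by simp
    also have "?A *\<^sub>v (M *\<^sub>v y) = 0\<^sub>v n" using y(3) assoc_mult_mat_vec[OF A M y(1)] by simp
    finally have "(M *\<^sub>v y) \<bullet>c (M *\<^sub>v y) = 0" using y(1) by simp
    then have "l2_vec (M *\<^sub>v y) = 0" unfolding cscalar_prod_self by simp
    then have "M *\<^sub>v y = 0\<^sub>v N" using l2_vec_eq_0[of "M *\<^sub>v y"] unfolding carrier_vecD[OF My] by blast
    then show False using inj[OF y(1)] y(2) by simp
  qed
  from det_non_zero_imp_unit[OF H this, of "()"]
  obtain G where G: "G \<in> carrier_mat n n" "(?A * M) * G = 1\<^sub>m n" "G * (?A * M) = 1\<^sub>m n"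
    unfolding Units_def ring_mat_def by auto
  have G': "mat_adjoint G \<in> carrier_mat n n" using G(1) by (rule mat_adjoint_carrier)
  have hG: "mat_adjoint G = G"
  proof -
    have "mat_adjoint G * (?A * M) = 1\<^sub>m n"
      using mat_adjoint_mult[OF H G(1)] hH G(2) by simp
    then have "mat_adjoint G * ((?A * M) * G) = G"
      using assoc_mult_mat[OF G' H G(1)] G(1) by simp
    then show ?thesis unfolding G(2) by (simp only: right_mult_one_mat[OF G'])
  qed
  define X where "X = M * G"
  have X: "X \<in> carrier_mat N n" unfolding X_def by (rule mult_carrier_mat[OF M G(1)])
  have AX: "?A * X = 1\<^sub>m n" unfolding X_def using assoc_mult_mat[OF A M G(1)] G(2) by simp
  have XA: "X * ?A \<in> carrier_mat N N" by (rule mult_carrier_mat[OF X A])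
  have hXA: "mat_adjoint (X * ?A) = X * ?A"
  proof -
    have "mat_adjoint (X * ?A) = M * mat_adjoint X" using mat_adjoint_mult[OF X A] by simp
    also have "mat_adjoint X = G * ?A" unfolding X_def using mat_adjoint_mult[OF M G(1)] hG by simp
    finally show ?thesis unfolding X_def using assoc_mult_mat[OF M G(1) A] by simp
  qed
  have "penrose_inverse ?A = X"
    unfolding penrose_inverse_def
  proof (rule the_equality)
    show "X \<in> carrier_mat (dim_col ?A) (dim_row ?A) \<and> ?A * X * ?A = ?A \<and> X * ?A * X = X
      \<and> mat_adjoint (?A * X) = ?A * X \<and> mat_adjoint (X * ?A) = X * ?A"
      using X A M AX hXA assoc_mult_mat[OF X A X] by auto
    fix Y assume Y': "Y \<in> carrier_mat (dim_col ?A) (dim_row ?A) \<and> ?A * Y * ?A = ?A \<and> Y * ?A * Y = Y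
      \<and> mat_adjoint (?A * Y) = ?A * Y \<and> mat_adjoint (Y * ?A) = Y * ?A"
    then have Y: "Y \<in> carrier_mat N n" and Y1: "?A * Y * ?A = ?A" and Y2: "Y * ?A * Y = Y"
      and Y4: "mat_adjoint (Y * ?A) = Y * ?A" using M by auto
    have AY: "?A * Y \<in> carrier_mat n n" and YA: "Y * ?A \<in> carrier_mat N N"
      by (rule mult_carrier_mat[OF A Y], rule mult_carrier_mat[OF Y A])
    have "?A * Y = ?A * Y * (?A * X)" unfolding AX by (rule right_mult_one_mat[OF AY, symmetric])
    also have "\<dots> = ?A * Y * ?A * X" by (rule assoc_mult_mat[OF AY A X, symmetric])
    finally have AY1: "?A * Y = 1\<^sub>m n" unfolding Y1 AX .
    have "X * ?A * (Y * ?A) = X * ?A * Y * ?A" by (rule assoc_mult_mat[OF XA Y A, symmetric])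
    also have "X * ?A * Y = X * (?A * Y)" by (rule assoc_mult_mat[OF X A Y])
    finally have e1: "X * ?A * (Y * ?A) = X * ?A" unfolding AY1 by (simp only: right_mult_one_mat[OF X])
    have "mat_adjoint (X * ?A * (Y * ?A)) = Y * ?A * (X * ?A)"
      unfolding mat_adjoint_mult[OF XA YA] hXA Y4 ..
    also have "\<dots> = Y * ?A * X * ?A" by (rule assoc_mult_mat[OF YA X A, symmetric])
    also have "Y * ?A * X = Y * (?A * X)" by (rule assoc_mult_mat[OF Y A X])
    finally have e2: "X * ?A = Y * ?A" unfolding e1 hXA AX by (simp only: right_mult_one_mat[OF Y])
    have "Y = Y * ?A * X" unfolding assoc_mult_mat[OF Y A X] AX by (rule right_mult_one_mat[OF Y, symmetric])
    also have "\<dots> = X * ?A * X" unfolding e2 ..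
    also have "\<dots> = X" unfolding assoc_mult_mat[OF X A X] AX by (rule right_mult_one_mat[OF X])
    finally show "Y = X" .
  qed
  from that[OF G(1) this[unfolded X_def] AX[unfolded X_def]] show ?thesis .
qed

text \<open>Let \<open>w\<close> be the conjugate of the first \<open>s\<close> entries of the row vector \<open>b M G\<close>, extended by zero, so that \<open>|w|\<^sup>2\<close>
is the sum to be bounded and equals \<open>b (M G w) \<le> |b| |M G w|\<close>. With \<open>y = G w\<close> and \<open>M\<^sup>* M y = w\<close>,
\<open>|M y|\<^sup>2 = \<langle>y, w\<rangle>\<close> involves only the first \<open>s\<close> entries of \<open>y\<close>, so the lower bound on \<open>M\<close>
for these entries gives \<open>|M y| \<le> \<kappa> |w|\<close>.\<close>

lemma penrose_column_bound:
  fixes M G :: "complex mat"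
  assumes M: "M \<in> carrier_mat N n" and G: "G \<in> carrier_mat n n" and inv: "mat_adjoint M * (M * G) = 1\<^sub>m n"
    and s: "s \<le> n" and \<kappa>: "\<kappa> \<ge> 0"
    and lower: "\<And>y. y \<in> carrier_vec n \<Longrightarrow> (\<Sum>j<s. (cmod (vec_index y j))\<^sup>2) \<le> \<kappa>\<^sup>2 * (l2_vec (M *\<^sub>v y))\<^sup>2"
  shows "(\<Sum>j<s. (cmod (\<Sum>k<N. b k * (M * G) $$ (k, j)))\<^sup>2) \<le> \<kappa>\<^sup>2 * (\<Sum>k<N. (cmod (b k))\<^sup>2)"
proof -
  define X where "X = M * G"
  have X: "X \<in> carrier_mat N n" unfolding X_def by (rule mult_carrier_mat[OF M G])
  define err where "err j = (\<Sum>k<N. b k * X $$ (k, j))" for j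
  define w where "w = Matrix.vec n (\<lambda>j. if j < s then cnj (err j) else 0)"
  define y where "y = G *\<^sub>v w"
  define z where "z = M *\<^sub>v y"
  have w: "w \<in> carrier_vec n" by (simp add: w_def)
  have y: "y \<in> carrier_vec n" unfolding y_def by (rule mult_mat_vec_carrier[OF G w])
  have z: "z \<in> carrier_vec N" unfolding z_def by (rule mult_mat_vec_carrier[OF M y])
  have zX: "z = X *\<^sub>v w" unfolding z_def y_def X_def using assoc_mult_mat_vec[OF M G w] by (simp only:)
  have Mz: "mat_adjoint M *\<^sub>v z = w"
  proof -
    have "mat_adjoint M *\<^sub>v z = (mat_adjoint M * X) *\<^sub>v w"
      unfolding zX by (rule assoc_mult_mat_vec[OF mat_adjoint_carrier[OF M] X w, symmetric])
    then show ?thesis unfolding X_def inv by (simp only: one_mult_mat_vec[OF w])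
  qed
  have restrict: "(\<Sum>j<n. if j < s then F j else 0) = (\<Sum>j<s. F j)" for F :: "nat \<Rightarrow> complex"
  proof -
    have "(\<Sum>j<n. if j < s then F j else 0) = (\<Sum>j\<in>{..<n} \<inter> {j. j < s}. F j)"
      by (simp add: sum.inter_restrict)
    also have "{..<n} \<inter> {j. j < s} = {..<s}" using s by auto
    finally show ?thesis .
  qed
  have lw: "(l2_vec w)\<^sup>2 = (\<Sum>j<s. (cmod (err j))\<^sup>2)"
  proof -
    have "(l2_vec w)\<^sup>2 = (\<Sum>j<n. if j < s then (cmod (err j))\<^sup>2 else 0)"
      unfolding l2_vec_square carrier_vecD[OF w] by (intro sum.cong) (auto simp: w_def)
    also have "\<dots> = (\<Sum>j\<in>{..<n} \<inter> {j. j < s}. (cmod (err j))\<^sup>2)"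
      by (simp add: sum.inter_restrict)
    also have "{..<n} \<inter> {j. j < s} = {..<s}" using s by auto
    finally show ?thesis .
  qed
  have zz: "(l2_vec z)\<^sup>2 \<le> l2_vec w * (\<kappa> * l2_vec z)"
  proof -
    have "z \<bullet>c z = y \<bullet>c w" using cscalar_prod_adjoint[OF M y z] unfolding Mz z_def[symmetric] .
    also have "\<dots> = (\<Sum>j<n. if j < s then vec_index y j * err j else 0)"
      unfolding cscalar_prod_sum[OF carrier_vecD[OF w]] by (intro sum.cong) (auto simp: w_def)
    finally have e: "complex_of_real ((l2_vec z)\<^sup>2) = (\<Sum>j<s. vec_index y j * err j)"
      unfolding cscalar_prod_self restrict .
    have "(l2_vec z)\<^sup>2 = cmod (complex_of_real ((l2_vec z)\<^sup>2))"
      unfolding norm_of_real by simp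
    also have "\<dots> \<le> (\<Sum>j<s. cmod (err j) * cmod (vec_index y j))"
      unfolding e by (intro sum_norm_le) (simp add: norm_mult mult.commute)
    also have "\<dots> \<le> L2_set (\<lambda>j. cmod (err j)) {..<s} * L2_set (\<lambda>j. cmod (vec_index y j)) {..<s}"
      using L2_set_mult_ineq[of "\<lambda>j. cmod (err j)" "\<lambda>j. cmod (vec_index y j)" "{..<s}"] by simp
    also have "L2_set (\<lambda>j. cmod (err j)) {..<s} = l2_vec w"
      unfolding L2_set_def lw[symmetric] using l2_vec_nonneg by simp
    also have "l2_vec w * L2_set (\<lambda>j. cmod (vec_index y j)) {..<s} \<le> l2_vec w * (\<kappa> * l2_vec z)"
    proof (intro mult_left_mono l2_vec_nonneg)
      have "L2_set (\<lambda>j. cmod (vec_index y j)) {..<s} \<le> sqrt (\<kappa>\<^sup>2 * (l2_vec z)\<^sup>2)"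
        unfolding L2_set_def z_def by (intro real_sqrt_le_mono lower y)
      then show "L2_set (\<lambda>j. cmod (vec_index y j)) {..<s} \<le> \<kappa> * l2_vec z"
        using \<kappa> l2_vec_nonneg[of z] by (simp add: real_sqrt_mult)
    qed
    finally show ?thesis .
  qed
  have lz: "l2_vec z \<le> \<kappa> * l2_vec w"
  proof (cases "l2_vec z = 0")
    case True
    then show ?thesis using \<kappa> l2_vec_nonneg[of w] by simp
  next
    case False
    then have pos: "l2_vec z > 0" using l2_vec_nonneg[of z] by simp
    have "l2_vec z * l2_vec z \<le> (\<kappa> * l2_vec w) * l2_vec z" using zz by (simp only: power2_eq_square mult_ac)
    then show ?thesis using pos by (rule mult_right_le_imp_le)
  qed
  let ?b = "L2_set (\<lambda>k. cmod (b k)) {..<N}"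
  have "(l2_vec w)\<^sup>2 \<le> ?b * l2_vec z"
  proof -
    have "complex_of_real ((l2_vec w)\<^sup>2) = (\<Sum>j<n. if j < s then err j * cnj (err j) else 0)"
      unfolding restrict lw by (simp only: of_real_sum complex_norm_square)
    also have "\<dots> = (\<Sum>j<n. err j * vec_index w j)"
      by (intro sum.cong) (auto simp: w_def)
    also have "\<dots> = (\<Sum>k<N. b k * (\<Sum>j<n. X $$ (k, j) * vec_index w j))"
      unfolding err_def sum_distrib_left sum_distrib_right by (subst sum.swap) (simp add: mult.assoc)
    also have "\<dots> = (\<Sum>k<N. b k * vec_index z k)"
      unfolding zX using mult_mat_vec_index[OF X w] by (intro sum.cong) auto
    finally have e: "complex_of_real ((l2_vec w)\<^sup>2) = (\<Sum>k<N. b k * vec_index z k)" .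
    have "(l2_vec w)\<^sup>2 = cmod (complex_of_real ((l2_vec w)\<^sup>2))"
      unfolding norm_of_real by simp
    also have "\<dots> \<le> (\<Sum>k<N. cmod (b k) * cmod (vec_index z k))"
      unfolding e by (intro sum_norm_le) (simp add: norm_mult)
    also have "\<dots> \<le> ?b * L2_set (\<lambda>k. cmod (vec_index z k)) {..<N}"
      using L2_set_mult_ineq[of "\<lambda>k. cmod (b k)" "\<lambda>k. cmod (vec_index z k)" "{..<N}"] by simp
    also have "L2_set (\<lambda>k. cmod (vec_index z k)) {..<N} = l2_vec z" unfolding l2_vec_L2_set using z by simp
    finally show ?thesis .
  qed
  also have "\<dots> \<le> ?b * (\<kappa> * l2_vec w)" by (intro mult_left_mono lz L2_set_nonneg)
  finally have ww: "(l2_vec w)\<^sup>2 \<le> ?b * \<kappa> * l2_vec w" by simp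
  have "l2_vec w \<le> ?b * \<kappa>"
  proof (cases "l2_vec w = 0")
    case True
    then show ?thesis using \<kappa> by (simp add: L2_set_nonneg)
  next
    case False
    then have pos: "l2_vec w > 0" using l2_vec_nonneg[of w] by simp
    have "l2_vec w * l2_vec w \<le> (?b * \<kappa>) * l2_vec w" using ww by (simp only: power2_eq_square)
    then show ?thesis using pos by (rule mult_right_le_imp_le)
  qed
  then have "(l2_vec w)\<^sup>2 \<le> (?b * \<kappa>)\<^sup>2" using l2_vec_nonneg by (intro power_mono) auto
  also have "\<dots> = \<kappa>\<^sup>2 * (\<Sum>k<N. (cmod (b k))\<^sup>2)"
    by (simp add: power_mult_distrib L2_set_def sum_nonneg)
  finally show ?thesis unfolding lw err_def X_def .
qed

section \<open>Moment matrices\<close>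

lemma continuous_mpow: "continuous_on S (\<lambda>z :: complex^'d. mpow z a)"
  unfolding mpow_def by (intro continuous_intros)

lemma moment_mat_carrier: "moment_mat \<alpha> n M \<in> carrier_mat (rdim CARD('d) n) (rdim CARD('d) n)"
  for \<alpha> :: "nat \<Rightarrow> 'd::finite \<Rightarrow> nat"
  by (simp add: moment_mat_def)

lemma moment_mat_adjoint: "mat_adjoint (moment_mat \<alpha> n M) = moment_mat \<alpha> n M"
proof (rule eq_matI)
  fix i j assume "i < dim_row (moment_mat \<alpha> n M)" "j < dim_col (moment_mat \<alpha> n M)"
  then have ij: "i < rdim CARD('a) n" "j < rdim CARD('a) n" by (auto simp: moment_mat_def)
  have "cnj (LINT z|M. cnj (mpow z (\<alpha> j)) * mpow z (\<alpha> i)) = (LINT z|M. cnj (cnj (mpow z (\<alpha> j)) * mpow z (\<alpha> i)))"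
    by (rule Bochner_Integration.integral_cnj[symmetric])
  then show "mat_adjoint (moment_mat \<alpha> n M) $$ (i, j) = moment_mat \<alpha> n M $$ (i, j)"
    using ij by (simp add: moment_mat_def mult.commute)
qed (auto simp: moment_mat_def)

lemma moment_mat_quadratic_form:
  fixes \<alpha> :: "nat \<Rightarrow> 'd::finite \<Rightarrow> nat"
  assumes int: "\<And>i j. integrable M (\<lambda>z. cnj (mpow z (\<alpha> i)) * mpow z (\<alpha> j))"
    and y: "y \<in> carrier_vec (rdim CARD('d) n)"
  shows "(moment_mat \<alpha> n M *\<^sub>v y) \<bullet>c y
    = complex_of_real (LINT z|M. (cmod (\<Sum>j<rdim CARD('d) n. vec_index y j * mpow z (\<alpha> j)))\<^sup>2)"
proof -
  let ?r = "rdim CARD('d) n"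
  let ?P = "\<lambda>z. \<Sum>j<?r. vec_index y j * mpow z (\<alpha> j)"
  have "(moment_mat \<alpha> n M *\<^sub>v y) \<bullet>c y = (\<Sum>i<?r. vec_index (moment_mat \<alpha> n M *\<^sub>v y) i * cnj (vec_index y i))"
    by (rule cscalar_prod_sum[OF carrier_vecD[OF y]])
  also have "\<dots> = (\<Sum>i<?r. \<Sum>j<?r. (LINT z|M. cnj (mpow z (\<alpha> i)) * mpow z (\<alpha> j)) * (vec_index y j * cnj (vec_index y i)))"
  proof (intro sum.cong refl)
    fix i assume i: "i \<in> {..<?r}"
    show "vec_index (moment_mat \<alpha> n M *\<^sub>v y) i * cnj (vec_index y i)
      = (\<Sum>j<?r. (LINT z|M. cnj (mpow z (\<alpha> i)) * mpow z (\<alpha> j)) * (vec_index y j * cnj (vec_index y i)))"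
      unfolding mult_mat_vec_index[OF moment_mat_carrier y i[unfolded lessThan_iff]] sum_distrib_right
      using i by (intro sum.cong) (auto simp: moment_mat_def)
  qed
  also have "\<dots> = (\<Sum>i<?r. \<Sum>j<?r. (LINT z|M. cnj (mpow z (\<alpha> i)) * mpow z (\<alpha> j) * (vec_index y j * cnj (vec_index y i))))"
    by simp
  also have "\<dots> = (LINT z|M. (\<Sum>i<?r. \<Sum>j<?r. cnj (mpow z (\<alpha> i)) * mpow z (\<alpha> j) * (vec_index y j * cnj (vec_index y i))))"
    using int by simp
  also have "\<dots> = (LINT z|M. complex_of_real ((cmod (?P z))\<^sup>2))"
  proof (intro Bochner_Integration.integral_cong refl)
    fix z
    have "complex_of_real ((cmod (?P z))\<^sup>2) = cnj (?P z) * ?P z"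
      by (simp only: complex_norm_square mult.commute)
    also have "\<dots> = (\<Sum>i<?r. \<Sum>j<?r. cnj (vec_index y i * mpow z (\<alpha> i)) * (vec_index y j * mpow z (\<alpha> j)))"
      by (simp only: cnj_sum sum_product)
    also have "\<dots> = (\<Sum>i<?r. \<Sum>j<?r. cnj (mpow z (\<alpha> i)) * mpow z (\<alpha> j) * (vec_index y j * cnj (vec_index y i)))"
      by (intro sum.cong refl) simp
    finally show "(\<Sum>i<?r. \<Sum>j<?r. cnj (mpow z (\<alpha> i)) * mpow z (\<alpha> j) * (vec_index y j * cnj (vec_index y i)))
      = complex_of_real ((cmod (?P z))\<^sup>2)" by simp
  qed
  finally show ?thesis by (simp only: integral_complex_of_real)
qed

lemma moment_mat_psd:
  fixes \<alpha> :: "nat \<Rightarrow> 'd::finite \<Rightarrow> nat"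
  assumes "prob_space \<mu>" "sets \<mu> = sets borel" "compact S" "emeasure \<mu> S = 1"
  shows "psd_mat (moment_mat \<alpha> n \<mu>)"
proof -
  interpret prob_space \<mu> by fact
  have AE: "AE z in \<mu>. z \<in> S"
    by (rule AE_prob_1) (simp add: measure_def assms(4))
  have int: "integrable \<mu> (\<lambda>z. cnj (mpow z (\<alpha> i)) * mpow z (\<alpha> j))" for i j
  proof -
    have cont: "continuous_on UNIV (\<lambda>z. cnj (mpow z (\<alpha> i)) * mpow z (\<alpha> j))"
      by (intro continuous_intros continuous_mpow)
    obtain B where "\<forall>z\<in>S. cmod (cnj (mpow z (\<alpha> i)) * mpow z (\<alpha> j)) \<le> B"
      using compact_continuous_bound[OF assms(3) continuous_on_subset[OF cont subset_UNIV]] by (elim exE conjE) (rule that)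
    then have "AE z in \<mu>. cmod (cnj (mpow z (\<alpha> i)) * mpow z (\<alpha> j)) \<le> B"
      using AE by (auto elim!: eventually_mono)
    moreover have "(\<lambda>z. cnj (mpow z (\<alpha> i)) * mpow z (\<alpha> j)) \<in> borel_measurable \<mu>"
      using borel_measurable_continuous_onI[OF cont] measurable_cong_sets[OF assms(2) refl] by blast
    ultimately show ?thesis by (rule integrable_const_bound)
  qed
  have "Re ((moment_mat \<alpha> n \<mu> *\<^sub>v y) \<bullet>c y) \<ge> 0" if "y \<in> carrier_vec (rdim CARD('d) n)" for y
    unfolding moment_mat_quadratic_form[OF int that] by simp
  then show ?thesis
    unfolding psd_mat_def moment_mat_adjoint using carrier_matD[OF moment_mat_carrier[of \<alpha> n \<mu>]] by auto
qed

text \<open>The image of the uniform probability measure on the index set; in this form the integral is known.\<close>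

lemma empirical_eq_distr:
  assumes "N \<ge> 1"
  shows "empirical N x = distr (uniform_count_measure {..<N}) borel x"
proof -
  let ?D = "distr (uniform_count_measure {..<N}) borel x"
  have eq: "ennreal (1 / real N) * (\<Sum>i<N. emeasure (return borel (x i)) A) = emeasure ?D A" if A: "A \<in> sets borel" for A
  proof -
    let ?I = "{i\<in>{..<N}. x i \<in> A}"
    have "(\<Sum>i<N. emeasure (return borel (x i)) A) = (\<Sum>i<N. ennreal (if x i \<in> A then 1 else 0))"
      using A by (intro sum.cong) (auto simp: indicator_def)
    also have "\<dots> = ennreal (\<Sum>i<N. if x i \<in> A then 1 else 0)" by (intro sum_ennreal) auto
    also have "(\<Sum>i<N. if x i \<in> A then 1 else 0) = real (card ?I)"
      by (simp add: sum.If_cases Int_def)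
    finally have l: "(\<Sum>i<N. emeasure (return borel (x i)) A) = ennreal (real (card ?I))" .
    have "emeasure ?D A = emeasure (uniform_count_measure {..<N}) (x -` A \<inter> space (uniform_count_measure {..<N}))"
      using A by (intro emeasure_distr) (auto simp: uniform_count_measure_def measurable_def space_point_measure sets_point_measure)
    also have "x -` A \<inter> space (uniform_count_measure {..<N}) = ?I"
      by (auto simp: space_uniform_count_measure)
    also have "emeasure (uniform_count_measure {..<N}) ?I = ennreal (real (card ?I) / real N)"
      by (subst emeasure_uniform_count_measure) auto
    finally show ?thesis unfolding l by (simp add: ennreal_mult[symmetric])
  qed
  have "empirical N x = measure_of (space ?D) (sets ?D) (emeasure ?D)"
    unfolding empirical_def space_distr sets_distr space_borel
    by (rule measure_of_eq) (use eq sets.sigma_sets_eq[of "borel :: 'a measure"] in \<open>auto simp: space_borel\<close>)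
  then show ?thesis unfolding measure_of_of_measure .
qed

lemma integral_empirical:
  fixes g :: "'a::topological_space \<Rightarrow> 'b::{banach, second_countable_topology}"
  assumes "N \<ge> 1" "g \<in> borel_measurable borel"
  shows "integrable (empirical N x) g" "(LINT z|empirical N x. g z) = (\<Sum>i<N. g (x i)) /\<^sub>R real N"
proof -
  have x: "x \<in> measurable (uniform_count_measure {..<N}) borel"
    by (auto simp: uniform_count_measure_def measurable_def space_point_measure sets_point_measure)
  show "integrable (empirical N x) g"
    unfolding empirical_eq_distr[OF assms(1)] integrable_distr_eq[OF x assms(2)]
    by (simp add: uniform_count_measure_def integrable_point_measure_finite)
  have "(LINT z|empirical N x. g z) = (LINT i|uniform_count_measure {..<N}. g (x i))"
    unfolding empirical_eq_distr[OF assms(1)] by (rule integral_distr[OF x assms(2)])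
  also have "\<dots> = (\<Sum>i<N. (1 / real N) *\<^sub>R g (x i))"
    unfolding uniform_count_measure_def by (subst lebesgue_integral_point_measure_finite) auto
  finally show "(LINT z|empirical N x. g z) = (\<Sum>i<N. g (x i)) /\<^sub>R real N"
    by (simp add: scaleR_sum_right divide_inverse)
qed

lemma empirical_quadratic_form:
  fixes \<alpha> :: "nat \<Rightarrow> 'd::finite \<Rightarrow> nat"
  assumes "N \<ge> 1" and y: "y \<in> carrier_vec (rdim CARD('d) n)"
  shows "Re ((moment_mat \<alpha> n (empirical N x) *\<^sub>v y) \<bullet>c y)
    = (\<Sum>k<N. (cmod (\<Sum>j<rdim CARD('d) n. vec_index y j * mpow (x k) (\<alpha> j)))\<^sup>2) / real N"
proof -
  have "integrable (empirical N x) (\<lambda>z. cnj (mpow z (\<alpha> i)) * mpow z (\<alpha> j))" for i j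
    by (intro integral_empirical(1)[OF assms(1)] borel_measurable_continuous_onI continuous_intros continuous_mpow)
  from moment_mat_quadratic_form[OF this y]
  have "Re ((moment_mat \<alpha> n (empirical N x) *\<^sub>v y) \<bullet>c y)
      = (LINT z|empirical N x. (cmod (\<Sum>j<rdim CARD('d) n. vec_index y j * mpow z (\<alpha> j)))\<^sup>2)" by simp
  also have "\<dots> = (\<Sum>k<N. (cmod (\<Sum>j<rdim CARD('d) n. vec_index y j * mpow (x k) (\<alpha> j)))\<^sup>2) /\<^sub>R real N"
    by (intro integral_empirical(2)[OF assms(1)] borel_measurable_continuous_onI continuous_intros continuous_mpow)
  finally show ?thesis by (simp add: divide_inverse mult.commute)
qed

lemma mfact_le_fact_mdeg: "mfact a \<le> fact (mdeg a)"
proof -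
  have "(\<Prod>i\<in>S. fact (a i)) \<le> (fact (\<Sum>i\<in>S. a i) :: nat)" if "finite S" for S
    using that
  proof (induction S rule: finite_induct)
    case (insert i S)
    have "(\<Prod>j\<in>insert i S. fact (a j)) = fact (a i) * (\<Prod>j\<in>S. fact (a j) :: nat)" using insert.hyps by simp
    also have "\<dots> \<le> fact (a i) * fact (\<Sum>j\<in>S. a j)" using insert.IH by simp
    also have "\<dots> \<le> fact (a i + (\<Sum>j\<in>S. a j))"
      by (intro dvd_imp_le fact_fact_dvd_fact) simp
    finally show ?case using insert.hyps by simp
  qed simp
  then show ?thesis unfolding mfact_def mdeg_def by simp
qed

lemma rdim_pos: "rdim d n > 0"
  by (simp add: rdim_def zero_less_binomial)

lemma rdim_mono: "m \<le> n \<Longrightarrow> rdim CARD('d::finite) m \<le> rdim CARD('d) n"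
  unfolding card_mdeg_le[symmetric] by (intro card_mono finite_mdeg_le) auto

section \<open>The error estimate\<close>

text \<open>Up to the factors \<open>exp (herm (p + x k) p)\<close>, of modulus bounded below by \<open>c0\<close> after normalisation, the
sample matrix applied to \<open>y\<close> evaluates the polynomial with coefficients \<open>w\<^sub>j = y\<^sub>j / sqrt (\<alpha>\<^sub>j!)\<close> at the sample points,
and the mean square of these values is the empirical quadratic form at \<open>w\<close>. Summing only over degrees at
most \<open>m\<close> on the left costs the factor \<open>m!\<close>.\<close>

lemma sample_mat_lower_bound:
  fixes \<alpha> :: "nat \<Rightarrow> 'd::finite \<Rightarrow> nat" and p :: "complex^'d"
  assumes \<alpha>: "numbering \<alpha>" and "m \<le> n" and N: "N \<ge> 1"
    and c0: "c0 > 0" "\<And>k. k < N \<Longrightarrow> c0 \<le> exp (- (norm p)\<^sup>2 / 2) * cmod (exp (herm (p + x k) p))"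
    and L: "L > 0" "\<And>w. w \<in> carrier_vec (rdim CARD('d) n) \<Longrightarrow>
        L * (l2_vec w)\<^sup>2 \<le> Re ((moment_mat \<alpha> n (empirical N x) *\<^sub>v w) \<bullet>c w)"
    and y: "y \<in> carrier_vec (rdim CARD('d) n)"
  shows "(\<Sum>j<rdim CARD('d) m. (cmod (vec_index y j))\<^sup>2)
    \<le> fact m / (c0\<^sup>2 * real N * L) * (l2_vec (sample_mat \<alpha> p n N (\<lambda>k. p + x k) *\<^sub>v y))\<^sup>2"
proof -
  let ?r = "rdim CARD('d) n" and ?s = "rdim CARD('d) m"
  let ?M = "sample_mat \<alpha> p n N (\<lambda>k. p + x k)"
  have M: "?M \<in> carrier_mat N ?r" by (simp add: sample_mat_def)
  define w where "w = Matrix.vec ?r (\<lambda>j. vec_index y j / complex_of_real (sqrt (real (mfact (\<alpha> j)))))"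
  have w: "w \<in> carrier_vec ?r" by (simp add: w_def)
  have sr: "?s \<le> ?r" by (rule rdim_mono[OF assms(2)])
  have entry: "vec_index (?M *\<^sub>v y) k = complex_of_real (exp (- (norm p)\<^sup>2 / 2)) * exp (herm (p + x k) p)
      * (\<Sum>j<?r. vec_index w j * mpow (x k) (\<alpha> j))" if k: "k < N" for k
    unfolding mult_mat_vec_index[OF M y k] sum_distrib_left
    using k by (intro sum.cong) (auto simp: sample_mat_def fock_basis_def w_def)
  have "(\<Sum>j<?s. (cmod (vec_index y j))\<^sup>2) \<le> (\<Sum>j<?s. fact m * (cmod (vec_index w j))\<^sup>2)"
  proof (rule sum_mono)
    fix j assume "j \<in> {..<?s}"
    then have j: "j < ?s" "j < ?r" using sr by auto
    have "mfact (\<alpha> j) \<le> fact (mdeg (\<alpha> j))" by (rule mfact_le_fact_mdeg)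
    also have "\<dots> \<le> fact m" using j numbering_less_iff[OF \<alpha>] by (intro fact_mono) blast
    finally have "real (mfact (\<alpha> j)) \<le> fact m" by (metis of_nat_fact of_nat_le_iff)
    moreover have "(cmod (vec_index y j))\<^sup>2 = real (mfact (\<alpha> j)) * (cmod (vec_index w j))\<^sup>2"
      using j mfact_pos[of "\<alpha> j"] by (simp add: w_def norm_divide power_divide)
    ultimately show "(cmod (vec_index y j))\<^sup>2 \<le> fact m * (cmod (vec_index w j))\<^sup>2"
      by (simp add: mult_right_mono)
  qed
  also have "\<dots> \<le> (\<Sum>j<?r. fact m * (cmod (vec_index w j))\<^sup>2)"
    using sr by (intro sum_mono2) auto
  also have "\<dots> = fact m * (l2_vec w)\<^sup>2"
    unfolding l2_vec_square carrier_vecD[OF w] sum_distrib_left ..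
  finally have 1: "(\<Sum>j<?s. (cmod (vec_index y j))\<^sup>2) \<le> fact m * (l2_vec w)\<^sup>2" .
  let ?Q = "\<Sum>k<N. (cmod (\<Sum>j<?r. vec_index w j * mpow (x k) (\<alpha> j)))\<^sup>2"
  have "L * (l2_vec w)\<^sup>2 \<le> ?Q / real N"
    using L(2)[OF w] unfolding empirical_quadratic_form[OF N w] .
  then have 2: "L * real N * (l2_vec w)\<^sup>2 \<le> ?Q" using N by (simp add: field_simps)
  have "c0\<^sup>2 * ?Q \<le> (l2_vec (?M *\<^sub>v y))\<^sup>2"
  proof -
    have "c0\<^sup>2 * ?Q = (\<Sum>k<N. (c0 * cmod (\<Sum>j<?r. vec_index w j * mpow (x k) (\<alpha> j)))\<^sup>2)"
      unfolding sum_distrib_left by (simp only: power_mult_distrib)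
    also have "\<dots> \<le> (\<Sum>k<N. (cmod (vec_index (?M *\<^sub>v y) k))\<^sup>2)"
    proof (intro sum_mono power_mono)
      fix k assume "k \<in> {..<N}"
      then have k: "k < N" by simp
      show "c0 * cmod (\<Sum>j<?r. vec_index w j * mpow (x k) (\<alpha> j)) \<le> cmod (vec_index (?M *\<^sub>v y) k)"
        unfolding entry[OF k] norm_mult norm_of_real using c0(2)[OF k] by (simp add: mult_right_mono)
    qed (use c0(1) in simp)
    also have "\<dots> = (l2_vec (?M *\<^sub>v y))\<^sup>2" unfolding l2_vec_square using M by (simp del: index_mult_mat_vec)
    finally show ?thesis .
  qed
  with 2 have 3: "c0\<^sup>2 * (L * real N * (l2_vec w)\<^sup>2) \<le> (l2_vec (?M *\<^sub>v y))\<^sup>2"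
    using mult_left_mono[OF 2, of "c0\<^sup>2"] by simp
  have pos: "c0\<^sup>2 * real N * L > 0" using c0(1) L(1) N by simp
  have "(l2_vec w)\<^sup>2 \<le> (l2_vec (?M *\<^sub>v y))\<^sup>2 / (c0\<^sup>2 * real N * L)"
    using 3 pos by (simp add: pos_le_divide_eq mult_ac)
  then have "fact m * (l2_vec w)\<^sup>2 \<le> fact m * ((l2_vec (?M *\<^sub>v y))\<^sup>2 / (c0\<^sup>2 * real N * L))"
    by (intro mult_left_mono) auto
  with 1 show ?thesis by simp
qed

context abs_convex_body
begin

text \<open>Substitute the expansion of \<open>fock (f p) b \<circ> f\<close> into \<open>V\<^sup>*\<close>. The part in the span of the basis
functions is multiplied by \<open>U\<^sup>* (U\<^sup>*)\<^sup>\<dagger> = I\<close> and reproduces the entry of \<open>C_mat\<close>.\<close>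

lemma estimator_error_entry:
  fixes g f :: "complex^'d \<Rightarrow> complex^'r" and \<alpha> :: "nat \<Rightarrow> 'd \<Rightarrow> nat" and \<beta> :: "nat \<Rightarrow> 'r \<Rightarrow> nat"
  assumes g: "hol_map_on U g" and U: "open U" "K \<subseteq> U" and fg: "\<forall>z\<in>K. g z = f z"
    and \<alpha>: "numbering \<alpha>" and \<beta>: "numbering \<beta>" and mn: "rdim CARD('d) m \<le> rdim CARD('d) n"
    and G: "G \<in> carrier_mat (rdim CARD('d) n) (rdim CARD('d) n)"
    and X: "penrose_inverse (mat_adjoint (sample_mat \<alpha> p n N z)) = sample_mat \<alpha> p n N z * G"
    and inv: "mat_adjoint (sample_mat \<alpha> p n N z) * (sample_mat \<alpha> p n N z * G) = 1\<^sub>m (rdim CARD('d) n)"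
    and i: "i < rdim CARD('r) m" and j: "j < rdim CARD('d) m"
  shows "(C_mat \<alpha> \<beta> K f p m - C_hat \<alpha> \<beta> f p m n N z) $$ (i, j)
    = - (\<Sum>k<N. cnj (fock (f p) (\<beta> i) (f (z k))
          - (\<Sum>a | mdeg a \<le> n. fock_functional p a (\<lambda>z. fock (f p) (\<beta> i) (g z)) * fock p a (z k)))
        * (sample_mat \<alpha> p n N z * G) $$ (k, j))"
proof -
  let ?r = "rdim CARD('d) n" and ?M = "sample_mat \<alpha> p n N z" and ?V = "sample_mat \<beta> (f p) m N (\<lambda>k. f (z k))"
  let ?X = "?M * G"
  let ?D = "\<lambda>a. fock_functional p a (\<lambda>z. fock (f p) (\<beta> i) (g z))"
  let ?\<rho> = "\<lambda>k. fock (f p) (\<beta> i) (f (z k)) - (\<Sum>a | mdeg a \<le> n. ?D a * fock p a (z k))"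
  have M: "?M \<in> carrier_mat N ?r" by (simp add: sample_mat_def)
  have M': "mat_adjoint ?M \<in> carrier_mat ?r N" by (rule mat_adjoint_carrier[OF M])
  have V: "?V \<in> carrier_mat N (rdim CARD('r) m)" by (simp add: sample_mat_def)
  have V': "mat_adjoint ?V \<in> carrier_mat (rdim CARD('r) m) N" by (rule mat_adjoint_carrier[OF V])
  have Xc: "?X \<in> carrier_mat N ?r" by (rule mult_carrier_mat[OF M G])
  have jr: "j < ?r" using j mn by simp
  have sp: "cnj (fock (f p) (\<beta> i) (f (z k))) = cnj (?\<rho> k) + (\<Sum>l<?r. cnj (?D (\<alpha> l)) * mat_adjoint ?M $$ (l, k))"
    if k: "k < N" for k
  proof -
    have "(\<Sum>a | mdeg a \<le> n. ?D a * fock p a (z k)) = (\<Sum>l<?r. ?D (\<alpha> l) * fock p (\<alpha> l) (z k))"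
      by (rule sum.reindex_bij_betw[OF numbering_bij[OF \<alpha>], symmetric])
    then have "cnj (\<Sum>a | mdeg a \<le> n. ?D a * fock p a (z k)) = (\<Sum>l<?r. cnj (?D (\<alpha> l)) * cnj (fock p (\<alpha> l) (z k)))"
      by (simp only: cnj_sum complex_cnj_mult)
    also have "\<dots> = (\<Sum>l<?r. cnj (?D (\<alpha> l)) * mat_adjoint ?M $$ (l, k))"
      using k by (intro sum.cong) (auto simp: sample_mat_def fock_basis_eq)
    finally show ?thesis by (simp only: complex_cnj_diff) simp
  qed
  have "(mat_adjoint ?V * ?X) $$ (i, j) = (\<Sum>k<N. cnj (fock (f p) (\<beta> i) (f (z k))) * ?X $$ (k, j))"
    unfolding mult_mat_index[OF V' Xc i jr] using i by (intro sum.cong) (auto simp: sample_mat_def fock_basis_eq simp del: index_mult_mat)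
  also have "\<dots> = (\<Sum>k<N. cnj (?\<rho> k) * ?X $$ (k, j) + (\<Sum>l<?r. cnj (?D (\<alpha> l)) * (mat_adjoint ?M $$ (l, k) * ?X $$ (k, j))))"
  proof (intro sum.cong refl)
    fix k assume "k \<in> {..<N}"
    then have k: "k < N" by simp
    show "cnj (fock (f p) (\<beta> i) (f (z k))) * ?X $$ (k, j)
      = cnj (?\<rho> k) * ?X $$ (k, j) + (\<Sum>l<?r. cnj (?D (\<alpha> l)) * (mat_adjoint ?M $$ (l, k) * ?X $$ (k, j)))"
      unfolding sp[OF k] ring_distribs sum_distrib_right by (simp only: mult.assoc)
  qed
  also have "\<dots> = (\<Sum>k<N. cnj (?\<rho> k) * ?X $$ (k, j)) + (\<Sum>l<?r. cnj (?D (\<alpha> l)) * (\<Sum>k<N. mat_adjoint ?M $$ (l, k) * ?X $$ (k, j)))"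
    unfolding sum.distrib sum_distrib_left by (subst sum.swap) (rule refl)
  also have "(\<Sum>l<?r. cnj (?D (\<alpha> l)) * (\<Sum>k<N. mat_adjoint ?M $$ (l, k) * ?X $$ (k, j)))
      = (\<Sum>l<?r. if l = j then cnj (?D (\<alpha> j)) else 0)"
  proof (intro sum.cong refl)
    fix l assume "l \<in> {..<?r}"
    then have l: "l < ?r" by simp
    have "(\<Sum>k<N. mat_adjoint ?M $$ (l, k) * ?X $$ (k, j)) = 1\<^sub>m ?r $$ (l, j)"
      unfolding mult_mat_index[OF M' Xc l jr, symmetric] inv ..
    then show "cnj (?D (\<alpha> l)) * (\<Sum>k<N. mat_adjoint ?M $$ (l, k) * ?X $$ (k, j)) = (if l = j then cnj (?D (\<alpha> j)) else 0)"
      using l jr by simp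
  qed
  also have "\<dots> = cnj (?D (\<alpha> j))" using jr by simp
  finally have "(mat_adjoint ?V * ?X) $$ (i, j) = (\<Sum>k<N. cnj (?\<rho> k) * ?X $$ (k, j)) + cnj (?D (\<alpha> j))" .
  then have "C_hat \<alpha> \<beta> f p m n N z $$ (i, j) = (\<Sum>k<N. cnj (?\<rho> k) * ?X $$ (k, j)) + cnj (?D (\<alpha> j))"
    unfolding C_hat_def Let_def X using i j by (simp del: index_mult_mat)
  moreover have "C_mat \<alpha> \<beta> K f p m $$ (i, j) = cnj (?D (\<alpha> j))"
    unfolding C_mat_eq[OF g U fg \<alpha> \<beta>] using i j by simp
  moreover have "C_hat \<alpha> \<beta> f p m n N z \<in> carrier_mat (rdim CARD('r) m) (rdim CARD('d) m)"
    by (simp add: C_hat_def Let_def)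
  ultimately show ?thesis using i j by simp
qed

end

theorem theorem4p7:
  fixes p :: "complex^'d" and K0 K :: "(complex^'d) set"
    and f :: "complex^'d \<Rightarrow> complex^'r" and \<mu> :: "(complex^'d) measure"
  defines "K \<equiv> (\<lambda>x. p + x) ` K0"
  assumes "\<forall>i. p $ i \<in> \<real>"
    and "compact K0" and "abs_convex K0" and "0 \<in> interior K0"
    and "analytic_map_on K f"
    and "prob_space \<mu>" and "sets \<mu> = sets borel" and "emeasure \<mu> K0 = 1" and "msupp \<mu> \<subseteq> K0"
  shows "\<exists>C>0. \<forall>(\<alpha> :: nat \<Rightarrow> 'd \<Rightarrow> nat) (\<beta> :: nat \<Rightarrow> 'r \<Rightarrow> nat) (m::nat) (n::nat) (N::nat)
            (z0 :: nat \<Rightarrow> complex^'d) (\<gamma>::real).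
      numbering \<alpha> \<longrightarrow> numbering \<beta> \<longrightarrow> m \<le> n \<longrightarrow> N \<ge> 1 \<longrightarrow> (\<forall>i<N. z0 i \<in> msupp \<mu>) \<longrightarrow>
      invertible_mat (moment_mat \<alpha> n \<mu>) \<longrightarrow> 0 < \<gamma> \<longrightarrow> \<gamma> < 1 \<longrightarrow>
      op_norm (1\<^sub>m (rdim CARD('d) n)
        - inv_sqrt_mat (moment_mat \<alpha> n \<mu>) * moment_mat \<alpha> n (empirical N z0)
            * inv_sqrt_mat (moment_mat \<alpha> n \<mu>)) \<le> 1 - \<gamma> \<longrightarrow>
      frob_norm (C_mat \<alpha> \<beta> K f p m - C_hat \<alpha> \<beta> f p m n N (\<lambda>i. p + z0 i))
        \<le> C * sqrt (fact m / \<gamma>)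
            * ((SUP x\<in>msupp \<mu>. minkowski_gauge K0 x) ^ n / sqrt (min_eigenvalue (moment_mat \<alpha> n \<mu>)))"
proof -
  interpret body: abs_convex_body p K0 by unfold_locales fact+
  have K: "body.K = K" unfolding body.K_def K_def ..
  obtain U g where U: "open U" "K \<subseteq> U" and g: "hol_map_on U g" and fg: "\<forall>z\<in>K. g z = f z"
    using \<open>analytic_map_on K f\<close> unfolding analytic_map_on_def by (elim exE conjE) (rule that)
  note hyps = g U(1) U(2)[folded K] fg[folded K]
  let ?gauge = "minkowski_gauge K0" and ?R = "SUP x\<in>msupp \<mu>. minkowski_gauge K0 x"
  define \<rho> where "\<rho> n b x = fock (f p) b (f (p + x))
      - (\<Sum>a | mdeg a \<le> n. fock_functional p a (\<lambda>z. fock (f p) b (g z)) * fock p a (p + x))" for n :: nat and b x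
  have "\<exists>C>0. \<forall>m n. \<forall>x\<in>K0. (\<Sum>b | mdeg b \<le> m. (cmod (\<rho> n b x))\<^sup>2) \<le> (C * ?gauge x ^ n)\<^sup>2"
    unfolding \<rho>_def by (rule body.fock_expansion_remainder[OF hyps])
  then obtain C1 where C1: "C1 > 0"
    "\<forall>m n. \<forall>x\<in>K0. (\<Sum>b | mdeg b \<le> m. (cmod (\<rho> n b x))\<^sup>2) \<le> (C1 * ?gauge x ^ n)\<^sup>2"
    by (elim exE conjE) (rule that)
  obtain M0 where M0: "M0 > 0" "\<forall>x\<in>K0. cmod (exp (- herm x p)) \<le> M0"
  proof -
    have "continuous_on K0 (\<lambda>x. exp (0 * 0 + (-1) * herm x p))"
      by (intro hol_on_continuous hol_on_exp hol_on_lincomb hol_on_const hol_on_herm)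
    from compact_continuous_bound[OF \<open>compact K0\<close> this] that show ?thesis by auto
  qed
  \<comment> \<open>A lower bound, over the body, for the modulus of the factors common to all basis functions.\<close>
  define c0 where "c0 = exp (- (norm p)\<^sup>2 / 2) * cmod (exp (herm p p)) / M0"
  have c0: "c0 > 0" unfolding c0_def using M0(1) by simp
  have c0_le: "c0 \<le> exp (- (norm p)\<^sup>2 / 2) * cmod (exp (herm (p + x) p))" if "x \<in> K0" for x
  proof -
    have "cmod (exp (- herm x p)) * cmod (exp (herm x p)) = 1"
      unfolding norm_mult[symmetric] exp_add[symmetric] by simp
    moreover have "cmod (exp (- herm x p)) * cmod (exp (herm x p)) \<le> M0 * cmod (exp (herm x p))"
      using M0(2) that by (intro mult_right_mono) auto
    ultimately have "1 / M0 \<le> cmod (exp (herm x p))" using M0(1) by (simp add: field_simps)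
    then have "exp (- (norm p)\<^sup>2 / 2) * cmod (exp (herm p p)) * (1 / M0)
        \<le> exp (- (norm p)\<^sup>2 / 2) * cmod (exp (herm p p)) * cmod (exp (herm x p))"
      by (intro mult_left_mono) auto
    then show ?thesis by (simp add: c0_def herm_add_left exp_add norm_mult mult.assoc)
  qed
  have main: "frob_norm (C_mat \<alpha> \<beta> K f p m - C_hat \<alpha> \<beta> f p m n N (\<lambda>i. p + z0 i))
        \<le> C1 / c0 * sqrt (fact m / \<gamma>) * (?R ^ n / sqrt (min_eigenvalue (moment_mat \<alpha> n \<mu>)))"
    if \<alpha>: "numbering \<alpha>" and \<beta>: "numbering \<beta>" and mn: "m \<le> n" and N: "N \<ge> 1" and z0: "\<forall>i<N. z0 i \<in> msupp \<mu>"
      and inv: "invertible_mat (moment_mat \<alpha> n \<mu>)" and \<gamma>: "0 < \<gamma>"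
      and op: "op_norm (1\<^sub>m (rdim CARD('d) n)
        - inv_sqrt_mat (moment_mat \<alpha> n \<mu>) * moment_mat \<alpha> n (empirical N z0)
            * inv_sqrt_mat (moment_mat \<alpha> n \<mu>)) \<le> 1 - \<gamma>"
    for \<alpha> :: "nat \<Rightarrow> 'd \<Rightarrow> nat" and \<beta> :: "nat \<Rightarrow> 'r \<Rightarrow> nat" and m n N z0 \<gamma>
  proof -
    let ?r = "rdim CARD('d) n" and ?s = "rdim CARD('d) m" and ?l = "rdim CARD('r) m"
    let ?A = "moment_mat \<alpha> n \<mu>" and ?z = "\<lambda>i. p + z0 i"
    let ?M = "sample_mat \<alpha> p n N ?z" and ?\<Lambda> = "min_eigenvalue (moment_mat \<alpha> n \<mu>)"
    have zK: "z0 k \<in> K0" if "k < N" for k using z0 \<open>msupp \<mu> \<subseteq> K0\<close> that by blast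
    have psd: "psd_mat ?A" by (rule moment_mat_psd) fact+
    have \<Lambda>: "?\<Lambda> > 0" by (rule inv_sqrt_mat_properties(4)[OF moment_mat_carrier psd inv rdim_pos])
    have L: "\<gamma> * ?\<Lambda> > 0" using \<gamma> \<Lambda> by simp
    have lower: "\<gamma> * ?\<Lambda> * (l2_vec w)\<^sup>2 \<le> Re ((moment_mat \<alpha> n (empirical N z0) *\<^sub>v w) \<bullet>c w)"
      if "w \<in> carrier_vec ?r" for w
      by (rule relative_perturbation[OF moment_mat_carrier psd inv rdim_pos moment_mat_carrier op \<gamma> that])
    have bound: "(\<Sum>j<rdim CARD('d) m'. (cmod (vec_index y j))\<^sup>2)
        \<le> fact m' / (c0\<^sup>2 * real N * (\<gamma> * ?\<Lambda>)) * (l2_vec (?M *\<^sub>v y))\<^sup>2"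
      if "m' \<le> n" "y \<in> carrier_vec ?r" for m' y
      by (rule sample_mat_lower_bound[OF \<alpha> that(1) N c0 c0_le[OF zK] L lower that(2)])
    have M: "?M \<in> carrier_mat N ?r" by (simp add: sample_mat_def)
    have sr: "?s \<le> ?r" by (rule rdim_mono[OF mn])
    obtain G where G: "G \<in> carrier_mat ?r ?r" "penrose_inverse (mat_adjoint ?M) = ?M * G" "mat_adjoint ?M * (?M * G) = 1\<^sub>m ?r"
    proof (rule penrose_inverse_full_rank[OF M])
      fix y assume y: "y \<in> carrier_vec ?r" "?M *\<^sub>v y = 0\<^sub>v N"
      have "(l2_vec y)\<^sup>2 \<le> fact n / (c0\<^sup>2 * real N * (\<gamma> * ?\<Lambda>)) * (l2_vec (0\<^sub>v N))\<^sup>2"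
        using bound[OF order_refl y(1)] unfolding y(2) l2_vec_square[of y] carrier_vecD[OF y(1)] .
      also have "\<dots> = 0" by (simp add: l2_vec_def)
      finally have "l2_vec y = 0" by simp
      then show "y = 0\<^sub>v ?r" using l2_vec_eq_0[of y] unfolding carrier_vecD[OF y(1)] by simp
    qed (rule that)
    define \<kappa> where "\<kappa> = sqrt (fact m / (c0\<^sup>2 * real N * (\<gamma> * ?\<Lambda>)))"
    have nonneg: "0 \<le> fact m / (c0\<^sup>2 * real N * (\<gamma> * ?\<Lambda>))"
      using \<gamma> \<Lambda> by (intro divide_nonneg_nonneg mult_nonneg_nonneg) (simp_all only: fact_ge_zero zero_le_power2 of_nat_0_le_iff less_imp_le)
    have \<kappa>2: "\<kappa>\<^sup>2 = fact m / (c0\<^sup>2 * real N * (\<gamma> * ?\<Lambda>))" and \<kappa>0: "\<kappa> \<ge> 0"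
      unfolding \<kappa>_def by (rule real_sqrt_pow2[OF nonneg], rule real_sqrt_ge_zero[OF nonneg])
    have gauge: "0 \<le> ?gauge (z0 k)" "?gauge (z0 k) \<le> ?R" if "k < N" for k
    proof -
      show "0 \<le> ?gauge (z0 k)" using body.minkowski_gauge_bounds(1)[OF zK[OF that]] .
      have "bdd_above (?gauge ` msupp \<mu>)"
        by (intro bdd_aboveI2[where M = 1] body.minkowski_gauge_bounds(2) subsetD[OF \<open>msupp \<mu> \<subseteq> K0\<close>])
      then show "?gauge (z0 k) \<le> ?R" using z0[rule_format, OF that] by (intro cSUP_upper)
    qed
    have R: "0 \<le> ?R" using gauge[of 0] N by linarith
    let ?E = "C_mat \<alpha> \<beta> K f p m - C_hat \<alpha> \<beta> f p m n N ?z"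
    have dims: "dim_row ?E = ?l" "dim_col ?E = ?s"
      by (simp_all add: C_hat_def Let_def)
    have entry: "cmod (?E $$ (i, j)) = cmod (\<Sum>k<N. cnj (\<rho> n (\<beta> i) (z0 k)) * (?M * G) $$ (k, j))" if "i < ?l" "j < ?s" for i j
      using body.estimator_error_entry[OF hyps \<alpha> \<beta> sr G that] unfolding K \<rho>_def by (simp only: norm_minus_cancel)
    have "(\<Sum>i<?l. \<Sum>j<?s. (cmod (?E $$ (i, j)))\<^sup>2)
        \<le> (\<Sum>i<?l. \<kappa>\<^sup>2 * (\<Sum>k<N. (cmod (\<rho> n (\<beta> i) (z0 k)))\<^sup>2))"
    proof (rule sum_mono)
      fix i assume "i \<in> {..<?l}"
      then have "(\<Sum>j<?s. (cmod (?E $$ (i, j)))\<^sup>2) = (\<Sum>j<?s. (cmod (\<Sum>k<N. cnj (\<rho> n (\<beta> i) (z0 k)) * (?M * G) $$ (k, j)))\<^sup>2)"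
        using entry by (intro sum.cong) auto
      also have "\<dots> \<le> \<kappa>\<^sup>2 * (\<Sum>k<N. (cmod (cnj (\<rho> n (\<beta> i) (z0 k))))\<^sup>2)"
        by (rule penrose_column_bound[OF M G(1,3) sr \<kappa>0]) (unfold \<kappa>2, rule bound[OF mn])
      finally show "(\<Sum>j<?s. (cmod (?E $$ (i, j)))\<^sup>2) \<le> \<kappa>\<^sup>2 * (\<Sum>k<N. (cmod (\<rho> n (\<beta> i) (z0 k)))\<^sup>2)" by simp
    qed
    also have "\<dots> = \<kappa>\<^sup>2 * (\<Sum>k<N. \<Sum>i<?l. (cmod (\<rho> n (\<beta> i) (z0 k)))\<^sup>2)"
      unfolding sum_distrib_left[symmetric] by (subst sum.swap) (rule refl)
    also have "\<dots> \<le> \<kappa>\<^sup>2 * (\<Sum>k<N. (C1 * ?R ^ n)\<^sup>2)"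
    proof (intro mult_left_mono sum_mono)
      fix k assume "k \<in> {..<N}"
      then have k: "k < N" by simp
      have "(\<Sum>i<?l. (cmod (\<rho> n (\<beta> i) (z0 k)))\<^sup>2) = (\<Sum>b | mdeg b \<le> m. (cmod (\<rho> n b (z0 k)))\<^sup>2)"
        by (rule sum.reindex_bij_betw[OF numbering_bij[OF \<beta>]])
      also have "\<dots> \<le> (C1 * ?gauge (z0 k) ^ n)\<^sup>2" using C1(2) zK[OF k] by blast
      also have "\<dots> \<le> (C1 * ?R ^ n)\<^sup>2"
        using C1(1) gauge[OF k] by (intro power_mono mult_left_mono) auto
      finally show "(\<Sum>i<?l. (cmod (\<rho> n (\<beta> i) (z0 k)))\<^sup>2) \<le> (C1 * ?R ^ n)\<^sup>2" .
    qed simp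
    also have "\<dots> = (C1 / c0 * sqrt (fact m / \<gamma>) * (?R ^ n / sqrt ?\<Lambda>))\<^sup>2"
      unfolding \<kappa>2 using c0 N \<gamma> \<Lambda> by (simp add: power_mult_distrib power_divide mult_ac)
    finally have "frob_norm ?E \<le> sqrt ((C1 / c0 * sqrt (fact m / \<gamma>) * (?R ^ n / sqrt ?\<Lambda>))\<^sup>2)"
      unfolding frob_norm_def dims by (rule real_sqrt_le_mono)
    also have "\<dots> = C1 / c0 * sqrt (fact m / \<gamma>) * (?R ^ n / sqrt ?\<Lambda>)"
      unfolding real_sqrt_abs using C1(1) c0 \<gamma> \<Lambda> R by (intro abs_of_nonneg mult_nonneg_nonneg divide_nonneg_nonneg) auto
    finally show ?thesis .
  qed
  show ?thesis
  proof (intro exI[of _ "C1 / c0"] conjI allI impI)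
    show "C1 / c0 > 0" using C1(1) c0 by simp
  qed (rule main)
qed

end
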